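(* Assume (H1)--(H5), with the coarse kernel, fine grid and events $\mathcal G_{R,v}(z_0)$ as in the context. There is an exponent $p$ with $\max\{1,d/2\}<p<d$, not depending on $v$ or $R$, with conjugate exponent $q'=p/(p-1)$, such that the following holds. Fix $C_*$ sufficiently large (for example $C_*=1024$), let $z_0$ be a fixed deterministic center, $D_R=B_{C_*R}(z_0)$, let $Z_n=X_{S_n}$ where $S_n$ are the cumulative actual coarse stopping times, $\tau_D=\inf\{n\ge0:Z_n\notin D_R\}$, and define the Green measure killed at coarse endpoints by \[ \nu^x(E)=\mathbf E_x\sum_{n<\tau_D}\mathbf1_E(Z_n), \] with fine-grid density $n^x$. For each fixed $v\in(0,1/2]$ (and $R$ sufficiently large depending on $v$), on the event $\mathcal G_{R,v}(z_0)$, simultaneously for all $x\in B_R(z_0)$, \[ \nu^x(\mathbb R^d)\le CR^2,\qquad \|n^x\|_{L^{q'}(B_{2R}(z_0))}\le C L^{d/p}R^{2-d/p},\qquad L=R^v. \] Consequently, for every measurable source $F$ supported in $B_{2R}(z_0)$ and dominated on the fine cells by a nonnegative array $F_Q$ (that is, $|F|\le F_Q$ on $Q$), one has \[ R^{-2}\sup_{x\in B_R(z_0)}\int|F|\,d\nu^x\le C L^{d/p}\left(R^{-d}\sum_{Q\cap B_{2R}(z_0)\ne\varnothing}|Q|F_Q^p\right)^{1/p}. \] This inequality holds simultaneously for all sources and all poles $x\in B_R(z_0)$ in the same environment.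
   Context: Setting. $d\ge2$; matrices carry the Frobenius norm and pairing $M:N=\operatorname{tr}(M^{\mathsf T}N)$; $B_r(x)$ is an open ball. The probability space is the canonical space of continuous symmetric matrix fields $A=A(x,\omega)$ on $\mathbb R^d$ (locally uniform topology, Borel $\sigma$-algebra); translations satisfy $A(x,\tau_z\omega)=A(x+z,\omega)$; law $\mathbb P$, expectation $\mathbb E$. Assumptions: (H1) almost surely, for every $x$, $A(x)=A(x)^{\mathsf T}$, $0<A(x)\le I$. (H2) Every $\tau_z$ preserves $\mathbb P$. (H3) There is $\ell<\infty$ such that $\sigma(A|_U)$, $\sigma(A|_V)$ are independent for deterministic Borel $U,V$ with $\operatorname{dist}(U,V)>\ell$. (H4) For $F(M,x,\omega)=-A(x,\omega):M$, the family $\{F(\cdot,\cdot,\omega)\}_\omega$ is uniformly equicontinuous on $\{|M|\le K\}\times\mathbb R^d$ for every $K<\infty$, and $|F(M,x,\omega)-F(M,y,\omega)|\le\rho((1+|M|)|x-y|^\sigma)$ for a deterministic continuous modulus $\rho$ and some $\sigma>1/2$. (H5) With $\lambda=\lambda_{\min}(A)$, $\lambda_*(z)=\inf_{B_1(z)}\lambda$, $\mathbb E[\lambda_*(0)^{-d}]<\infty$. Constants are deterministic and may depend on the law of $A$ and on the fixed parameters below, but not on $R$, the pole or the source. Bad clusters. Let $\kappa>0$ be fixed sufficiently small depending only on the law. For $k\in\mathbb Z^d$ put $Q_k=k+[-1/2,1/2)^d$, $\widehat Q_k=k+[-3,3]^d$; $k$ is bad if $\inf_{\widehat Q_k}\lambda<\kappa$.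 Let $\mathcal C(k)$ be the cluster of bad sites containing $k$, adjacency meaning $\ell^\infty$-distance one (empty if $k$ is good), and $H_k=1+|\mathcal C(k)|$. The choice of $\kappa$ ensures $\mathbb P(H_k\ge n)\le Ce^{-cn}$, so that almost surely all bad clusters are finite and all connected components of $W=\{x:\inf_{\overline B_2(x)}\lambda<\kappa\}$ are bounded. Coarse kernel and process. Let $a=\operatorname{tr}A$, $B=A/a$, and let $X$ be the diffusion with generator $B:D^2$ in the fixed environment, with quenched law $\mathbf P_x$ and expectation $\mathbf E_x$. One coarse step from $x$: if $x\in W$ first run $X$ until it exits the component of $W$ containing $x$, at a point $Y$; if $x\notin W$ put $Y=x$; then run $X$ until $|X_t-Y|=1$; call $S$ the total elapsed time. $K(x,E)=\mathbf P_x(X_S\in E)$, $\mathcal L=K-I$. Iterating gives stopping times $0=S_0<S_1<\cdots$ and the coarse chain $Z_n=X_{S_n}$, $Z_0=x$. $K$ has zero drift and covariance $\ge a_cI$, $a_c=\kappa/d$. Fine grid. Let $h_0=1/N_0$ with a fixed large integer $N_0$, $h_0\sqrt d\le a_c/8$; $\mathcal Q$ is a partition of $\mathbb R^d$ into half-open cubes $Q$ of side $h_0$ nested in the unit grid $\{Q_k\}$. For a nonnegative locally finite measure $\nu$ its grid density is $n=\sum_{Q\in\mathcal Q}\frac{\nu(Q)}{|Q|}\mathbf1_Q$. Event. $\mathcal G_{R,v}(z_0)$ is an event determined by the bad clusters near $D_R$ (existence is a separate proposition), with $\mathbb P(\mathcal G_{R,v}(z_0)^c)\le C_v\exp\{-c_vR^{v\eta_0}\}$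 for $R\ge R_0(v)$ and a fixed $\eta_0>0$, on which: (i) with $q=d/(d-1)$, $\kappa_0=16$ and a constant $H_0$ independent of $v,R,\nu,x,r$, every nonnegative measure $\nu$ with $\int\mathcal L\phi\,d\nu\le0$ for all nonnegative $\phi\in C_c^2(D_R)$ (integrals well defined) has grid density $n$ satisfying $\big(|B_r|^{-1}\int_{B_r(x)}n^q\big)^{1/q}\le H_0|B_{\kappa_0r}|^{-1}\int_{B_{\kappa_0r}(x)}n$ for all $x$ and $r\ge L$ with $B_{\kappa_0r}(x)\subset D_R$; (ii) every coarse step path $(X_t)_{0\le t\le S}$ started in $D_R$ stays within distance $L$ of its starting point. *)

theory Defs
  imports "HOL-Probability.Probability"
begin

section \<open>The canonical space of environments\<close>

type_synonym 'n matrix_field = "real^'n \<Rightarrow> real^'n^'n"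

definition symmetric_fields :: "('n::finite) matrix_field set" where
  "symmetric_fields = {A. continuous_on UNIV A \<and> (\<forall>x. transpose (A x) = A x)}"

definition locally_uniform_topology :: "('n::finite) matrix_field topology" where
  "locally_uniform_topology = topology_generated_by
     {{A' \<in> symmetric_fields. \<forall>x\<in>K. dist (A' x) (A x) < e} | A K e.
        A \<in> symmetric_fields \<and> compact K \<and> 0 < e}"

definition matrix_field_space :: "('n::finite) matrix_field measure" where
  "matrix_field_space = sigma symmetric_fields {U. openin locally_uniform_topology U}"

definition translate :: "real^'n \<Rightarrow> ('n::finite) matrix_field \<Rightarrow> 'n matrix_field" where
  "translate z A = (\<lambda>x. A (x + z))"

text \<open>The norm and the inner product of the type \<^typ>\<open>real^'n^'n\<close> are the Frobenius norm and pairing.\<close>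

definition eigenvalues :: "real^'n^'n \<Rightarrow> real set" where
  "eigenvalues M = {c. \<exists>v. v \<noteq> 0 \<and> M *v v = c *\<^sub>R v}"

definition lambda_min :: "real^'n^'n \<Rightarrow> real" where
  "lambda_min M = Min (eigenvalues M)"

definition field_events :: "(real^'n) set \<Rightarrow> ('n::finite) matrix_field set set" where
  "field_events U = sigma_sets symmetric_fields
     {(\<lambda>A. A x) -` E \<inter> symmetric_fields | x E. x \<in> U \<and> E \<in> sets borel}"

definition H1 :: "('n::finite) matrix_field measure \<Rightarrow> bool" where
  "H1 P \<longleftrightarrow> (AE A in P. \<forall>x. transpose (A x) = A x \<and>
     (\<forall>v. v \<noteq> 0 \<longrightarrow> 0 < v \<bullet> (A x *v v)) \<and> (\<forall>v. v \<bullet> (A x *v v) \<le> v \<bullet> v))"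

definition H2 :: "('n::finite) matrix_field measure \<Rightarrow> bool" where
  "H2 P \<longleftrightarrow> (\<forall>z. translate z \<in> measurable P P \<and> distr P P (translate z) = P)"

text \<open>Empty sets, at infinite distance from everything but with \<^term>\<open>setdist {} V = (0::real)\<close>,
  generate the trivial \<open>\<sigma>\<close>-algebra, so they impose no condition either way.\<close>

definition H3 :: "('n::finite) matrix_field measure \<Rightarrow> bool" where
  "H3 P \<longleftrightarrow> (\<exists>l\<ge>0. \<forall>U\<in>sets borel. \<forall>V\<in>sets borel. l < setdist U V \<longrightarrow>
     prob_space.indep_set P (field_events U) (field_events V))"

definition F_op :: "('n::finite) matrix_field \<Rightarrow> real^'n^'n \<Rightarrow> real^'n \<Rightarrow> real" where
  "F_op A M x = - (A x \<bullet> M)"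

definition continuous_modulus :: "(real \<Rightarrow> real) \<Rightarrow> bool" where
  "continuous_modulus \<rho> \<longleftrightarrow> continuous_on {0..} \<rho> \<and> mono_on {0..} \<rho> \<and> \<rho> 0 = 0"

definition H4 :: "('n::finite) matrix_field measure \<Rightarrow> bool" where
  "H4 P \<longleftrightarrow>
     (\<forall>K. \<forall>e>0. \<exists>\<delta>>0. AE A in P. \<forall>M M' x y.
        norm M \<le> K \<and> norm M' \<le> K \<and> dist (M, x) (M', y) < \<delta> \<longrightarrow>
        \<bar>F_op A M x - F_op A M' y\<bar> < e) \<and>
     (\<exists>\<rho> s. continuous_modulus \<rho> \<and> 1 / 2 < s \<and>
        (AE A in P. \<forall>M x y. \<bar>F_op A M x - F_op A M y\<bar> \<le> \<rho> ((1 + norm M) * norm (x - y) powr s)))"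

text \<open>In \<^typ>\<open>ennreal\<close> the inverse of zero is infinite.\<close>

definition H5 :: "('n::finite) matrix_field measure \<Rightarrow> bool" where
  "H5 P \<longleftrightarrow>
     (\<integral>\<^sup>+A. inverse (ennreal (INF y\<in>ball 0 1. lambda_min (A y))) ^ CARD('n) \<partial>P) < \<infinity>"


section \<open>Bad clusters\<close>

definition enlarged_cube :: "int^'n \<Rightarrow> (real^'n) set" where
  "enlarged_cube k = {x. \<forall>i. of_int (k$i) - 3 \<le> x$i \<and> x$i \<le> of_int (k$i) + 3}"

definition bad :: "('n::finite) matrix_field \<Rightarrow> real \<Rightarrow> int^'n \<Rightarrow> bool" where
  "bad A \<kappa> k \<longleftrightarrow> (INF y\<in>enlarged_cube k. lambda_min (A y)) < \<kappa>"

definition adjacent :: "int^'n \<Rightarrow> int^'n \<Rightarrow> bool" where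
  "adjacent j k \<longleftrightarrow> Max (range (\<lambda>i. \<bar>j$i - k$i\<bar>)) = 1"

definition bad_cluster :: "('n::finite) matrix_field \<Rightarrow> real \<Rightarrow> int^'n \<Rightarrow> (int^'n) set" where
  "bad_cluster A \<kappa> k =
     (if bad A \<kappa> k then {j. (\<lambda>i j. bad A \<kappa> i \<and> bad A \<kappa> j \<and> adjacent i j)\<^sup>*\<^sup>* k j} else {})"

definition cluster_height :: "('n::finite) matrix_field \<Rightarrow> real \<Rightarrow> int^'n \<Rightarrow> enat" where
  "cluster_height A \<kappa> k =
     (if finite (bad_cluster A \<kappa> k) then enat (1 + card (bad_cluster A \<kappa> k)) else \<infinity>)"

text \<open>This is what ``\<open>\<kappa>\<close> sufficiently small'' ensures. Lowering \<open>\<kappa>\<close> shrinks the set of bad sites, so the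
  admissible values of \<open>\<kappa>\<close> form an interval starting at zero.\<close>

definition exponential_cluster_tail :: "('n::finite) matrix_field measure \<Rightarrow> real \<Rightarrow> bool" where
  "exponential_cluster_tail P \<kappa> \<longleftrightarrow>
     (\<exists>C>0. \<exists>c>0. \<forall>k n. measure P {A \<in> space P. enat n \<le> cluster_height A \<kappa> k} \<le> C * exp (- c * real n))"

definition degenerate_set :: "('n::finite) matrix_field \<Rightarrow> real \<Rightarrow> (real^'n) set" where
  "degenerate_set A \<kappa> = {x. (INF y\<in>cball x 2. lambda_min (A y)) < \<kappa>}"


section \<open>The quenched diffusion\<close>

definition path_space :: "(real \<Rightarrow> real^'n) measure" where
  "path_space = restrict_space (Pi\<^sub>M {0..} (\<lambda>_. borel)) {w. continuous_on {0..} w}"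

definition natural_filtration :: "ennreal \<Rightarrow> (real \<Rightarrow> real^'n) measure" where
  "natural_filtration t = sigma (space path_space)
     {(\<lambda>w. w s) -` E \<inter> space path_space | s E. 0 \<le> s \<and> ennreal s \<le> t \<and> E \<in> sets borel}"

lemma filtration_natural: "filtration (space path_space) natural_filtration"
proof
  show "space (natural_filtration t) = space path_space" for t :: ennreal
    unfolding natural_filtration_def by (intro space_measure_of) auto
  show "sets (natural_filtration s) \<le> sets (natural_filtration t)" if "s \<le> t" for s t :: ennreal
    unfolding natural_filtration_def using that
    by (subst (1 2) sets_measure_of) (auto intro!: sigma_sets_mono' intro: order_trans)
qed

definition shift_path :: "real \<Rightarrow> (real \<Rightarrow> real^'n) \<Rightarrow> real \<Rightarrow> real^'n" where
  "shift_path s w = restrict (\<lambda>t. w (s + t)) {0..}"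

definition path_martingale ::
    "(real \<Rightarrow> real^'n) measure \<Rightarrow> (real \<Rightarrow> (real \<Rightarrow> real^'n) \<Rightarrow> real) \<Rightarrow> bool" where
  "path_martingale Q M \<longleftrightarrow>
     (\<forall>t\<ge>0. integrable Q (M t) \<and> M t \<in> borel_measurable (natural_filtration (ennreal t))) \<and>
     (\<forall>s\<ge>0. \<forall>t\<ge>s. AE w in Q. real_cond_exp Q (natural_filtration (ennreal s)) (M t) w = M s w)"

definition has_gradient_hessian ::
    "(real^'n \<Rightarrow> real) \<Rightarrow> (real^'n \<Rightarrow> real^'n) \<Rightarrow> (real^'n \<Rightarrow> real^'n^'n) \<Rightarrow> bool" where
  "has_gradient_hessian \<phi> g D2 \<longleftrightarrow>
     (\<forall>x. (\<phi> has_derivative (\<lambda>h. g x \<bullet> h)) (at x)) \<and>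
     (\<forall>x. (g has_derivative (\<lambda>h. D2 x *v h)) (at x)) \<and> continuous_on UNIV D2"

definition C2_compact :: "(real^'n) set \<Rightarrow> (real^'n \<Rightarrow> real) \<Rightarrow> bool" where
  "C2_compact D \<phi> \<longleftrightarrow> (\<exists>g D2. has_gradient_hessian \<phi> g D2) \<and>
     compact (closure {x. \<phi> x \<noteq> 0}) \<and> closure {x. \<phi> x \<noteq> 0} \<subseteq> D"

text \<open>The generator is \<open>B : D\<^sup>2\<close>, without the factor one half of the usual SDE convention.\<close>

definition solves_martingale_problem ::
    "('n::finite) matrix_field \<Rightarrow> real^'n \<Rightarrow> (real \<Rightarrow> real^'n) measure \<Rightarrow> bool" where
  "solves_martingale_problem B x Q \<longleftrightarrow>
     prob_space Q \<and> sets Q = sets path_space \<and> (AE w in Q. w 0 = x) \<and>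
     (\<forall>\<phi> g D2. C2_compact UNIV \<phi> \<and> has_gradient_hessian \<phi> g D2 \<longrightarrow>
        path_martingale Q (\<lambda>t w. \<phi> (w t) - integral {0..t} (\<lambda>s. B (w s) \<bullet> D2 (w s))))"

text \<open>A diffusion is a strong Markov family of laws on continuous paths. For the coefficients used
  below (continuous, positive definite, of trace one) the martingale problem is well-posed, and its
  solutions form such a family, which is therefore unique.\<close>

definition diffusion ::
    "('n::finite) matrix_field \<Rightarrow> (real^'n \<Rightarrow> (real \<Rightarrow> real^'n) measure) \<Rightarrow> bool" where
  "diffusion B Q \<longleftrightarrow>
     Q \<in> measurable borel (prob_algebra path_space) \<and>
     (\<forall>x. solves_martingale_problem B x (Q x)) \<and>
     (\<forall>x T E \<Gamma>. stopping_time natural_filtration T \<longrightarrow>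
        E \<in> sets (filtration.pre_sigma (space path_space) natural_filtration T) \<longrightarrow>
        \<Gamma> \<in> sets path_space \<longrightarrow>
        emeasure (Q x) {w \<in> E. T w < \<infinity> \<and> shift_path (enn2real (T w)) w \<in> \<Gamma>} =
        (\<integral>\<^sup>+w. emeasure (Q (w (enn2real (T w)))) \<Gamma> * indicator {w \<in> E. T w < \<infinity>} w \<partial>Q x))"

definition normalized_field :: "('n::finite) matrix_field \<Rightarrow> 'n matrix_field" where
  "normalized_field A = (\<lambda>x. (1 / trace (A x)) *\<^sub>R A x)"


section \<open>The coarse kernel and the coarse chain\<close>

definition first_time :: "real \<Rightarrow> (real \<Rightarrow> real^'n) \<Rightarrow> (real^'n) set \<Rightarrow> ennreal" where
  "first_time s w E = (INF t\<in>{t. s \<le> t \<and> w t \<in> E}. ennreal t)"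

definition component_exit_time :: "('n::finite) matrix_field \<Rightarrow> real \<Rightarrow> (real \<Rightarrow> real^'n) \<Rightarrow> ennreal" where
  "component_exit_time A \<kappa> w =
     (if w 0 \<in> degenerate_set A \<kappa>
      then first_time 0 w (- connected_component_set (degenerate_set A \<kappa>) (w 0)) else 0)"

definition step_time :: "('n::finite) matrix_field \<Rightarrow> real \<Rightarrow> (real \<Rightarrow> real^'n) \<Rightarrow> ennreal" where
  "step_time A \<kappa> w =
     (let T = component_exit_time A \<kappa> w; Y = w (enn2real T)
      in if T = \<infinity> then \<infinity> else first_time (enn2real T) w (sphere Y 1))"

primrec coarse_time :: "('n::finite) matrix_field \<Rightarrow> real \<Rightarrow> nat \<Rightarrow> (real \<Rightarrow> real^'n) \<Rightarrow> ennreal" where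
  "coarse_time A \<kappa> 0 w = 0"
| "coarse_time A \<kappa> (Suc n) w =
     coarse_time A \<kappa> n w + step_time A \<kappa> (shift_path (enn2real (coarse_time A \<kappa> n w)) w)"

text \<open>The junk value at an infinite time (\<^term>\<open>enn2real \<infinity> = 0\<close>) only matters on a null set of paths
  when the components of \<^const>\<open>degenerate_set\<close> are bounded.\<close>

definition coarse_chain :: "('n::finite) matrix_field \<Rightarrow> real \<Rightarrow> nat \<Rightarrow> (real \<Rightarrow> real^'n) \<Rightarrow> real^'n" where
  "coarse_chain A \<kappa> n w = w (enn2real (coarse_time A \<kappa> n w))"

definition coarse_kernel ::
    "('n::finite) matrix_field \<Rightarrow> (real^'n \<Rightarrow> (real \<Rightarrow> real^'n) measure) \<Rightarrow> real \<Rightarrow> real^'n \<Rightarrow> (real^'n) measure" where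
  "coarse_kernel A Q \<kappa> x = distr (Q x) borel (\<lambda>w. w (enn2real (step_time A \<kappa> w)))"

definition coarse_generator ::
    "('n::finite) matrix_field \<Rightarrow> (real^'n \<Rightarrow> (real \<Rightarrow> real^'n) measure) \<Rightarrow> real \<Rightarrow>
     (real^'n \<Rightarrow> real) \<Rightarrow> real^'n \<Rightarrow> real" where
  "coarse_generator A Q \<kappa> \<phi> x = (LINT y|coarse_kernel A Q \<kappa> x. \<phi> y) - \<phi> x"

definition chain_exit :: "('n::finite) matrix_field \<Rightarrow> real \<Rightarrow> (real^'n) set \<Rightarrow> (real \<Rightarrow> real^'n) \<Rightarrow> enat" where
  "chain_exit A \<kappa> D w = (INF n\<in>{n. coarse_chain A \<kappa> n w \<notin> D}. enat n)"

text \<open>The set function below is countably additive as soon as the chain is measurable on path space,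
  which holds for continuous fields: \<^const>\<open>degenerate_set\<close> is then open.\<close>

definition green_measure ::
    "('n::finite) matrix_field \<Rightarrow> (real^'n \<Rightarrow> (real \<Rightarrow> real^'n) measure) \<Rightarrow> real \<Rightarrow>
     (real^'n) set \<Rightarrow> real^'n \<Rightarrow> (real^'n) measure" where
  "green_measure A Q \<kappa> D x = measure_of UNIV (sets borel)
     (\<lambda>E. \<integral>\<^sup>+w. (\<Sum>n. if enat n < chain_exit A \<kappa> D w
                       then indicator E (coarse_chain A \<kappa> n w) else 0) \<partial>Q x)"


section \<open>The fine grid\<close>

definition fine_cell :: "nat \<Rightarrow> int^'n \<Rightarrow> (real^'n) set" where
  "fine_cell N k =
     {x. \<forall>i. - 1 / 2 + of_int (k$i) / real N \<le> x$i \<and> x$i < - 1 / 2 + (of_int (k$i) + 1) / real N}"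

definition fine_grid :: "nat \<Rightarrow> (real^'n) set set" where
  "fine_grid N = range (fine_cell N)"

definition locally_finite :: "(real^'n) measure \<Rightarrow> bool" where
  "locally_finite \<nu> \<longleftrightarrow> (\<forall>K. compact K \<longrightarrow> emeasure \<nu> K < \<infinity>)"

definition grid_density :: "nat \<Rightarrow> (real^'n) measure \<Rightarrow> real^'n \<Rightarrow> real" where
  "grid_density N \<nu> y = (\<Sum>\<^sub>\<infinity>Q\<in>fine_grid N. measure \<nu> Q / measure lborel Q * indicator Q y)"

definition average :: "(real^'n) set \<Rightarrow> (real^'n \<Rightarrow> real) \<Rightarrow> real" where
  "average U f = (LINT y:U|lborel. f y) / measure lborel U"


section \<open>The good events\<close>

definition reverse_Hoelder ::
    "('n::finite) matrix_field \<Rightarrow> (real^'n \<Rightarrow> (real \<Rightarrow> real^'n) measure) \<Rightarrow> real \<Rightarrow> nat \<Rightarrow> real \<Rightarrow>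
     (real^'n) set \<Rightarrow> real \<Rightarrow> bool" where
  "reverse_Hoelder A Q \<kappa> N H0 D L \<longleftrightarrow>
     (let q = real CARD('n) / (real CARD('n) - 1) in
      \<forall>\<nu>. sets \<nu> = sets borel \<and> locally_finite \<nu> \<and>
          (\<forall>\<phi>. C2_compact D \<phi> \<and> (\<forall>y. 0 \<le> \<phi> y) \<longrightarrow>
             integrable \<nu> (coarse_generator A Q \<kappa> \<phi>) \<and> (LINT y|\<nu>. coarse_generator A Q \<kappa> \<phi> y) \<le> 0) \<longrightarrow>
          (\<forall>x r. L \<le> r \<and> ball x (16 * r) \<subseteq> D \<longrightarrow>
             (average (ball x r) (\<lambda>y. grid_density N \<nu> y powr q)) powr (1 / q)
               \<le> H0 * average (ball x (16 * r)) (grid_density N \<nu>)))"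

definition short_coarse_steps :: "('n::finite) matrix_field \<Rightarrow> real \<Rightarrow> (real^'n) set \<Rightarrow> real \<Rightarrow> bool" where
  "short_coarse_steps A \<kappa> D L \<longleftrightarrow>
     (\<forall>w\<in>space path_space. w 0 \<in> D \<longrightarrow>
        (\<forall>t\<ge>0. ennreal t \<le> step_time A \<kappa> w \<longrightarrow> dist (w 0) (w t) \<le> L))"

text \<open>The event is determined by the bad clusters of the sites within some deterministic distance of \<open>D\<close>.\<close>

definition determined_by_clusters_near ::
    "real \<Rightarrow> (real^'n) set \<Rightarrow> ('n::finite) matrix_field set \<Rightarrow> bool" where
  "determined_by_clusters_near \<kappa> D G \<longleftrightarrow>
     (\<exists>b. \<forall>A\<in>symmetric_fields. \<forall>A'\<in>symmetric_fields.
        (\<forall>k. infdist (\<chi> i. of_int (k$i)) D \<le> b \<longrightarrow> bad_cluster A \<kappa> k = bad_cluster A' \<kappa> k) \<longrightarrow>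
        (A \<in> G \<longleftrightarrow> A' \<in> G))"

definition good_events ::
    "('n::finite) matrix_field measure \<Rightarrow> ('n matrix_field \<Rightarrow> real^'n \<Rightarrow> (real \<Rightarrow> real^'n) measure) \<Rightarrow>
     real \<Rightarrow> nat \<Rightarrow> real \<Rightarrow> real \<Rightarrow> real \<Rightarrow> real^'n \<Rightarrow> (real \<Rightarrow> real \<Rightarrow> 'n matrix_field set) \<Rightarrow> bool" where
  "good_events P PX \<kappa> N H0 \<eta>0 Cs z0 G \<longleftrightarrow>
     (\<forall>v. 0 < v \<and> v \<le> 1 / 2 \<longrightarrow> (\<exists>Cv>0. \<exists>cv>0. \<exists>R0>0. \<forall>R\<ge>R0.
        G R v \<in> sets P \<and>
        determined_by_clusters_near \<kappa> (ball z0 (Cs * R)) (G R v) \<and>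
        measure P (space P - G R v) \<le> Cv * exp (- cv * R powr (v * \<eta>0)) \<and>
        (AE A in P. A \<in> G R v \<longrightarrow>
           reverse_Hoelder A (PX A) \<kappa> N H0 (ball z0 (Cs * R)) (R powr v) \<and>
           short_coarse_steps A \<kappa> (ball z0 (Cs * R)) (R powr v))))"

end

theory Submission
  imports Defs
begin

text \<open>
  One coarse step has no drift and lasts a time bounded below in mean, so a truncated quadratic
  function decreases by a fixed amount per step and the Green measure has mass of order \<open>R\<^sup>2\<close>. Summing
  \<open>K \<phi> - \<phi>\<close> along the killed chain telescopes, so the Green measure satisfies the differential
  inequality of the reverse H\<ouml>lder condition, which controls its density in \<open>L\<^sup>q\<close> with \<open>q = d / (d - 1)\<close>
  on balls of radius at least \<open>L\<close>. Gehring's lemma, applied to the \<open>L\<^sup>q\<close> means of the density over cubes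
  of side comparable to \<open>L\<close>, raises \<open>q\<close> to some \<open>q' > q\<close>; its gain depends only on \<open>d\<close> and the
  reverse H\<ouml>lder constant. Passing from these means back to the fine cells costs the power of
  \<open>L\<close>. The bound for sources is H\<ouml>lder's inequality on the cells.
\<close>


section \<open>Higher integrability from a weak reverse H\<ouml>lder inequality\<close>

text \<open>The obstacle is that every estimate on the density stops at scale \<open>L\<close>. A
  Gehring argument usually descends to radius zero; here it starts at a radius comparable to
  \<open>L\<close>, where a mean over a cube is controlled by the mass in a ball around it. The
  final exponent is q + \<epsilon> with q = d / (d - 1), which is conjugate to d: any gain pushes
  the conjugate exponent p strictly below d, and a gain of at most 1 / d^2 keeps it above d / 2. The
  radius 1024 R is 16 * 2 * 32 R: means on a ball of radius 32 R see the density on 64 R, where the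
  given inequality with dilation 16 is applied once. On the probabilistic side the coarse times are
  sums of extended-real times with arbitrary conventions at infinity. The work is therefore done
  with the shift of a path by one step, whose iterates agree almost surely with the coarse chain
  until it is killed. Finiteness of a step and the mass bound come from the same Lyapunov function
  of radius M comparable to R: its decrease per step is of order R^-2.\<close>

definition weighted :: "('a::euclidean_space \<Rightarrow> real) \<Rightarrow> 'a measure" where
  "weighted f = density lborel (\<lambda>y. ennreal (f y))"

lemma sets_weighted [measurable_cong, simp]: "sets (weighted f) = sets borel"
  by (simp add: weighted_def)

lemma emeasure_weighted:
  assumes "f \<in> borel_measurable borel" "S \<in> sets borel"
  shows "emeasure (weighted f) S = (\<integral>\<^sup>+y\<in>S. ennreal (f y) \<partial>lborel)"
  using assms by (simp add: weighted_def emeasure_density)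

lemma emeasure_weighted_le:
  assumes "f \<in> borel_measurable borel" "S \<in> sets borel" "\<And>y. f y \<le> b"
  shows "emeasure (weighted f) S \<le> ennreal b * emeasure lborel S"
proof -
  have "emeasure (weighted f) S \<le> (\<integral>\<^sup>+y\<in>S. ennreal b \<partial>lborel)"
    unfolding emeasure_weighted[OF assms(1,2)]
    by (intro nn_integral_mono) (auto simp: indicator_def assms(3) ennreal_leI)
  also have "\<dots> = ennreal b * emeasure lborel S"
    using assms(2) by (simp add: nn_integral_cmult_indicator)
  finally show ?thesis .
qed

lemma emeasure_weighted_finite:
  assumes "f \<in> borel_measurable borel" "S \<in> sets borel" "\<And>y. f y \<le> b" "bounded S"
  shows "emeasure (weighted f) S < \<infinity>"
  using emeasure_bounded_finite[OF assms(4)]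
  by (intro le_less_trans[OF emeasure_weighted_le[OF assms(1-3)]])
     (auto simp: ennreal_mult_less_top)

abbreviation vol :: "'a::euclidean_space itself \<Rightarrow> real \<Rightarrow> real" where
  "vol T r \<equiv> unit_ball_vol (real DIM('a)) * r ^ DIM('a)"

lemma emeasure_le_of_measure_le:
  assumes "emeasure M S < \<infinity>" "measure M S \<le> c * measure N T" "emeasure N T < \<infinity>" "0 \<le> c"
  shows "emeasure M S \<le> ennreal c * emeasure N T"
  using assms by (simp add: emeasure_eq_ennreal_measure ennreal_mult'[symmetric] ennreal_leI)

lemma ball_subset_ball_I:
  fixes x z :: "'a::metric_space"
  assumes "dist z x + r \<le> s"
  shows "ball x r \<subseteq> ball z s"
proof
  fix y assume "y \<in> ball x r"
  then show "y \<in> ball z s" using assms dist_triangle[of z y x] by simp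
qed

text \<open>Pointwise the indicator of a union is at most the sum of the indicators; Tonelli does
  the rest. The index set stays the family of centres that Vitali's lemma returns, without an
  enumeration.\<close>

lemma emeasure_UN_le_nn_integral:
  assumes "countable I" "\<And>i. i \<in> I \<Longrightarrow> X i \<in> sets M"
  shows "emeasure M (\<Union>i\<in>I. X i) \<le> (\<integral>\<^sup>+i. emeasure M (X i) \<partial>count_space I)"
proof -
  have "emeasure M (\<Union>i\<in>I. X i) = (\<integral>\<^sup>+x. indicator (\<Union>i\<in>I. X i) x \<partial>M)"
    using assms by (intro nn_integral_indicator[symmetric] sets.countable_UN') auto
  also have "\<dots> \<le> (\<integral>\<^sup>+x. (\<integral>\<^sup>+i. indicator (X i) x \<partial>count_space I) \<partial>M)"
  proof (intro nn_integral_mono)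
    fix x
    show "indicator (\<Union>i\<in>I. X i) x \<le> (\<integral>\<^sup>+i. indicator (X i) x \<partial>count_space I)"
    proof (cases "x \<in> (\<Union>i\<in>I. X i)")
      case True
      then obtain i where "i \<in> I" "x \<in> X i" by auto
      then show ?thesis using nn_integral_ge_point[of i I "\<lambda>i. indicator (X i) x"] by (simp add: indicator_def)
    qed simp
  qed
  also have "\<dots> = (\<integral>\<^sup>+i. (\<integral>\<^sup>+x. indicator (X i) x \<partial>M) \<partial>count_space I)"
    using assms by (intro nn_integral_count_space_nn_integral) auto
  also have "\<dots> = (\<integral>\<^sup>+i. emeasure M (X i) \<partial>count_space I)"
    using assms by (intro nn_integral_cong) auto
  finally show ?thesis .
qed

section \<open>Gehring's lemma with a smallest admissible radius\<close>

definition gehring_scale :: "real \<Rightarrow> real \<Rightarrow> real \<Rightarrow> real" where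
  "gehring_scale q H c0 = 1 / (2 * c0 powr (1/q) * H)"

text \<open>The factor next to \<open>\<epsilon>\<close> in front of the larger ball in the
  hole-filling inequality. With the scale above called \<open>c1\<close>,
  \<open>5 ^ d / (c0 * c1)\<close> is the constant of the level set estimate;
  \<open>1 / (q - 1)\<close> and the last power bound, uniformly for gains up to 1, what is left
  after integrating \<open>t powr (q + \<epsilon> - 2)\<close> up to \<open>g / c1\<close>.\<close>

definition gehring_const :: "nat \<Rightarrow> real \<Rightarrow> real \<Rightarrow> real \<Rightarrow> real" where
  "gehring_const d q H c0 = 5 ^ d / (c0 * gehring_scale q H c0 * (q - 1)) * (1 / gehring_scale q H c0) powr q"

text \<open>The inequality is only assumed at radii above \<open>\<rho>0\<close>; the assumption \<open>loc\<close> then takes the place of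
  Lebesgue's differentiation theorem in the stopping argument.\<close>

locale weak_reverse_Hoelder =
  fixes g :: "'a::euclidean_space \<Rightarrow> real" and q A H c0 \<rho>0 b M :: real and z :: 'a
  assumes meas [measurable]: "g \<in> borel_measurable borel"
    and nonneg: "\<And>y. 0 \<le> g y" and bdd: "\<And>y. g y \<le> b"
    and q: "1 < q" and A: "1 \<le> A" and H: "1 \<le> H" and c0: "1 \<le> c0" and \<rho>0: "0 < \<rho>0" "\<rho>0 \<le> M"
    and RH: "\<And>x r. \<rho>0 \<le> r \<Longrightarrow> ball x (A * r) \<subseteq> ball z M \<Longrightarrow>
      measure (weighted (\<lambda>y. g y powr q)) (ball x r) \<le>
        vol TYPE('a) r * (H * measure (weighted g) (ball x (A * r)) / vol TYPE('a) (A * r)) powr q"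
    and loc: "\<And>x. x \<in> ball z M \<Longrightarrow>
      g x powr q \<le> c0 * measure (weighted (\<lambda>y. g y powr q)) (ball x \<rho>0) / vol TYPE('a) \<rho>0"
begin

abbreviation "\<mu>q \<equiv> weighted (\<lambda>y. g y powr q)"
abbreviation "\<mu>1 \<equiv> weighted g"

lemma gq_le: "g y powr q \<le> b powr q"
  using q by (intro powr_mono2) (auto simp: nonneg bdd)

lemma finite_\<mu>q: "S \<in> sets borel \<Longrightarrow> bounded S \<Longrightarrow> emeasure \<mu>q S < \<infinity>"
  by (rule emeasure_weighted_finite[OF _ _ gq_le]) auto

lemma finite_\<mu>1: "S \<in> sets borel \<Longrightarrow> bounded S \<Longrightarrow> emeasure \<mu>1 S < \<infinity>"
  by (rule emeasure_weighted_finite[OF _ _ bdd]) auto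

abbreviation "c1 \<equiv> gehring_scale q H c0"

lemma c1: "0 < c1" "c1 \<le> 1"
proof -
  have "1 \<le> c0 powr (1/q)" using c0 q by (intro ge_one_powr_ge_zero) auto
  then have "1 * 1 \<le> c0 powr (1/q) * H" using H by (intro mult_mono) auto
  then show "c1 \<le> 1" "0 < c1" unfolding gehring_scale_def by (auto simp: field_simps)
qed

text \<open>By the reverse Hoelder inequality, the lower bound on the mean of
  \<open>g powr q\<close> forces \<open>g\<close> to have mass at least \<open>2 * c1 * t\<close>
  times the volume on the ball of radius \<open>A * r\<close>. Points with \<open>g < c1 * t\<close>
  account for at most half of it, so the volume is controlled by the mass on the high level set; the
  upper bound on the enlarged ball turns volume back into q-mass.\<close>

lemma stopped_ball:
  assumes r: "\<rho>0 \<le> r" "ball x (A * r) \<subseteq> ball z M" and t: "0 < t"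
    and large: "t powr q / c0 * vol TYPE('a) r \<le> measure \<mu>q (ball x r)"
    and small: "measure \<mu>q (ball x (5 * A * r)) \<le> t powr q / c0 * vol TYPE('a) (5 * A * r)"
  shows "emeasure \<mu>q (ball x (5 * A * r)) \<le>
    ennreal (5 ^ DIM('a) / (c0 * c1) * t powr (q - 1)) * emeasure \<mu>1 (ball x (A * r) \<inter> {y. c1 * t \<le> g y})"
proof -
  define v where "v = vol TYPE('a) (A * r)"
  define m where "m = measure \<mu>1 (ball x (A * r))"
  define m' where "m' = measure \<mu>1 (ball x (A * r) \<inter> {y. c1 * t \<le> g y})"
  define k where "k = c0 powr (1/q)"
  have r0: "0 < r" using r \<rho>0 by simp
  have Ar: "0 < A * r" using r0 A by simp
  have v: "0 < v" unfolding v_def using Ar by (simp add: unit_ball_vol_pos)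
  have vr: "0 < vol TYPE('a) r" using r0 by (simp add: unit_ball_vol_pos)
  have k: "0 < k" "k powr q = c0" using c0 q by (auto simp: k_def powr_powr)
  have m0: "0 \<le> m" by (simp add: m_def)
  have "t powr q / c0 * vol TYPE('a) r \<le> vol TYPE('a) r * (H * m / v) powr q"
    using large RH[OF r] by (simp add: m_def v_def)
  then have "vol TYPE('a) r * (t powr q / c0) \<le> vol TYPE('a) r * (H * m / v) powr q"
    by (simp only: mult.commute)
  then have "t powr q / c0 \<le> (H * m / v) powr q"
    using vr by (simp only: mult_le_cancel_left_pos)
  moreover have "t powr q / c0 = (t / k) powr q" using t k by (simp add: powr_divide)
  ultimately have "(t / k) powr q \<le> (H * m / v) powr q" by simp
  then have tk: "t / k \<le> H * m / v"
    using powr_less_mono2[of q "H * m / v" "t / k"] H m0 v q by (force simp: not_le[symmetric])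
  have "m \<le> c1 * t * v + m'"
  proof -
    have "emeasure \<mu>1 (ball x (A * r)) \<le>
        emeasure \<mu>1 (ball x (A * r) \<inter> {y. c1 * t \<le> g y}) + emeasure \<mu>1 (ball x (A * r) \<inter> {y. g y < c1 * t})"
      by (rule order_trans[OF emeasure_mono emeasure_subadditive]) (auto simp: not_le)
    also have "emeasure \<mu>1 (ball x (A * r) \<inter> {y. g y < c1 * t}) \<le> ennreal (c1 * t) * ennreal v"
    proof -
      have "emeasure \<mu>1 (ball x (A * r) \<inter> {y. g y < c1 * t}) =
          (\<integral>\<^sup>+y\<in>ball x (A * r) \<inter> {y. g y < c1 * t}. ennreal (g y) \<partial>lborel)"
        by (intro emeasure_weighted) auto
      also have "\<dots> \<le> (\<integral>\<^sup>+y\<in>ball x (A * r). ennreal (c1 * t) \<partial>lborel)"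
        by (intro nn_integral_mono) (auto simp: indicator_def ennreal_leI)
      also have "\<dots> = ennreal (c1 * t) * emeasure lborel (ball x (A * r))"
        by (simp add: nn_integral_cmult_indicator)
      also have "emeasure lborel (ball x (A * r)) = ennreal v"
        using Ar by (simp add: emeasure_ball v_def)
      finally show ?thesis .
    qed
    finally have "emeasure \<mu>1 (ball x (A * r)) \<le>
        emeasure \<mu>1 (ball x (A * r) \<inter> {y. c1 * t \<le> g y}) + ennreal (c1 * t) * ennreal v"
      by (simp add: add_left_mono)
    moreover have "emeasure \<mu>1 (ball x (A * r)) = ennreal m"
      using finite_\<mu>1[of "ball x (A * r)"] by (simp add: m_def emeasure_eq_ennreal_measure less_top)
    moreover have "emeasure \<mu>1 (ball x (A * r) \<inter> {y. c1 * t \<le> g y}) = ennreal m'"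
      using finite_\<mu>1[of "ball x (A * r) \<inter> {y. c1 * t \<le> g y}"]
      by (simp add: m'_def emeasure_eq_ennreal_measure less_top bounded_Int)
    ultimately have "ennreal m \<le> ennreal (m' + c1 * t * v)"
      using c1 t v by (simp add: ennreal_mult'[symmetric] m'_def ennreal_plus[symmetric] del: ennreal_plus)
    then show ?thesis using c1 t v by (subst (asm) ennreal_le_iff) (auto simp: m'_def)
  qed
  moreover have "2 * c1 * t * v \<le> m"
    using tk k H v by (simp add: gehring_scale_def k_def[symmetric] field_simps)
  ultimately have m': "v \<le> m' / (c1 * t)" using c1 t by (simp add: field_simps)
  have "measure \<mu>q (ball x (5 * A * r)) \<le> t powr q / c0 * (5 ^ DIM('a) * v)"
    using small by (simp add: v_def power_mult_distrib mult_ac)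
  also have "\<dots> \<le> t powr q / c0 * (5 ^ DIM('a) * (m' / (c1 * t)))"
    using m' c0 by (intro mult_left_mono) auto
  also have "\<dots> = 5 ^ DIM('a) / (c0 * c1) * t powr (q - 1) * m'"
    using t by (simp add: powr_diff field_simps)
  finally have "measure \<mu>q (ball x (5 * A * r)) \<le> 5 ^ DIM('a) / (c0 * c1) * t powr (q - 1) * m'" .
  then show ?thesis unfolding m'_def
    using c0 c1 by (intro emeasure_le_of_measure_le finite_\<mu>q finite_\<mu>1) (auto simp: bounded_Int)
qed

text \<open>The radii grow by the factor \<open>5 A\<close>: the ball at which the mean first drops below the level is the
  fivefold enlargement, as in Vitali's lemma, of the ball on the right-hand side of the reverse
  H\<ouml>lder inequality.\<close>

lemma stopping_radius:
  assumes \<rho>: "0 < \<delta>" "\<rho>1 + \<delta> \<le> M" and a: "0 < a"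
    and total: "measure \<mu>q (ball z (2 * M)) \<le> vol TYPE('a) (2 * M) * a powr q"
    and t: "t = c0 powr (1/q) * (10 * A * M / \<delta>) powr (DIM('a) / q) * a * s" "1 < s"
    and x: "x \<in> ball z \<rho>1" "t \<le> g x"
  obtains r where "\<rho>0 \<le> r" "5 * A * r \<le> \<delta>"
    "t powr q / c0 * vol TYPE('a) r \<le> measure \<mu>q (ball x r)"
    "measure \<mu>q (ball x (5 * A * r)) \<le> t powr q / c0 * vol TYPE('a) (5 * A * r)"
proof -
  define \<beta> where "\<beta> = 5 * A"
  define rr where "rr i = \<rho>0 * \<beta> ^ i" for i
  have \<beta>: "5 \<le> \<beta>" using A by (simp add: \<beta>_def)
  have rr0: "0 < rr i" for i using \<rho>0 \<beta> by (simp add: rr_def)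
  have xz: "x \<in> ball z M" "dist z x < M" using x \<rho> by auto
  have M0: "0 < M" using \<rho>0 by simp
  have tq: "t powr q = c0 * (10 * A * M / \<delta>) ^ DIM('a) * a powr q * s powr q"
    unfolding t(1) using c0 q \<rho> A M0 a t(2)
    by (simp add: powr_mult powr_powr powr_realpow)
  have s1: "1 < s powr q" using t(2) q by (intro gr_one_powr) auto
  \<comment> \<open>The prefactor in \<open>t\<close> is made for this: the ball lies in
    \<open>ball z (2 * M)\<close>, and the ratio of the radii is at most
    \<open>10 * A * M / \<delta>\<close>, because \<open>2 * M\<close> is that quotient times
    \<open>\<delta> / \<beta>\<close>. Strictness comes from \<open>1 < s\<close>.\<close>
  have small: "measure \<mu>q (ball x r) < t powr q / c0 * vol TYPE('a) r"
    if r: "\<delta> / \<beta> \<le> r" "r \<le> M" for r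
  proof -
    have r0: "0 < r" using r \<rho> \<beta> by (smt (verit) divide_pos_pos)
    have "ball x r \<subseteq> ball z (2 * M)"
      using xz r by (intro ball_subset_ball_I) auto
    then have "measure \<mu>q (ball x r) \<le> measure \<mu>q (ball z (2 * M))"
      using finite_\<mu>q[of "ball z (2*M)"] by (intro measure_mono_fmeasurable) (auto simp: fmeasurable_def)
    also have "\<dots> \<le> vol TYPE('a) (2 * M) * a powr q" by (rule total)
    also have "\<dots> < vol TYPE('a) (2 * M) * a powr q * s powr q"
      using s1 a M0 by (simp add: unit_ball_vol_pos)
    also have "\<dots> \<le> vol TYPE('a) ((10 * A * M / \<delta>) * r) * a powr q * s powr q"
    proof -
      have "2 * M \<le> (10 * A * M / \<delta>) * r"
      proof -
        have "2 * M = (10 * A * M / \<delta>) * (\<delta> / \<beta>)" using \<rho> A by (simp add: \<beta>_def)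
        also have "\<dots> \<le> (10 * A * M / \<delta>) * r" using r \<rho> A M0 by (intro mult_left_mono) auto
        finally show ?thesis .
      qed
      then show ?thesis using M0 by (intro mult_right_mono mult_left_mono power_mono) auto
    qed
    also have "\<dots> = t powr q / c0 * vol TYPE('a) r"
      using c0 by (simp add: tq power_mult_distrib power_divide)
    finally show ?thesis .
  qed
  have start: "t powr q / c0 * vol TYPE('a) (rr 0) \<le> measure \<mu>q (ball x (rr 0))"
  proof -
    have "t powr q \<le> g x powr q"
      using x(2) q t \<rho> A M0 a c0 by (intro powr_mono2) auto
    also have "\<dots> \<le> c0 * measure \<mu>q (ball x \<rho>0) / vol TYPE('a) \<rho>0" by (rule loc[OF xz(1)])
    finally show ?thesis using c0 \<rho>0 by (simp add: rr_def field_simps unit_ball_vol_pos)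
  qed
  \<comment> \<open>Index \<open>i\<close> is tested at the next radius, so the least bad
    \<open>i\<close> gives both conclusions: the mean at \<open>rr (Suc i)\<close> is below the
    level, while at \<open>rr i\<close> it is still above, by minimality or, for
    \<open>i = 0\<close>, by \<open>start\<close>.\<close>
  define bad where "bad i \<longleftrightarrow> measure \<mu>q (ball x (rr (Suc i))) \<le> t powr q / c0 * vol TYPE('a) (rr (Suc i))" for i
  have r0small: "rr 0 < \<delta> / \<beta>"
  proof (rule ccontr)
    assume "\<not> ?thesis"
    then have "measure \<mu>q (ball x (rr 0)) < t powr q / c0 * vol TYPE('a) (rr 0)"
      using \<rho>0 by (intro small) (auto simp: rr_def)
    then show False using start by simp
  qed
  obtain N where N: "\<delta> / \<beta> \<le> rr N"
    using real_arch_pow[of \<beta> "\<delta> / \<beta> / \<rho>0"] \<beta> \<rho>0 by (auto simp: rr_def field_simps intro: less_imp_le)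
  \<comment> \<open>The first radius to reach \<open>\<delta> / \<beta>\<close> is still below
    \<open>\<delta>\<close>, hence in the range of \<open>small\<close>: a bad index exists before
    the enlarged balls become too big.\<close>
  define j where "j = (LEAST i. \<delta> / \<beta> \<le> rr i)"
  have j: "\<delta> / \<beta> \<le> rr j" unfolding j_def using N by (rule LeastI)
  have "j \<noteq> 0" using j r0small by (metis not_le)
  then obtain k where k: "j = Suc k" by (cases j) auto
  have krr: "rr k < \<delta> / \<beta>" using not_less_Least[of k "\<lambda>i. \<delta> / \<beta> \<le> rr i"] k by (auto simp: j_def)
  have "rr (Suc k) = \<beta> * rr k" by (simp add: rr_def)
  then have "rr (Suc k) < \<delta>" using krr \<beta> by (simp add: field_simps)
  moreover have "\<delta> \<le> M" using \<rho> x(1) by (smt (verit) mem_ball zero_le_dist)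
  ultimately have badk: "bad k"
    unfolding bad_def using j k by (intro less_imp_le[OF small]) auto
  define i where "i = (LEAST i. bad i)"
  have i: "bad i" "i \<le> k" unfolding i_def using badk by (auto intro: LeastI Least_le)
  have notbad: "\<not> bad m" if "m < i" for m using that not_less_Least[of m bad] by (auto simp: i_def)
  show ?thesis
  proof (rule that[of "rr i"])
    show "\<rho>0 \<le> rr i" using \<beta> \<rho>0 by (simp add: rr_def)
    have "rr i \<le> rr k" using i \<beta> \<rho>0 by (auto simp: rr_def intro!: mult_left_mono power_increasing)
    then have "\<beta> * rr i \<le> \<beta> * rr k" using \<beta> by (intro mult_left_mono) auto
    also have "\<dots> \<le> \<delta>" using krr \<beta> by (simp add: field_simps)
    finally show "5 * A * rr i \<le> \<delta>" by (simp add: \<beta>_def)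
    show "t powr q / c0 * vol TYPE('a) (rr i) \<le> measure \<mu>q (ball x (rr i))"
    proof (cases i)
      case 0 then show ?thesis using start by simp
    next
      case (Suc m) then show ?thesis using notbad[of m] by (simp add: bad_def)
    qed
    have "rr (Suc i) = 5 * A * rr i" by (simp add: rr_def \<beta>_def)
    then show "measure \<mu>q (ball x (5 * A * rr i)) \<le> t powr q / c0 * vol TYPE('a) (5 * A * rr i)"
      using i(1) by (simp only: bad_def)
  qed
qed

text \<open>Each point of the level set is the centre of a stopped ball. Vitali's lemma selects
  disjoint balls of radius \<open>A * r x\<close> whose fivefold enlargements cover the set;
  \<open>stopped_ball\<close> applies to each, and disjointness lets the masses on the right add up
  inside the larger ball.\<close>

lemma level_set_bound:
  assumes \<rho>: "0 < \<delta>" "\<rho>1 + \<delta> \<le> M" and a: "0 < a"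
    and total: "measure \<mu>q (ball z (2 * M)) \<le> vol TYPE('a) (2 * M) * a powr q"
    and t: "c0 powr (1/q) * (10 * A * M / \<delta>) powr (DIM('a) / q) * a < t"
  shows "emeasure \<mu>q (ball z \<rho>1 \<inter> {y. t \<le> g y}) \<le>
    ennreal (5 ^ DIM('a) / (c0 * c1) * t powr (q - 1)) * emeasure \<mu>1 (ball z (\<rho>1 + \<delta>) \<inter> {y. c1 * t \<le> g y})"
proof -
  define t0 where "t0 = c0 powr (1/q) * (10 * A * M / \<delta>) powr (DIM('a) / q) * a"
  define C where "C = 5 ^ DIM('a) / (c0 * c1) * t powr (q - 1)"
  define E where "E = ball z \<rho>1 \<inter> {y. t \<le> g y}"
  define U where "U = ball z (\<rho>1 + \<delta>) \<inter> {y. c1 * t \<le> g y}"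
  have M0: "0 < M" using \<rho>0 by simp
  have t0: "0 < t0" using c0 A M0 \<rho> a by (simp add: t0_def)
  have tpos: "0 < t" using t t0 by (simp add: t0_def)
  have ts: "t = c0 powr (1/q) * (10 * A * M / \<delta>) powr (DIM('a) / q) * a * (t / t0)" "1 < t / t0"
    using t0 t by (auto simp: t0_def)
  have "\<exists>r. \<rho>0 \<le> r \<and> 5 * A * r \<le> \<delta> \<and>
      t powr q / c0 * vol TYPE('a) r \<le> measure \<mu>q (ball x r) \<and>
      measure \<mu>q (ball x (5 * A * r)) \<le> t powr q / c0 * vol TYPE('a) (5 * A * r)" if "x \<in> E" for x
  proof -
    have "x \<in> ball z \<rho>1" "t \<le> g x" using that by (auto simp: E_def)
    from stopping_radius[OF \<rho> a total ts this] show ?thesis by metis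
  qed
  then obtain r where r: "\<And>x. x \<in> E \<Longrightarrow> \<rho>0 \<le> r x" "\<And>x. x \<in> E \<Longrightarrow> 5 * A * r x \<le> \<delta>"
    "\<And>x. x \<in> E \<Longrightarrow> t powr q / c0 * vol TYPE('a) (r x) \<le> measure \<mu>q (ball x (r x))"
    "\<And>x. x \<in> E \<Longrightarrow> measure \<mu>q (ball x (5 * A * r x)) \<le> t powr q / c0 * vol TYPE('a) (5 * A * r x)"
    by metis
  have rpos: "0 < A * r x" if "x \<in> E" for x using r(1)[OF that] \<rho>0 A by simp
  obtain K where K: "countable K" "K \<subseteq> E"
    "pairwise (\<lambda>i j. disjnt (ball i (A * r i)) (ball j (A * r j))) K"
    "E \<subseteq> (\<Union>i\<in>K. ball i (5 * (A * r i)))"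
  proof (rule Vitali_covering_lemma_balls[where S=E and K=E and a="\<lambda>x. x" and r="\<lambda>x. A * r x" and B=\<delta>])
    show "E \<subseteq> (\<Union>i\<in>E. ball i (A * r i))" using rpos by auto
    show "0 < A * r i \<and> A * r i \<le> \<delta>" if "i \<in> E" for i
      using rpos[OF that] r(2)[OF that] by simp
  qed blast
  have sub: "ball x (A * r x) \<subseteq> ball z (\<rho>1 + \<delta>)" if "x \<in> E" for x
  proof -
    have "dist z x < \<rho>1" using that by (simp add: E_def)
    moreover have "A * r x \<le> \<delta>" using r(2)[OF that] rpos[OF that] by simp
    ultimately show ?thesis by (intro ball_subset_ball_I) auto
  qed
  have one: "emeasure \<mu>q (ball x (5 * A * r x)) \<le> ennreal C * emeasure \<mu>1 (ball x (A * r x) \<inter> {y. c1 * t \<le> g y})"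
    if "x \<in> E" for x
    unfolding C_def using sub[OF that] \<rho> r that tpos by (intro stopped_ball) auto
  show ?thesis
  proof (cases "K = {}")
    case True
    then have "E = {}" using K by auto
    then show ?thesis by (simp add: E_def[symmetric])
  next
    case False
    have Kn: "from_nat_into K n \<in> E" for n using from_nat_into[OF False] K by auto
    have "emeasure \<mu>q E \<le> emeasure \<mu>q (\<Union>i\<in>K. ball i (5 * A * r i))"
      using K by (intro emeasure_mono) (auto simp: mult.assoc intro!: sets.countable_UN')
    also have "\<dots> \<le> (\<integral>\<^sup>+x. emeasure \<mu>q (ball x (5 * A * r x)) \<partial>count_space K)"
      using K(1) by (intro emeasure_UN_le_nn_integral) auto
    also have "\<dots> \<le> (\<integral>\<^sup>+x. ennreal C * emeasure \<mu>1 (ball x (A * r x) \<inter> {y. c1 * t \<le> g y}) \<partial>count_space K)"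
      using K one by (intro nn_integral_mono) auto
    also have "\<dots> = ennreal C * (\<integral>\<^sup>+x. emeasure \<mu>1 (ball x (A * r x) \<inter> {y. c1 * t \<le> g y}) \<partial>count_space K)"
      by (intro nn_integral_cmult) auto
    also have "(\<integral>\<^sup>+x. emeasure \<mu>1 (ball x (A * r x) \<inter> {y. c1 * t \<le> g y}) \<partial>count_space K)
        = emeasure \<mu>1 (\<Union>x\<in>K. ball x (A * r x) \<inter> {y. c1 * t \<le> g y})"
      using K by (intro emeasure_UN_countable[symmetric])
        (auto simp: disjoint_family_on_def pairwise_def disjnt_def)
    also have "\<dots> \<le> emeasure \<mu>1 U"
      using K sub by (intro emeasure_mono) (auto simp: U_def)
    finally show ?thesis by (simp add: E_def U_def C_def mult_left_mono)
  qed
qed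


lemma C2_pos: "0 < gehring_const DIM('a) q H c0" unfolding gehring_const_def using c0 c1 q by simp

text \<open>The level set estimate is multiplied by
  \<open>\<epsilon> * t powr (\<epsilon> - 1)\<close> and integrated over \<open>t > t0\<close>. By
  Tonelli the left side yields the (q + \<epsilon>)-mass up to \<open>t0 powr \<epsilon>\<close>
  times the q-mass; the right side keeps the factor \<open>\<epsilon>\<close>, which later makes it
  absorbable.\<close>

lemma hole_filling_step:
  assumes \<rho>: "0 < \<delta>" "\<rho>1 + \<delta> \<le> M" and a: "0 < a"
    and total: "measure \<mu>q (ball z (2 * M)) \<le> vol TYPE('a) (2 * M) * a powr q"
    and \<epsilon>: "0 < \<epsilon>" "\<epsilon> \<le> 1"
    and t0_def: "t0 = c0 powr (1/q) * (10 * A * M / \<delta>) powr (DIM('a) / q) * a"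
  shows "emeasure (weighted (\<lambda>y. g y powr (q + \<epsilon>))) (ball z \<rho>1) \<le>
    ennreal (t0 powr \<epsilon>) * emeasure \<mu>q (ball z \<rho>1) +
    ennreal (\<epsilon> * gehring_const DIM('a) q H c0) * emeasure (weighted (\<lambda>y. g y powr (q + \<epsilon>))) (ball z (\<rho>1 + \<delta>))"
proof -
  define K where "K = 5 ^ DIM('a) / (c0 * c1)"
  define B1 where "B1 = ball z \<rho>1"
  define B2 where "B2 = ball z (\<rho>1 + \<delta>)"
  have [measurable]: "B1 \<in> sets borel" "B2 \<in> sets borel" by (auto simp: B1_def B2_def)
  have K: "0 < K" using c0 c1 by (simp add: K_def)
  have t0: "0 < t0" using c0 A \<rho>0 \<rho> a by (simp add: t0_def)
  \<comment> \<open>The integrands in \<open>(y, t)\<close> of the two sides: integration in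
    \<open>y\<close> gives the masses of level sets at height \<open>t\<close>, integration in
    \<open>t\<close> gives powers of \<open>g y\<close>.\<close>
  define f1 where "f1 y t = ennreal (if y \<in> B1 \<and> t0 < t \<and> t \<le> g y then \<epsilon> * t powr (\<epsilon> - 1) * g y powr q else 0)" for y t
  define f2 where "f2 y t = ennreal (if y \<in> B2 \<and> t0 < t \<and> c1 * t \<le> g y then \<epsilon> * K * t powr (q + \<epsilon> - 2) * g y else 0)" for y t
  have [measurable]: "(\<lambda>(y, t). f1 y t) \<in> borel_measurable (lborel \<Otimes>\<^sub>M lborel)"
    "(\<lambda>(y, t). f2 y t) \<in> borel_measurable (lborel \<Otimes>\<^sub>M lborel)"
    unfolding f1_def f2_def by measurable
  have deriv: "((\<lambda>t. t powr p / p) has_real_derivative t powr (p - 1)) (at t)" if "0 < t" "0 < p" for t p :: real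
    using that by (auto intro!: derivative_eq_intros simp: powr_diff field_simps)
  have FTC: "(\<integral>\<^sup>+t\<in>{t0..u}. ennreal (t powr (p - 1)) \<partial>lborel) = ennreal (u powr p / p - t0 powr p / p)"
    if "t0 \<le> u" "0 < p" for u p
    using that t0 by (intro nn_integral_FTC_Icc deriv) auto
  have lower: "ennreal (g y powr (q + \<epsilon>)) \<le> ennreal (t0 powr \<epsilon>) * ennreal (g y powr q) + (\<integral>\<^sup>+t. f1 y t \<partial>lborel)"
    if y: "y \<in> B1" for y
  proof (cases "g y \<le> t0")
    case True
    have "g y powr (q + \<epsilon>) = g y powr \<epsilon> * g y powr q" by (simp add: powr_add)
    also have "\<dots> \<le> t0 powr \<epsilon> * g y powr q"
      using True \<epsilon> nonneg by (intro mult_right_mono powr_mono2) auto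
    finally have "ennreal (g y powr (q + \<epsilon>)) \<le> ennreal (t0 powr \<epsilon>) * ennreal (g y powr q)"
      by (simp add: ennreal_mult'[symmetric] ennreal_leI)
    then show ?thesis by (rule order_trans) simp
  next
    case False
    have "(\<integral>\<^sup>+t. f1 y t \<partial>lborel) = (\<integral>\<^sup>+t. ennreal (\<epsilon> * g y powr q) * (ennreal (t powr (\<epsilon> - 1)) * indicator {t0..g y} t) \<partial>lborel)"
    proof (rule nn_integral_cong_AE)
      show "AE t in lborel. f1 y t = ennreal (\<epsilon> * g y powr q) * (ennreal (t powr (\<epsilon> - 1)) * indicator {t0..g y} t)"
        using AE_lborel_singleton[of t0]
      proof eventually_elim
        case (elim t)
        then show ?case using y \<epsilon>
          by (auto simp: f1_def indicator_def ennreal_mult'[symmetric] mult_ac)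
      qed
    qed
    also have "\<dots> = ennreal (\<epsilon> * g y powr q) * (\<integral>\<^sup>+t\<in>{t0..g y}. ennreal (t powr (\<epsilon> - 1)) \<partial>lborel)"
      by (intro nn_integral_cmult) simp
    also have "\<dots> = ennreal (\<epsilon> * g y powr q) * ennreal (g y powr \<epsilon> / \<epsilon> - t0 powr \<epsilon> / \<epsilon>)"
      using False \<epsilon> by (subst FTC) auto
    also have "\<dots> = ennreal (g y powr (q + \<epsilon>) - t0 powr \<epsilon> * g y powr q)"
      using \<epsilon> by (simp add: ennreal_mult'[symmetric] powr_add diff_divide_distrib[symmetric]) (simp add: algebra_simps)
    finally have eq: "(\<integral>\<^sup>+t. f1 y t \<partial>lborel) = ennreal (g y powr (q + \<epsilon>) - t0 powr \<epsilon> * g y powr q)" .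
    have "t0 powr \<epsilon> * g y powr q \<le> g y powr (q + \<epsilon>)"
      using False \<epsilon> t0 by (auto simp: powr_add mult.commute intro!: mult_right_mono powr_mono2)
    then show ?thesis unfolding eq
      by (simp add: ennreal_mult'[symmetric] ennreal_plus[symmetric] del: ennreal_plus)
  qed
  have upper: "(\<integral>\<^sup>+t. f2 y t \<partial>lborel) \<le> ennreal (\<epsilon> * gehring_const DIM('a) q H c0) * ennreal (g y powr (q + \<epsilon>))" if y: "y \<in> B2" for y
  proof (cases "t0 \<le> g y / c1")
    case True
    have gy: "0 < g y" using True t0 c1 by (smt (verit) divide_nonpos_pos)
    have "(\<integral>\<^sup>+t. f2 y t \<partial>lborel) \<le> (\<integral>\<^sup>+t. ennreal (\<epsilon> * K * g y) * (ennreal (t powr (q + \<epsilon> - 1 - 1)) * indicator {t0..g y / c1} t) \<partial>lborel)"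
      using c1 \<epsilon> K nonneg
      by (intro nn_integral_mono) (auto simp: f2_def indicator_def ennreal_mult'[symmetric] mult_ac field_simps)
    also have "\<dots> = ennreal (\<epsilon> * K * g y) * (\<integral>\<^sup>+t\<in>{t0..g y / c1}. ennreal (t powr (q + \<epsilon> - 1 - 1)) \<partial>lborel)"
      by (intro nn_integral_cmult) simp
    also have "\<dots> = ennreal (\<epsilon> * K * g y) * ennreal ((g y / c1) powr (q + \<epsilon> - 1) / (q + \<epsilon> - 1) - t0 powr (q + \<epsilon> - 1) / (q + \<epsilon> - 1))"
      using True \<epsilon> q by (subst FTC) auto
    \<comment> \<open>Here and two steps below the constant is made independent of
      \<open>\<epsilon>\<close>: \<open>q + \<epsilon> - 1\<close> in the denominator becomes
      \<open>q - 1\<close>, and the exponent of \<open>1 / c1\<close> is raised to \<open>q\<close>,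
      using \<open>\<epsilon> \<le> 1\<close> and \<open>c1 \<le> 1\<close>.\<close>
    also have "\<dots> \<le> ennreal (\<epsilon> * K * g y) * ennreal ((g y / c1) powr (q + \<epsilon> - 1) / (q - 1))"
    proof (intro mult_left_mono ennreal_leI)
      have "(g y / c1) powr (q + \<epsilon> - 1) / (q + \<epsilon> - 1) - t0 powr (q + \<epsilon> - 1) / (q + \<epsilon> - 1) \<le> (g y / c1) powr (q + \<epsilon> - 1) / (q + \<epsilon> - 1)"
        using q \<epsilon> by simp
      also have "\<dots> \<le> (g y / c1) powr (q + \<epsilon> - 1) / (q - 1)" using q \<epsilon> by (intro divide_left_mono) auto
      finally show "(g y / c1) powr (q + \<epsilon> - 1) / (q + \<epsilon> - 1) - t0 powr (q + \<epsilon> - 1) / (q + \<epsilon> - 1) \<le> (g y / c1) powr (q + \<epsilon> - 1) / (q - 1)" .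
    qed auto
    also have "\<dots> = ennreal (\<epsilon> * K / (q - 1) * (1 / c1) powr (q + \<epsilon> - 1) * g y powr (q + \<epsilon>))"
      using gy c1 \<epsilon> K q by (simp add: ennreal_mult'[symmetric] powr_divide powr_diff field_simps)
    also have "\<dots> \<le> ennreal (\<epsilon> * K / (q - 1) * (1 / c1) powr q * g y powr (q + \<epsilon>))"
      using c1 \<epsilon> K q by (intro ennreal_leI mult_right_mono mult_left_mono powr_mono) auto
    also have "\<dots> = ennreal (\<epsilon> * gehring_const DIM('a) q H c0) * ennreal (g y powr (q + \<epsilon>))"
      using C2_pos \<epsilon> by (simp add: gehring_const_def K_def ennreal_mult'[symmetric] field_simps)
    finally show ?thesis .
  next
    case False
    have "f2 y t = 0" for t
    proof -
      have "\<not> (t0 < t \<and> c1 * t \<le> g y)"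
      proof
        assume t: "t0 < t \<and> c1 * t \<le> g y"
        then have "c1 * t0 < c1 * t" using c1 by (intro mult_strict_left_mono) auto
        moreover have "g y < c1 * t0" using False c1 by (simp add: field_simps)
        ultimately show False using t by linarith
      qed
      then show ?thesis by (auto simp: f2_def)
    qed
    then show ?thesis by simp
  qed
  have levels: "(\<integral>\<^sup>+y. f1 y t \<partial>lborel) \<le> (\<integral>\<^sup>+y. f2 y t \<partial>lborel)" for t
  proof (cases "t0 < t")
    case True
    have tpos: "0 < t" using True t0 by simp
    have "(\<integral>\<^sup>+y. f1 y t \<partial>lborel) = (\<integral>\<^sup>+y. ennreal (\<epsilon> * t powr (\<epsilon> - 1)) * (ennreal (g y powr q) * indicator (B1 \<inter> {y. t \<le> g y}) y) \<partial>lborel)"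
      using True \<epsilon> by (intro nn_integral_cong) (auto simp: f1_def indicator_def ennreal_mult'[symmetric])
    also have "\<dots> = ennreal (\<epsilon> * t powr (\<epsilon> - 1)) * emeasure \<mu>q (B1 \<inter> {y. t \<le> g y})"
      by (subst nn_integral_cmult) (auto simp: emeasure_weighted)
    also have "\<dots> \<le> ennreal (\<epsilon> * t powr (\<epsilon> - 1)) * (ennreal (K * t powr (q - 1)) * emeasure \<mu>1 (B2 \<inter> {y. c1 * t \<le> g y}))"
      unfolding B1_def B2_def K_def using True
      by (intro mult_left_mono level_set_bound[OF \<rho> a total]) (auto simp: t0_def)
    also have "\<dots> = ennreal (\<epsilon> * K * t powr (q + \<epsilon> - 2)) * emeasure \<mu>1 (B2 \<inter> {y. c1 * t \<le> g y})"
    proof -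
      have "t powr (\<epsilon> - 1) * t powr (q - 1) = t powr (q + \<epsilon> - 2)" by (simp add: powr_add[symmetric] add.commute)
      then have "\<epsilon> * t powr (\<epsilon> - 1) * (K * t powr (q - 1)) = \<epsilon> * K * t powr (q + \<epsilon> - 2)"
        by (metis mult.assoc mult.left_commute)
      then have "ennreal (\<epsilon> * t powr (\<epsilon> - 1)) * ennreal (K * t powr (q - 1)) = ennreal (\<epsilon> * K * t powr (q + \<epsilon> - 2))"
        using \<epsilon> by (metis ennreal_mult' mult_nonneg_nonneg powr_ge_zero less_imp_le)
      then show ?thesis by (metis mult.assoc)
    qed
    also have "\<dots> = (\<integral>\<^sup>+y. ennreal (\<epsilon> * K * t powr (q + \<epsilon> - 2)) * (ennreal (g y) * indicator (B2 \<inter> {y. c1 * t \<le> g y}) y) \<partial>lborel)"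
      by (subst nn_integral_cmult) (auto simp: emeasure_weighted)
    also have "\<dots> = (\<integral>\<^sup>+y. f2 y t \<partial>lborel)"
      using True \<epsilon> K by (intro nn_integral_cong) (auto simp: f2_def indicator_def ennreal_mult'[symmetric])
    finally show ?thesis .
  qed (simp add: f1_def)
  have "emeasure (weighted (\<lambda>y. g y powr (q + \<epsilon>))) B1 = (\<integral>\<^sup>+y\<in>B1. ennreal (g y powr (q + \<epsilon>)) \<partial>lborel)"
    by (intro emeasure_weighted) auto
  also have "\<dots> \<le> (\<integral>\<^sup>+y. ennreal (t0 powr \<epsilon>) * (ennreal (g y powr q) * indicator B1 y) + (\<integral>\<^sup>+t. f1 y t \<partial>lborel) \<partial>lborel)"
    using lower by (intro nn_integral_mono) (auto simp: indicator_def)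
  also have "\<dots> = ennreal (t0 powr \<epsilon>) * emeasure \<mu>q B1 + (\<integral>\<^sup>+y. (\<integral>\<^sup>+t. f1 y t \<partial>lborel) \<partial>lborel)"
    by (subst nn_integral_add) (auto simp: nn_integral_cmult emeasure_weighted)
  also have "(\<integral>\<^sup>+y. (\<integral>\<^sup>+t. f1 y t \<partial>lborel) \<partial>lborel) = (\<integral>\<^sup>+t. (\<integral>\<^sup>+y. f1 y t \<partial>lborel) \<partial>lborel)"
    by (rule lborel_pair.Fubini'[symmetric]) simp
  also have "\<dots> \<le> (\<integral>\<^sup>+t. (\<integral>\<^sup>+y. f2 y t \<partial>lborel) \<partial>lborel)"
    by (intro nn_integral_mono levels)
  also have "\<dots> = (\<integral>\<^sup>+y. (\<integral>\<^sup>+t. f2 y t \<partial>lborel) \<partial>lborel)"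
    by (rule lborel_pair.Fubini') simp
  also have "\<dots> \<le> (\<integral>\<^sup>+y. ennreal (\<epsilon> * gehring_const DIM('a) q H c0) * (ennreal (g y powr (q + \<epsilon>)) * indicator B2 y) \<partial>lborel)"
  proof (intro nn_integral_mono)
    fix y show "(\<integral>\<^sup>+t. f2 y t \<partial>lborel) \<le> ennreal (\<epsilon> * gehring_const DIM('a) q H c0) * (ennreal (g y powr (q + \<epsilon>)) * indicator B2 y)"
      using upper[of y] by (cases "y \<in> B2") (auto simp: f2_def)
  qed
  also have "\<dots> = ennreal (\<epsilon> * gehring_const DIM('a) q H c0) * emeasure (weighted (\<lambda>y. g y powr (q + \<epsilon>))) B2"
    by (subst nn_integral_cmult) (auto simp: emeasure_weighted)
  finally show ?thesis by (simp add: B1_def B2_def add_left_mono)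
qed

text \<open>Hole filling along radii from \<open>M / 2\<close> to \<open>M\<close> whose gaps halve
  each time. The threshold costs a further factor of at most \<open>2 ^ d\<close> per stage, while
  the smallness of \<open>\<epsilon>\<close> gains \<open>(1/2) ^ (d + 1)\<close>, so the stages sum
  geometrically to at most \<open>2 * Y\<close>. Boundedness of \<open>g\<close> makes the remainder
  finite, and it then tends to zero.\<close>

lemma higher_integrability:
  assumes a: "0 < a"
    and total: "measure \<mu>q (ball z (2 * M)) \<le> vol TYPE('a) (2 * M) * a powr q"
    and \<epsilon>: "0 < \<epsilon>" "\<epsilon> \<le> 1" "\<epsilon> * gehring_const DIM('a) q H c0 \<le> (1/2) ^ (DIM('a) + 1)"
  shows "measure (weighted (\<lambda>y. g y powr (q + \<epsilon>))) (ball z (M / 2)) \<le>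
    2 * c0 powr (1/q) * (40 * A) ^ DIM('a) * vol TYPE('a) (2 * M) * a powr (q + \<epsilon>)"
proof -
  let ?d = "DIM('a)"
  define m where "m = weighted (\<lambda>y. g y powr (q + \<epsilon>))"
  define \<rho> where "\<rho> k = M * (1 - (1/2) ^ (k + 1))" for k :: nat
  define \<Phi> where "\<Phi> k = measure m (ball z (\<rho> k))" for k
  define Y where "Y = c0 powr (1/q) * (40 * A) ^ ?d * vol TYPE('a) (2 * M) * a powr (q + \<epsilon>)"
  have M0: "0 < M" using \<rho>0 by simp
  have fin: "emeasure m (ball z r) < \<infinity>" for r
    unfolding m_def
    by (rule emeasure_weighted_finite[where b="b powr (q + \<epsilon>)"])
       (use q \<epsilon> in \<open>auto intro!: powr_mono2 nonneg bdd\<close>)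
  have step: "\<Phi> k \<le> 2 ^ (?d * k) * Y + (1/2) ^ (?d + 1) * \<Phi> (Suc k)" for k
  proof -
    define \<delta> where "\<delta> = M * (1/2) ^ (k + 2)"
    define t0 where "t0 = c0 powr (1/q) * (10 * A * M / \<delta>) powr (?d / q) * a"
    have \<rho>\<delta>: "\<rho> (Suc k) = \<rho> k + \<delta>" by (simp add: \<rho>_def \<delta>_def algebra_simps)
    have \<rho>M: "\<rho> k \<le> M" "\<rho> (Suc k) \<le> M" using M0 by (simp_all add: \<rho>_def mult_le_cancel_left1)
    have "emeasure m (ball z (\<rho> k)) \<le> ennreal (t0 powr \<epsilon>) * emeasure \<mu>q (ball z (\<rho> k)) +
        ennreal (\<epsilon> * gehring_const DIM('a) q H c0) * emeasure m (ball z (\<rho> (Suc k)))"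
      unfolding m_def \<rho>\<delta> using M0 \<rho>M
      by (intro hole_filling_step[OF _ _ a total \<epsilon>(1,2)]) (auto simp: \<delta>_def t0_def \<rho>_def algebra_simps)
    also have "\<dots> = ennreal (t0 powr \<epsilon> * measure \<mu>q (ball z (\<rho> k)) + \<epsilon> * gehring_const DIM('a) q H c0 * \<Phi> (Suc k))"
      using fin[of "\<rho> (Suc k)"] finite_\<mu>q[of "ball z (\<rho> k)"] \<epsilon> C2_pos
      by (simp add: emeasure_eq_ennreal_measure less_top ennreal_mult'[symmetric] \<Phi>_def ennreal_plus[symmetric] del: ennreal_plus)
    also have "emeasure m (ball z (\<rho> k)) = ennreal (\<Phi> k)"
      using fin[of "\<rho> k"] by (simp add: emeasure_eq_ennreal_measure less_top \<Phi>_def)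
    finally have "\<Phi> k \<le> t0 powr \<epsilon> * measure \<mu>q (ball z (\<rho> k)) + \<epsilon> * gehring_const DIM('a) q H c0 * \<Phi> (Suc k)"
      using \<epsilon> C2_pos by (subst (asm) ennreal_le_iff) (auto simp: \<Phi>_def)
    also have "\<epsilon> * gehring_const DIM('a) q H c0 * \<Phi> (Suc k) \<le> (1/2) ^ (?d + 1) * \<Phi> (Suc k)"
      using \<epsilon>(3) by (intro mult_right_mono) (auto simp: \<Phi>_def)
    also have "t0 powr \<epsilon> * measure \<mu>q (ball z (\<rho> k)) \<le> (c0 powr (1/q) * (40 * A) ^ ?d * 2 ^ (?d * k) * a powr \<epsilon>) * (vol TYPE('a) (2 * M) * a powr q)"
    proof (intro mult_mono)
      have \<delta>': "10 * A * M / \<delta> = 40 * A * 2 ^ k" using M0 by (simp add: \<delta>_def field_simps power_add)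
      have big: "1 \<le> 40 * A * 2 ^ k" using A mult_mono[of 1 "40 * A" 1 "2 ^ k"] by simp
      have "(40 * A * 2 ^ k) powr (?d / q * \<epsilon>) \<le> (40 * A * 2 ^ k) powr (real ?d)"
      proof (intro powr_mono big)
        have "?d / q * \<epsilon> \<le> ?d / 1 * 1" using q \<epsilon> by (intro mult_mono divide_left_mono) auto
        then show "?d / q * \<epsilon> \<le> ?d" by simp
      qed
      also have "\<dots> = (40 * A) ^ ?d * 2 ^ (?d * k)"
        using A by (simp add: powr_realpow power_mult_distrib power_mult[symmetric] mult.commute)
      finally have 1: "(40 * A * 2 ^ k) powr (?d / q * \<epsilon>) \<le> (40 * A) ^ ?d * 2 ^ (?d * k)" .
      have "c0 powr (1/q * \<epsilon>) \<le> c0 powr (1/q)"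
        using c0 q \<epsilon> by (intro powr_mono) (auto simp: field_simps)
      then have "c0 powr (1/q * \<epsilon>) * (40 * A * 2 ^ k) powr (?d / q * \<epsilon>) * a powr \<epsilon> \<le>
          c0 powr (1/q) * ((40 * A) ^ ?d * 2 ^ (?d * k)) * a powr \<epsilon>"
        using A 1 by (intro mult_right_mono mult_mono) auto
      moreover have "t0 powr \<epsilon> = c0 powr (1/q * \<epsilon>) * (40 * A * 2 ^ k) powr (?d / q * \<epsilon>) * a powr \<epsilon>"
        unfolding t0_def \<delta>' using c0 A a by (simp add: powr_mult powr_powr)
      ultimately show "t0 powr \<epsilon> \<le> c0 powr (1/q) * (40 * A) ^ ?d * 2 ^ (?d * k) * a powr \<epsilon>"
        by (simp add: mult.assoc)
      have "measure \<mu>q (ball z (\<rho> k)) \<le> measure \<mu>q (ball z (2 * M))"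
        using finite_\<mu>q[of "ball z (2*M)"] \<rho>M M0 by (intro measure_mono_fmeasurable) (auto simp: fmeasurable_def)
      then show "measure \<mu>q (ball z (\<rho> k)) \<le> vol TYPE('a) (2 * M) * a powr q" using total by simp
    qed (use A in auto)
    also have "\<dots> = 2 ^ (?d * k) * Y" by (simp add: Y_def powr_add mult_ac)
    finally show ?thesis by simp
  qed
  have iter: "\<Phi> 0 \<le> Y * (\<Sum>j<k. (1/2) ^ j) + ((1/2) ^ (?d + 1)) ^ k * \<Phi> k" for k
  proof (induction k)
    case (Suc k)
    have "((1/2) ^ (?d + 1)) ^ k * \<Phi> k \<le> ((1/2) ^ (?d + 1)) ^ k * (2 ^ (?d * k) * Y + (1/2) ^ (?d + 1) * \<Phi> (Suc k))"
      by (intro mult_left_mono step) auto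
    also have "\<dots> = (((1/2) ^ (?d + 1)) ^ k * 2 ^ (?d * k)) * Y + ((1/2) ^ (?d + 1)) ^ Suc k * \<Phi> (Suc k)"
      by (simp add: algebra_simps)
    also have "((1/2) ^ (?d + 1)) ^ k * 2 ^ (?d * k) = ((1/2) ^ k :: real)"
    proof -
      have "(1/2) ^ (?d + 1) * 2 ^ ?d = (1/2 :: real)" by (simp add: power_divide)
      then show ?thesis by (simp only: power_mult power_mult_distrib[symmetric])
    qed
    finally show ?case using Suc by (simp add: algebra_simps)
  qed simp
  have Y0: "0 \<le> Y" using A c0 M0 by (simp add: Y_def)
  have "\<Phi> 0 \<le> 2 * Y + (1/2) ^ k * measure m (ball z M)" for k
  proof -
    have "(\<Sum>j<k. (1/2) ^ j) = 2 - 2 * (1/2 :: real) ^ k" by (induction k) auto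
    then have "(\<Sum>j<k. (1/2) ^ j) \<le> (2::real)" by simp
    from mult_left_mono[OF this Y0] have le: "Y * (\<Sum>j<k. (1/2) ^ j) \<le> 2 * Y" by (simp only: mult.commute)
    have "\<rho> k \<le> M" using M0 by (simp add: \<rho>_def mult_le_cancel_left1)
    then have \<Phi>k: "\<Phi> k \<le> measure m (ball z M)"
      unfolding \<Phi>_def using fin[of M] by (intro measure_mono_fmeasurable) (auto simp: fmeasurable_def m_def)
    have "((1/2) ^ (?d + 1)) ^ k * \<Phi> k \<le> (1/2) ^ k * measure m (ball z M)"
    proof (intro mult_mono)
      show "((1/2) ^ (?d + 1)) ^ k \<le> ((1/2) ^ k :: real)"
        using power_decreasing[of 1 "?d + 1" "1/2 :: real"] by (intro power_mono) auto
      show "\<Phi> k \<le> measure m (ball z M)" by (rule \<Phi>k)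
    qed (auto simp: \<Phi>_def)
    then show ?thesis using iter[of k] le by linarith
  qed
  moreover have "(\<lambda>k. 2 * Y + (1/2) ^ k * measure m (ball z M)) \<longlonglongrightarrow> 2 * Y + 0 * measure m (ball z M)"
    by (intro tendsto_intros LIMSEQ_power_zero) auto
  ultimately have "\<Phi> 0 \<le> 2 * Y"
    using LIMSEQ_le_const[of _ "2 * Y" "\<Phi> 0"] by auto
  then show ?thesis by (simp add: \<Phi>_def \<rho>_def m_def Y_def mult.assoc)
qed

end

section \<open>Grids of cubes and comparison of measures on them\<close>

instance vec :: (countable, finite) countable
  by (rule countable_classI[of "\<lambda>v. to_nat (vec_nth v)"]) (simp add: vec_eq_iff)

text \<open>The offset \<open>1 / 2\<close> puts a corner of every grid at the corner of the unit
  cell, whatever the side \<open>s\<close>. Grids whose sides are integer multiples of one another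
  are then nested, and side \<open>1 / N\<close> gives the fine cells.\<close>

definition cube_index :: "real \<Rightarrow> real^'n \<Rightarrow> int^'n" where
  "cube_index s y = (\<chi> i. \<lfloor>(y $ i + 1 / 2) / s\<rfloor>)"

text \<open>Taken as a fibre of the index map, so that disjointness and covering are immediate; the
  coordinate inequalities are unfolded only for geometry.\<close>

definition cube :: "real \<Rightarrow> int^'n \<Rightarrow> (real^'n) set" where
  "cube s k = cube_index s -` {k}"

lemma mem_cube: "y \<in> cube s k \<longleftrightarrow> cube_index s y = k"
  by (simp add: cube_def)

lemma mem_cube_iff:
  assumes "0 < s"
  shows "y \<in> cube s k \<longleftrightarrow> (\<forall>i. - 1 / 2 + of_int (k $ i) * s \<le> y $ i \<and> y $ i < - 1 / 2 + (of_int (k $ i) + 1) * s)"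
  using assms by (simp add: mem_cube cube_index_def vec_eq_iff floor_eq_iff field_simps)

lemma fine_cell_eq_cube: "0 < N \<Longrightarrow> fine_cell N k = cube (1 / real N) k"
  by (auto simp: fine_cell_def mem_cube_iff)

lemma cube_borel [measurable]:
  fixes k :: "int^'n"
  shows "0 < s \<Longrightarrow> cube s k \<in> sets borel"
proof -
  assume "0 < s"
  then have "cube s k = (\<Inter>i. {y. - 1 / 2 + of_int (k $ i) * s \<le> y $ i} \<inter> {y. y $ i < - 1 / 2 + (of_int (k $ i) + 1) * s})"
    by (auto simp: mem_cube_iff)
  also have "\<dots> \<in> sets borel"
    by (intro sets.countable_INT'' sets.Int borel_closed borel_open closed_Collect_le open_Collect_less)
       (auto intro!: continuous_intros)
  finally show ?thesis .
qed

lemma measurable_cube_index [measurable]: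
  "0 < s \<Longrightarrow> cube_index s \<in> measurable borel (count_space UNIV)"
  by (subst measurable_count_space_eq_countable) (auto simp: cube_def[symmetric])

lemma measurable_cube_index_compose [measurable]:
  fixes f :: "int^'n \<Rightarrow> real"
  assumes "0 < s"
  shows "(\<lambda>y. f (cube_index s y)) \<in> borel_measurable borel"
  using measurable_compose[OF measurable_cube_index[OF assms], of f borel] by simp

lemma emeasure_cube:
  fixes k :: "int^'n"
  assumes s: "0 < s"
  shows "emeasure lborel (cube s k) = ennreal (s ^ CARD('n))"
proof -
  define l where "l = (\<chi> i. - 1 / 2 + of_int (k $ i) * s :: real^'n)"
  define u where "u = (\<chi> i. - 1 / 2 + (of_int (k $ i) + 1) * s :: real^'n)"
  have sub: "box l u \<subseteq> cube s k" "cube s k \<subseteq> cbox l u"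
    by (auto simp: mem_cube_iff[OF s] mem_box_cart l_def u_def less_imp_le)
  have ne: "cbox l u \<noteq> {}"
    using s by (auto simp: interval_ne_empty_cart l_def u_def)
  have "measure lborel (cbox l u) = s ^ CARD('n)"
    using content_cbox_cart[OF ne] by (simp add: l_def u_def algebra_simps)
  then have c: "emeasure lborel (cbox l u) = ennreal (s ^ CARD('n))"
    using emeasure_eq_ennreal_measure[of lborel "cbox l u"] emeasure_lborel_cbox_finite[of l u] by auto
  have "emeasure lborel (cbox l u) = emeasure lborel (box l u)"
    using ne by (simp add: emeasure_lborel_cbox_eq emeasure_lborel_box_eq box_ne_empty)
  then show ?thesis
    using emeasure_mono[OF sub(1), of lborel] emeasure_mono[OF sub(2), of lborel] s c by auto
qed

lemma measure_cube: "0 < s \<Longrightarrow> measure lborel (cube s (k :: int^'n)) = s ^ CARD('n)"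
  by (simp add: measure_def emeasure_cube)

text \<open>The l1 norm dominates the Euclidean one. This crude bound gives the radius
  \<open>d * s\<close> and thereby the smallest radius in the later application of Gehring's
  lemma.\<close>

lemma cube_subset_ball:
  fixes y :: "real^'n"
  assumes s: "0 < s"
  shows "cube s (cube_index s y) \<subseteq> ball y (real CARD('n) * s)"
proof
  fix x :: "real^'n" assume x: "x \<in> cube s (cube_index s y)"
  have y: "y \<in> cube s (cube_index s y)" by (simp add: mem_cube)
  have "\<bar>(y - x) $ i\<bar> < s" for i
    using x[unfolded mem_cube_iff[OF s], rule_format, of i] y[unfolded mem_cube_iff[OF s], rule_format, of i]
    by (simp add: abs_less_iff algebra_simps)
  then have "(\<Sum>i\<in>UNIV. \<bar>(y - x) $ i\<bar>) < (\<Sum>i\<in>(UNIV :: 'n set). s)"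
    by (intro sum_strict_mono) auto
  then show "x \<in> ball y (real CARD('n) * s)"
    using norm_le_l1_cart[of "y - x"] by (simp add: dist_norm)
qed

lemma ball_subset_cubes:
  fixes x :: "real^'n"
  assumes s: "0 < s" and r: "real CARD('n) * s \<le> r"
  obtains I where "ball x r \<subseteq> cube_index s -` I" "cube_index s -` I \<subseteq> ball x (2 * r)"
proof
  show "ball x r \<subseteq> cube_index s -` (cube_index s ` ball x r)" by auto
  show "cube_index s -` (cube_index s ` ball x r) \<subseteq> ball x (2 * r)"
  proof safe
    fix y w assume y: "w \<in> ball x r" "cube_index s y = cube_index s w"
    then have "y \<in> ball w (real CARD('n) * s)" using cube_subset_ball[OF s, of w] by (auto simp: mem_cube)
    then show "y \<in> ball x (2 * r)" using y(1) r dist_triangle[of x y w] by simp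
  qed
qed

lemma emeasure_cubes:
  fixes I :: "(int^'n) set"
  assumes "0 < s" "sets M = sets borel"
  shows "emeasure M (cube_index s -` I) = (\<integral>\<^sup>+k. emeasure M (cube s k) \<partial>count_space I)"
proof -
  have "cube_index s -` I = (\<Union>k\<in>I. cube s k)" by (auto simp: mem_cube)
  moreover have "disjoint_family_on (cube s) I" by (auto simp: disjoint_family_on_def mem_cube)
  ultimately show ?thesis using assms by (simp add: emeasure_UN_countable)
qed

text \<open>The cubes meeting a ball lie in the ball of twice the radius once that radius is at
  least \<open>d * s\<close>. Every passage on balls between a density and its cube means goes
  through this, at the price of one doubling.\<close>

lemma emeasure_ball_le_of_cubes:
  fixes x :: "real^'n"
  assumes s: "0 < s" "real CARD('n) * s \<le> r" and sets: "sets M = sets borel" "sets N = sets borel"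
    and le: "\<And>k :: int^'n. emeasure M (cube s k) \<le> c * emeasure N (cube s k)"
  shows "emeasure M (ball x r) \<le> c * emeasure N (ball x (2 * r))"
proof -
  obtain I where I: "ball x r \<subseteq> cube_index s -` I" "cube_index s -` I \<subseteq> ball x (2 * r)"
    by (rule ball_subset_cubes[OF s])
  have borel: "cube_index s -` I \<in> sets borel"
    using measurable_sets[OF measurable_cube_index[OF s(1)], of I] by simp
  have "emeasure M (ball x r) \<le> emeasure M (cube_index s -` I)"
    using I borel by (intro emeasure_mono) (auto simp: sets)
  also have "\<dots> \<le> c * emeasure N (cube_index s -` I)"
    unfolding emeasure_cubes[OF s(1) sets(1)] emeasure_cubes[OF s(1) sets(2)]
    by (subst nn_integral_cmult[symmetric]) (auto intro!: nn_integral_mono le)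
  also have "\<dots> \<le> c * emeasure N (ball x (2 * r))"
    using I by (intro mult_left_mono emeasure_mono) (auto simp: sets)
  finally show ?thesis .
qed

text \<open>The q-mean rather than the ordinary average: it preserves the mass of
  \<open>n powr q\<close> on each cube and dominates the mass of \<open>n\<close>, so both sides of
  the reverse Hoelder inequality pass to it. Being constant on cubes, it is controlled by its own
  q-mass at scale \<open>s\<close>, which is the assumption \<open>loc\<close>.\<close>

definition cube_mean :: "real \<Rightarrow> real \<Rightarrow> (real^'n \<Rightarrow> real) \<Rightarrow> real^'n \<Rightarrow> real" where
  "cube_mean s q n y = (measure (weighted (\<lambda>y. n y powr q)) (cube s (cube_index s y)) / s ^ CARD('n)) powr (1 / q)"

context
  fixes n :: "real^'n \<Rightarrow> real" and s q b :: real
  assumes n [measurable]: "n \<in> borel_measurable borel" and n0: "\<And>y. 0 \<le> n y" and nb: "\<And>y. n y \<le> b"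
    and s: "0 < s" and q: "1 < q"
begin

lemma cube_mean_measurable [measurable]: "(cube_mean s q n) \<in> borel_measurable borel"
  unfolding cube_mean_def using s by measurable

lemma cube_mean_nonneg: "0 \<le> cube_mean s q n y" by (simp add: cube_mean_def)

lemma powr_bound: "n y powr q \<le> b powr q" using q n0 nb by (intro powr_mono2) auto

lemma bounded_cube: "bounded (cube s (k :: int^'n))"
proof (cases "cube s k = {}")
  case False
  then obtain y where "y \<in> cube s k" by auto
  then have "cube s k \<subseteq> ball y (real CARD('n) * s)" using cube_subset_ball[OF s, of y] by (simp add: mem_cube)
  then show ?thesis by (rule bounded_subset[OF bounded_ball])
qed simp

lemma cube_mean_le: "cube_mean s q n y \<le> b"
proof -
  let ?K = "cube s (cube_index s y)"
  have b: "0 \<le> b" using n0[of y] nb[of y] by simp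
  have "emeasure (weighted (\<lambda>y. n y powr q)) ?K \<le> ennreal (b powr q) * emeasure lborel ?K"
    using s by (intro emeasure_weighted_le powr_bound) auto
  also have "\<dots> = ennreal (b powr q * s ^ CARD('n))"
    using s by (simp add: emeasure_cube ennreal_mult'[symmetric])
  finally have "measure (weighted (\<lambda>y. n y powr q)) ?K \<le> b powr q * s ^ CARD('n)"
    unfolding measure_def using s by (metis enn2real_leI mult_nonneg_nonneg powr_ge_zero zero_le_power less_imp_le)
  then have "cube_mean s q n y \<le> (b powr q) powr (1 / q)"
    unfolding cube_mean_def using s q by (intro powr_mono2) (auto simp: field_simps)
  then show ?thesis using q b by (simp add: powr_powr)
qed

lemma cube_weighted_mean:
  "emeasure (weighted (\<lambda>y. cube_mean s q n y powr q)) (cube s k) = emeasure (weighted (\<lambda>y. n y powr q)) (cube s k)"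
proof -
  define m where "m = measure (weighted (\<lambda>y. n y powr q)) (cube s k)"
  have fin: "emeasure (weighted (\<lambda>y. n y powr q)) (cube s k) < \<infinity>"
    using s by (intro emeasure_weighted_finite[OF _ _ powr_bound] bounded_cube) auto
  have "emeasure (weighted (\<lambda>y. cube_mean s q n y powr q)) (cube s k) = (\<integral>\<^sup>+y\<in>cube s k. ennreal (m / s ^ CARD('n)) \<partial>lborel)"
    unfolding emeasure_weighted[of "\<lambda>y. cube_mean s q n y powr q" "cube s k", simplified, OF cube_borel[OF s]]
    using q s by (intro nn_integral_cong) (auto simp: indicator_def mem_cube cube_mean_def m_def powr_powr)
  also have "\<dots> = ennreal m"
    using s by (simp add: nn_integral_cmult_indicator emeasure_cube ennreal_mult'[symmetric] m_def)
  also have "\<dots> = emeasure (weighted (\<lambda>y. n y powr q)) (cube s k)"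
    using fin by (simp add: m_def emeasure_eq_ennreal_measure less_top)
  finally show ?thesis .
qed

text \<open>By Young's inequality for the quotient of \<open>n\<close> by its mean.\<close>

lemma cube_weighted_le:
  "emeasure (weighted n) (cube s k) \<le> emeasure (weighted (cube_mean s q n)) (cube s k)"
proof -
  obtain g where g: "\<And>y. y \<in> cube s k \<Longrightarrow> cube_mean s q n y = g" "0 \<le> g"
    by (metis cube_mean_nonneg cube_mean_def mem_cube powr_ge_zero)
  have Gq: "emeasure (weighted (\<lambda>y. n y powr q)) (cube s k) = ennreal (g powr q * s ^ CARD('n))"
  proof -
    have "emeasure (weighted (\<lambda>y. n y powr q)) (cube s k) = emeasure (weighted (\<lambda>y. cube_mean s q n y powr q)) (cube s k)"
      by (rule cube_weighted_mean[symmetric])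
    also have "\<dots> = (\<integral>\<^sup>+y\<in>cube s k. ennreal (g powr q) \<partial>lborel)"
      using s by (subst emeasure_weighted) (auto intro!: nn_integral_cong simp: indicator_def g)
    also have "\<dots> = ennreal (g powr q * s ^ CARD('n))"
      using s by (simp add: nn_integral_cmult_indicator emeasure_cube ennreal_mult'[symmetric])
    finally show ?thesis .
  qed
  have eqG: "emeasure (weighted (cube_mean s q n)) (cube s k) = ennreal (g * s ^ CARD('n))"
  proof -
    have "emeasure (weighted (cube_mean s q n)) (cube s k) = (\<integral>\<^sup>+y\<in>cube s k. ennreal g \<partial>lborel)"
      using s by (subst emeasure_weighted) (auto intro!: nn_integral_cong simp: indicator_def g)
    then show ?thesis
      using s g(2) by (simp add: nn_integral_cmult_indicator emeasure_cube ennreal_mult'[symmetric])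
  qed
  show ?thesis
  proof (cases "g = 0")
    case True
    then have "(\<integral>\<^sup>+y. ennreal (n y powr q) * indicator (cube s k) y \<partial>lborel) = 0"
      using Gq q s by (simp add: emeasure_weighted)
    then have "AE y in lborel. ennreal (n y powr q) * indicator (cube s k) y = 0"
      using s by (subst (asm) nn_integral_0_iff_AE) auto
    then have "AE y in lborel. ennreal (n y) * indicator (cube s k) y = 0"
      by eventually_elim (auto simp: indicator_def)
    then have "(\<integral>\<^sup>+y. ennreal (n y) * indicator (cube s k) y \<partial>lborel) = 0"
      using s by (subst nn_integral_0_iff_AE) auto
    then show ?thesis using s by (simp add: emeasure_weighted)
  next
    case False
    then have g0: "0 < g" using g(2) by simp
    have young: "n y \<le> g powr (1 - q) / q * n y powr q + g * (1 - 1 / q)" for y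
    proof -
      have "n y / g * 1 \<le> (n y / g) powr q / q + 1 powr (q / (q - 1)) / (q / (q - 1))"
        using q n0 g0 by (intro Youngs_inequality) (auto simp: field_simps)
      then have "n y / g \<le> (n y powr q / g powr q) / q + (q - 1) / q"
        using n0 g0 by (simp add: powr_divide)
      then have "g * (n y / g) \<le> g * ((n y powr q / g powr q) / q + (q - 1) / q)"
        using g0 by (intro mult_left_mono) auto
      also have "\<dots> = g powr (1 - q) / q * n y powr q + g * (1 - 1 / q)"
        using g0 q by (simp add: powr_diff field_simps)
      finally show ?thesis using g0 by simp
    qed
    have "emeasure (weighted n) (cube s k) \<le>
        (\<integral>\<^sup>+y. ennreal (g powr (1 - q) / q) * (ennreal (n y powr q) * indicator (cube s k) y) + ennreal (g * (1 - 1 / q)) * indicator (cube s k) y \<partial>lborel)"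
      unfolding emeasure_weighted[OF n cube_borel[OF s]]
    proof (intro nn_integral_mono)
      fix y
      have "ennreal (n y) \<le> ennreal (g powr (1 - q) / q) * ennreal (n y powr q) + ennreal (g * (1 - 1 / q))"
        using young[of y] g0 q by (simp add: ennreal_mult'[symmetric] ennreal_plus[symmetric] ennreal_leI del: ennreal_plus)
      then show "ennreal (n y) * indicator (cube s k) y \<le> ennreal (g powr (1 - q) / q) * (ennreal (n y powr q) * indicator (cube s k) y) + ennreal (g * (1 - 1 / q)) * indicator (cube s k) y"
        by (simp add: indicator_def)
    qed
    also have "\<dots> = ennreal (g powr (1 - q) / q) * emeasure (weighted (\<lambda>y. n y powr q)) (cube s k) + ennreal (g * (1 - 1 / q)) * emeasure lborel (cube s k)"
      using s by (subst nn_integral_add) (auto simp: nn_integral_cmult nn_integral_cmult_indicator emeasure_weighted)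
    also have "\<dots> = ennreal (g powr (1 - q) / q * (g powr q * s ^ CARD('n)) + g * (1 - 1 / q) * s ^ CARD('n))"
      unfolding Gq emeasure_cube[OF s] using g0 q s
      by (simp add: ennreal_mult'[symmetric] ennreal_plus[symmetric] del: ennreal_plus)
    also have "g powr (1 - q) / q * (g powr q * s ^ CARD('n)) + g * (1 - 1 / q) * s ^ CARD('n) = g * s ^ CARD('n)"
      using g0 q by (simp add: powr_diff field_simps)
    finally show ?thesis by (simp add: eqG)
  qed
qed

text \<open>The factor \<open>(s / h)\<close> is the price for passing from the cells of side \<open>h\<close>, on which \<open>n\<close> is
  constant, to the cubes of side \<open>s\<close>.\<close>

lemma cube_weighted_power_le:
  fixes h \<epsilon> :: real
  assumes h: "0 < h" and nested: "\<And>x y :: real^'n. cube_index h x = cube_index h y \<Longrightarrow> cube_index s x = cube_index s y"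
    and const: "\<And>x y. cube_index h x = cube_index h y \<Longrightarrow> n x = n y" and \<epsilon>: "0 < \<epsilon>"
  shows "emeasure (weighted (\<lambda>y. n y powr (q + \<epsilon>))) (cube s k) \<le>
    ennreal ((s / h) powr (CARD('n) * \<epsilon> / q)) * emeasure (weighted (\<lambda>y. cube_mean s q n y powr (q + \<epsilon>))) (cube s k)"
proof -
  \<comment> \<open>A single cell of side \<open>h\<close> cannot carry more q-mass than the cube
    containing it, so \<open>n y powr q * h ^ d\<close> is at most \<open>s ^ d\<close> times the
    q-th power of the mean.\<close>
  have pointwise: "n y \<le> (s / h) powr (CARD('n) / q) * cube_mean s q n y" for y
  proof -
    let ?c = "cube h (cube_index h y)" and ?K = "cube s (cube_index s y)"
    have fin: "emeasure (weighted (\<lambda>y. n y powr q)) ?K < \<infinity>"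
      using s by (intro emeasure_weighted_finite[OF _ _ powr_bound] bounded_cube) auto
    have sub: "?c \<subseteq> ?K" by (auto simp: mem_cube intro!: nested)
    have "emeasure (weighted (\<lambda>y. n y powr q)) ?c = (\<integral>\<^sup>+x\<in>?c. ennreal (n y powr q) \<partial>lborel)"
    proof -
      have "n x powr q = n y powr q" if "x \<in> ?c" for x using const[of x y] that by (simp add: mem_cube)
      then show ?thesis using h by (subst emeasure_weighted) (auto intro!: nn_integral_cong simp: indicator_def)
    qed
    also have "\<dots> = ennreal (n y powr q * h ^ CARD('n))"
      using h by (simp add: nn_integral_cmult_indicator emeasure_cube ennreal_mult'[symmetric])
    finally have "measure (weighted (\<lambda>y. n y powr q)) ?c = n y powr q * h ^ CARD('n)"
      using h by (simp add: measure_def)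
    moreover have "measure (weighted (\<lambda>y. n y powr q)) ?c \<le> measure (weighted (\<lambda>y. n y powr q)) ?K"
      using sub fin h s by (intro measure_mono_fmeasurable) (auto simp: fmeasurable_def)
    ultimately have "n y powr q \<le> (s / h) ^ CARD('n) * (measure (weighted (\<lambda>y. n y powr q)) ?K / s ^ CARD('n))"
      using h s by (simp add: field_simps)
    then have "(n y powr q) powr (1 / q) \<le> ((s / h) ^ CARD('n) * (measure (weighted (\<lambda>y. n y powr q)) ?K / s ^ CARD('n))) powr (1 / q)"
      using q by (intro powr_mono2) auto
    also have "\<dots> = (s / h) powr (CARD('n) / q) * cube_mean s q n y"
    proof -
      have "((s / h) ^ CARD('n)) powr (1 / q) = (s / h) powr (CARD('n) / q)"
        using h s by (simp add: powr_realpow[symmetric] powr_powr)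
      then show ?thesis unfolding cube_mean_def by (subst powr_mult) simp
    qed
    finally show ?thesis using q n0 by (simp add: powr_powr)
  qed
  obtain g where g: "\<And>y. y \<in> cube s k \<Longrightarrow> cube_mean s q n y = g" "0 \<le> g"
    by (metis cube_mean_nonneg cube_mean_def mem_cube powr_ge_zero)
  \<comment> \<open>Only the excess power \<open>n powr \<epsilon>\<close> is bounded pointwise; the
    remaining q-mass is preserved exactly. Hence the exponent \<open>d * \<epsilon> / q\<close> in
    the loss.\<close>
  define a where "a = ((s / h) powr (CARD('n) / q) * g) powr \<epsilon>"
  have "emeasure (weighted (\<lambda>y. n y powr (q + \<epsilon>))) (cube s k) \<le>
      (\<integral>\<^sup>+y. ennreal a * (ennreal (n y powr q) * indicator (cube s k) y) \<partial>lborel)"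
    unfolding emeasure_weighted[of "\<lambda>y. n y powr (q + \<epsilon>)" "cube s k", simplified, OF cube_borel[OF s]]
  proof (intro nn_integral_mono)
    fix y
    have "n y powr (q + \<epsilon>) \<le> a * n y powr q" if "y \<in> cube s k"
      unfolding a_def powr_add using pointwise[of y] g(1)[OF that] n0 \<epsilon>
      by (subst mult.commute) (intro mult_right_mono powr_mono2, auto)
    then show "ennreal (n y powr (q + \<epsilon>)) * indicator (cube s k) y \<le> ennreal a * (ennreal (n y powr q) * indicator (cube s k) y)"
      by (auto simp: indicator_def ennreal_mult'[symmetric] a_def ennreal_leI)
  qed
  also have "\<dots> = ennreal a * emeasure (weighted (\<lambda>y. cube_mean s q n y powr q)) (cube s k)"
    using s by (simp add: nn_integral_cmult emeasure_weighted cube_weighted_mean)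
  also have "\<dots> = (\<integral>\<^sup>+y. ennreal a * (ennreal (cube_mean s q n y powr q) * indicator (cube s k) y) \<partial>lborel)"
    using s by (simp add: nn_integral_cmult emeasure_weighted)
  also have "\<dots> = (\<integral>\<^sup>+y. ennreal ((s / h) powr (CARD('n) * \<epsilon> / q)) * (ennreal (cube_mean s q n y powr (q + \<epsilon>)) * indicator (cube s k) y) \<partial>lborel)"
    using s h g by (intro nn_integral_cong)
      (auto simp: indicator_def a_def powr_mult powr_powr powr_add ennreal_mult'[symmetric] mult_ac)
  also have "\<dots> = ennreal ((s / h) powr (CARD('n) * \<epsilon> / q)) * emeasure (weighted (\<lambda>y. cube_mean s q n y powr (q + \<epsilon>))) (cube s k)"
    using s by (simp add: nn_integral_cmult emeasure_weighted)
  finally show ?thesis .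
qed

end

section \<open>Higher integrability of grid densities\<close>

lemma set_integral_eq_measure_weighted:
  assumes "f \<in> borel_measurable borel" "\<And>y. 0 \<le> f y" "S \<in> sets borel"
  shows "(LINT y:S|lborel. f y) = measure (weighted f) S"
proof -
  have "(LINT y:S|lborel. f y) = enn2real (\<integral>\<^sup>+y. ennreal (indicator S y * f y) \<partial>lborel)"
    unfolding set_lebesgue_integral_def using assms
    by (simp add: integral_eq_nn_integral)
  also have "(\<integral>\<^sup>+y. ennreal (indicator S y * f y) \<partial>lborel) = emeasure (weighted f) S"
    using assms by (subst emeasure_weighted) (auto intro!: nn_integral_cong simp: indicator_def)
  finally show ?thesis by (simp add: measure_def)
qed

text \<open>All data that vary with the environment, the pole and the radius are quantified inside,
  so that \<open>C\<close> is chosen before them. The power of \<open>R\<close> is that of a mass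
  \<open>T\<close> spread evenly over a ball of radius \<open>R\<close>; the power of
  \<open>L\<close> is the loss between cubes and cells.\<close>

definition gains_integrability :: "real \<Rightarrow> real \<Rightarrow> real \<Rightarrow> real \<Rightarrow> real \<Rightarrow> (real^'n \<Rightarrow> real) \<Rightarrow> bool" where
  "gains_integrability h H0 q \<epsilon> C n \<longleftrightarrow> (\<forall>b z R L T.
    n \<in> borel_measurable borel \<and> (\<forall>y. 0 \<le> n y \<and> n y \<le> b) \<and>
    (\<forall>x y. cube_index h x = cube_index h y \<longrightarrow> n x = n y) \<and> 1 \<le> L \<and> real CARD('n) * L \<le> R \<and>
    (\<forall>x r. L \<le> r \<and> ball x (16 * r) \<subseteq> ball z (1024 * R) \<longrightarrow>
      average (ball x r) (\<lambda>y. n y powr q) powr (1 / q) \<le> H0 * average (ball x (16 * r)) n) \<and>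
    0 < T \<and> measure (weighted n) (ball z (1024 * R)) \<le> T \<longrightarrow>
    measure (weighted (\<lambda>y. n y powr (q + \<epsilon>))) (ball z (4 * R)) powr (1 / (q + \<epsilon>)) \<le>
      C * L powr (CARD('n) / q - CARD('n) / (q + \<epsilon>)) * R powr (CARD('n) / (q + \<epsilon>) - CARD('n)) * T)"

text \<open>Gehring's lemma is applied to the q-means over cubes of side between \<open>L\<close>
  and \<open>2 * L\<close>. The dilation 64 is 2 * 16 * 2: from the means to \<open>n\<close>, the
  given inequality, and back to the means. In \<open>H = 4 ^ d * H'\<close> one factor
  \<open>2 ^ d\<close> pays for the volume of the first doubling and one for the last.\<close>

theorem grid_higher_integrability:
  fixes H0 h q :: real
  assumes q: "1 < q" and h: "0 < h" "h \<le> 1"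
  shows "\<exists>\<epsilon>0>0. \<forall>\<epsilon>. 0 < \<epsilon> \<and> \<epsilon> \<le> \<epsilon>0 \<longrightarrow> (\<exists>C>0. \<forall>n :: real^'n \<Rightarrow> real. gains_integrability h H0 q \<epsilon> C n)"
proof -
  let ?d = "CARD('n)"
  define \<omega> where "\<omega> = unit_ball_vol (real ?d)"
  define H' where "H' = max 1 H0"
  define H where "H = 4 ^ ?d * H'"
  \<comment> \<open>The ball of radius \<open>d * s\<close> contains the cube of volume
    \<open>s ^ d\<close>, and \<open>\<omega> * d ^ d\<close> is the ratio of their volumes.\<close>
  define c0 where "c0 = max 1 (\<omega> * real ?d ^ ?d)"
  define K where "K = gehring_const ?d q H c0"
  have \<omega>: "0 < \<omega>" by (simp add: \<omega>_def unit_ball_vol_pos)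
  have H': "1 \<le> H'" by (simp add: H'_def)
  have H: "1 \<le> H" unfolding H_def using H' mult_mono[of 1 "4 ^ ?d" 1 H'] by simp
  have c0: "1 \<le> c0" by (simp add: c0_def)
  have d1: "1 \<le> real ?d" by (simp add: Suc_le_eq)
  have K: "0 < K" unfolding K_def gehring_const_def gehring_scale_def using c0 H q by simp
  define \<epsilon>0 where "\<epsilon>0 = min 1 ((1/2) ^ (?d + 1) / K)"
  have "\<epsilon>0 > 0" using K by (simp add: \<epsilon>0_def)
  moreover have "\<exists>C>0. \<forall>n :: real^'n \<Rightarrow> real. gains_integrability h H0 q \<epsilon> C n"
    if \<epsilon>: "0 < \<epsilon>" "\<epsilon> \<le> \<epsilon>0" for \<epsilon>
  proof -
    define q' where "q' = q + \<epsilon>"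
    have q': "q < q'" "1 < q'" using \<epsilon> q by (auto simp: q'_def)
    define C1 where "C1 = 2 * c0 powr (1/q) * (40 * 64) ^ ?d * \<omega> * 32 ^ ?d"
    have C1: "0 < C1" using c0 \<omega> by (simp add: C1_def)
    define C where "C = (2 / h) powr (?d / q - ?d / q') * C1 powr (1 / q') * (2 ^ ?d * H' / (\<omega> * 1024 ^ ?d))"
    have C: "0 < C" unfolding C_def using C1 h H' \<omega> by simp
    have main: "measure (weighted (\<lambda>y. n y powr q')) (ball z (4 * R)) powr (1 / q') \<le>
      C * L powr (?d / q - ?d / q') * R powr (?d / q' - ?d) * T"
      if n [measurable]: "n \<in> borel_measurable borel" and nb: "\<And>y. 0 \<le> n y" "\<And>y. n y \<le> b"
        and const: "\<And>x y. cube_index h x = cube_index h y \<Longrightarrow> n x = n y" and L: "1 \<le> L" "real ?d * L \<le> R"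
        and RH: "\<And>x r. L \<le> r \<Longrightarrow> ball x (16 * r) \<subseteq> ball z (1024 * R) \<Longrightarrow>
          average (ball x r) (\<lambda>y. n y powr q) powr (1 / q) \<le> H0 * average (ball x (16 * r)) n"
        and T: "0 < T" "measure (weighted n) (ball z (1024 * R)) \<le> T"
      for n :: "real^'n \<Rightarrow> real" and b z R L T
    proof -
      have R: "1 \<le> R" using L d1 mult_mono[of 1 "real ?d" 1 L] by simp
      \<comment> \<open>\<open>s = h * m\<close> is the least multiple of \<open>h\<close> that
        reaches \<open>L\<close>: a multiple, so that the cells nest in the cubes, and at most
        \<open>2 * L\<close>, because \<open>h \<le> 1 \<le> L\<close>.\<close>
      define m where "m = \<lceil>L / h\<rceil>"
      define s where "s = h * of_int m"
      define \<rho>0 where "\<rho>0 = real ?d * s"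
      define Gf where "Gf = cube_mean s q n"
      have m: "1 \<le> m" unfolding m_def using L h by (simp add: le_ceiling_iff)
      have sL: "L \<le> s" unfolding s_def m_def using h by (metis le_of_int_ceiling mult.commute pos_divide_le_eq)
      have "of_int m < L / h + 1" unfolding m_def by linarith
      then have "s < L + h" using h mult_strict_left_mono[of "of_int m" "L / h + 1" h] by (simp add: s_def field_simps)
      then have s2: "s \<le> 2 * L" using h L by simp
      have s: "0 < s" using sL L by simp
      have \<rho>0: "0 < \<rho>0" "L \<le> \<rho>0" "\<rho>0 \<le> 2 * R"
      proof -
        show "0 < \<rho>0" using s by (simp add: \<rho>0_def)
        show "L \<le> \<rho>0" unfolding \<rho>0_def using sL L d1 mult_mono[of 1 "real ?d" L s] by simp
        have "\<rho>0 \<le> real ?d * (2 * L)" unfolding \<rho>0_def using s2 by (intro mult_left_mono) auto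
        then show "\<rho>0 \<le> 2 * R" using L by simp
      qed
      have nested: "cube_index s x = cube_index s y" if "cube_index h x = cube_index h y" for x y :: "real^'n"
      proof -
        have "cube_index s x = (\<chi> i. cube_index h x $ i div m)" for x :: "real^'n"
          unfolding vec_eq_iff cube_index_def s_def using m
          by (simp add: floor_divide_real_eq_div[symmetric])
        then show ?thesis using that by simp
      qed
      have Gm [measurable]: "Gf \<in> borel_measurable borel" unfolding Gf_def by (rule cube_mean_measurable[OF n nb s q])
      have Gb: "0 \<le> Gf y" "Gf y \<le> b" for y unfolding Gf_def by (rule cube_mean_nonneg[OF n nb s q] cube_mean_le[OF n nb s q])+
      have fin: "emeasure (weighted (\<lambda>y. f y powr p)) (ball x r) < \<infinity>"
        if "f \<in> borel_measurable borel" "\<And>y. 0 \<le> f y" "\<And>y. f y \<le> b" "0 \<le> p" for f :: "real^'n \<Rightarrow> real" and p x r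
        using that by (intro emeasure_weighted_finite[where b="b powr p"]) (auto intro: powr_mono2)
      have fin1: "emeasure (weighted f) (ball x r) < \<infinity>"
        if "f \<in> borel_measurable borel" "\<And>y. f y \<le> b" for f :: "real^'n \<Rightarrow> real" and x r
        using that by (intro emeasure_weighted_finite[where b=b]) auto
      have mball: "measure lborel (ball x r) = \<omega> * r ^ ?d" if "0 \<le> r" for x :: "real^'n" and r
        using that by (simp add: content_ball \<omega>_def)
      have RHn: "measure (weighted (\<lambda>y. n y powr q)) (ball x r) \<le>
          \<omega> * r ^ ?d * (H' * measure (weighted n) (ball x (16 * r)) / (\<omega> * (16 * r) ^ ?d)) powr q"
        if r: "L \<le> r" "ball x (16 * r) \<subseteq> ball z (1024 * R)" for x r
      proof -
        let ?X = "measure (weighted (\<lambda>y. n y powr q)) (ball x r) / (\<omega> * r ^ ?d)"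
        let ?Y = "measure (weighted n) (ball x (16 * r)) / (\<omega> * (16 * r) ^ ?d)"
        have r0: "0 < r" using r L by simp
        have "?X powr (1 / q) \<le> H0 * ?Y"
          using RH[OF r] r0 by (simp add: average_def set_integral_eq_measure_weighted nb mball)
        also have "\<dots> \<le> H' * ?Y" using \<omega> r0 by (intro mult_right_mono) (auto simp: H'_def)
        finally have "(?X powr (1 / q)) powr q \<le> (H' * ?Y) powr q"
          using q by (intro powr_mono2) auto
        then have "?X \<le> (H' * ?Y) powr q" using q \<omega> r0 by (simp add: powr_powr)
        then show ?thesis using \<omega> r0 by (simp add: field_simps)
      qed
      have Gn: "measure (weighted (\<lambda>y. Gf y powr q)) (ball x r) \<le> measure (weighted (\<lambda>y. n y powr q)) (ball x (2 * r))"
        if r: "\<rho>0 \<le> r" for x r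
      proof -
        have "emeasure (weighted (\<lambda>y. Gf y powr q)) (ball x r) \<le> 1 * emeasure (weighted (\<lambda>y. n y powr q)) (ball x (2 * r))"
          by (rule emeasure_ball_le_of_cubes[OF s r[unfolded \<rho>0_def]]) (simp_all add: Gf_def cube_weighted_mean[OF n nb s q])
        then show ?thesis
          unfolding measure_def using fin[OF n nb, of q x "2 * r"] q by (intro enn2real_mono) auto
      qed
      have nG: "measure (weighted n) (ball x r) \<le> measure (weighted Gf) (ball x (2 * r))"
        if r: "\<rho>0 \<le> r" for x r
      proof -
        have "emeasure (weighted n) (ball x r) \<le> 1 * emeasure (weighted Gf) (ball x (2 * r))"
          by (rule emeasure_ball_le_of_cubes[OF s r[unfolded \<rho>0_def]]) (simp_all add: Gf_def cube_weighted_le[OF n nb s q])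
        then show ?thesis
          unfolding measure_def using fin1[OF Gm Gb(2), of x "2 * r"] by (intro enn2real_mono) auto
      qed
      \<comment> \<open>As \<open>q > 1\<close>, a factor \<open>2 ^ d\<close> outside can be moved
        under the q-th power, where it becomes part of the reverse Hoelder constant.\<close>
      have scale: "\<omega> * (2 * r) ^ ?d * Z powr q \<le> \<omega> * r ^ ?d * (2 ^ ?d * Z) powr q" if "0 \<le> r" "0 \<le> Z" for r Z :: real
      proof -
        have "(2 ^ ?d) powr 1 \<le> ((2::real) ^ ?d) powr q" using q by (intro powr_mono) auto
        then have "\<omega> * r ^ ?d * (2 ^ ?d * Z powr q) \<le> \<omega> * r ^ ?d * ((2 ^ ?d) powr q * Z powr q)"
          using \<omega> that by (intro mult_left_mono mult_right_mono) auto
        then show ?thesis using that by (simp add: power_mult_distrib powr_mult mult_ac)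
      qed
      \<comment> \<open>With outer radius \<open>16 * R\<close> the conclusion lands on
        \<open>8 * R\<close>, which contains the cubes meeting \<open>ball z (4 * R)\<close>; the
        total mass is then needed on \<open>32 * R\<close>.\<close>
      interpret W: weak_reverse_Hoelder Gf q 64 H c0 \<rho>0 b "16 * R" z
      proof
        show "Gf \<in> borel_measurable borel" by (rule Gm)
        show "0 \<le> Gf y" "Gf y \<le> b" for y by (rule Gb)+
        show "\<rho>0 \<le> 16 * R" using \<rho>0 R by simp
        show "measure (weighted (\<lambda>y. Gf y powr q)) (ball x r) \<le> unit_ball_vol (real DIM(real^'n)) * r ^ DIM(real^'n) *
            (H * measure (weighted Gf) (ball x (64 * r)) / (unit_ball_vol (real DIM(real^'n)) * (64 * r) ^ DIM(real^'n))) powr q"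
          if r: "\<rho>0 \<le> r" "ball x (64 * r) \<subseteq> ball z (16 * R)" for x r
        proof -
          have r0: "0 < r" using r \<rho>0 by simp
          let ?g = "measure (weighted Gf) (ball x (64 * r))"
          have "measure (weighted (\<lambda>y. Gf y powr q)) (ball x r) \<le> measure (weighted (\<lambda>y. n y powr q)) (ball x (2 * r))"
            by (rule Gn[OF r(1)])
          also have "\<dots> \<le> \<omega> * (2 * r) ^ ?d * (H' * measure (weighted n) (ball x (16 * (2 * r))) / (\<omega> * (16 * (2 * r)) ^ ?d)) powr q"
          proof (rule RHn)
            show "L \<le> 2 * r" using r \<rho>0 by simp
            have "ball x (16 * (2 * r)) \<subseteq> ball x (64 * r)" using r0 by (intro subset_ball) simp
            also have "\<dots> \<subseteq> ball z (1024 * R)" using r(2) subset_ball[of "16 * R" "1024 * R" z] R by auto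
            finally show "ball x (16 * (2 * r)) \<subseteq> ball z (1024 * R)" .
          qed
          also have "\<dots> \<le> \<omega> * (2 * r) ^ ?d * (H' * ?g / (\<omega> * (16 * (2 * r)) ^ ?d)) powr q"
            using nG[of "16 * (2 * r)" x] r r0 \<rho>0 \<omega> H' q
            by (intro mult_left_mono powr_mono2 divide_right_mono) auto
          also have "H' * ?g / (\<omega> * (16 * (2 * r)) ^ ?d) = 2 ^ ?d * (H' * ?g / (\<omega> * (64 * r) ^ ?d))"
            using r0 \<omega> by (simp add: power_mult_distrib field_simps) (simp add: power_mult_distrib[symmetric])
          also have "\<omega> * (2 * r) ^ ?d * (2 ^ ?d * (H' * ?g / (\<omega> * (64 * r) ^ ?d))) powr q \<le>
            \<omega> * r ^ ?d * (2 ^ ?d * (2 ^ ?d * (H' * ?g / (\<omega> * (64 * r) ^ ?d)))) powr q"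
            using r0 H' \<omega> by (intro scale) auto
          also have "2 ^ ?d * (2 ^ ?d * (H' * ?g / (\<omega> * (64 * r) ^ ?d))) = H * ?g / (\<omega> * (64 * r) ^ ?d)"
          proof -
            have "(4 :: real) ^ ?d = 2 ^ ?d * 2 ^ ?d" by (simp add: power_mult_distrib[symmetric])
            then show ?thesis by (simp add: H_def)
          qed
          finally show ?thesis by (simp add: \<omega>_def)
        qed
        show "Gf x powr q \<le> c0 * measure (weighted (\<lambda>y. Gf y powr q)) (ball x \<rho>0) / (unit_ball_vol (real DIM(real^'n)) * \<rho>0 ^ DIM(real^'n))" for x
        proof -
          let ?K = "cube s (cube_index s x)"
          have "Gf x powr q = measure (weighted (\<lambda>y. n y powr q)) ?K / s ^ ?d"
            using q s by (simp add: Gf_def cube_mean_def powr_powr)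
          also have "measure (weighted (\<lambda>y. n y powr q)) ?K = measure (weighted (\<lambda>y. Gf y powr q)) ?K"
            unfolding measure_def Gf_def by (simp add: cube_weighted_mean[OF n nb s q])
          also have "\<dots> \<le> measure (weighted (\<lambda>y. Gf y powr q)) (ball x \<rho>0)"
            unfolding \<rho>0_def using cube_subset_ball[OF s, of x] fin[OF Gm Gb, of q x \<rho>0] q s
            by (intro measure_mono_fmeasurable) (auto simp: fmeasurable_def \<rho>0_def)
          also have "measure (weighted (\<lambda>y. Gf y powr q)) (ball x \<rho>0) / s ^ ?d =
              (\<omega> * real ?d ^ ?d) * measure (weighted (\<lambda>y. Gf y powr q)) (ball x \<rho>0) / (\<omega> * \<rho>0 ^ ?d)"
            using \<omega> s by (simp add: \<rho>0_def power_mult_distrib)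
          also have "\<dots> \<le> c0 * measure (weighted (\<lambda>y. Gf y powr q)) (ball x \<rho>0) / (\<omega> * \<rho>0 ^ ?d)"
            using \<omega> \<rho>0 by (intro divide_right_mono mult_right_mono) (auto simp: c0_def)
          finally show ?thesis using s by (simp add: \<omega>_def divide_right_mono)
        qed
      qed (use q H c0 \<rho>0 in auto)
      \<comment> \<open>An upper bound for the q-mean of \<open>Gf\<close> over
        \<open>ball z (32 * R)\<close>: the given inequality is used at radius
        \<open>64 * R\<close>, whose dilate is all of \<open>ball z (1024 * R)\<close>. The factor
        \<open>2 ^ d\<close> comes from \<open>scale\<close>.\<close>
      define a where "a = 2 ^ ?d * (H' * T / (\<omega> * (1024 * R) ^ ?d))"
      have a: "0 < a" using H' T R \<omega> by (simp add: a_def)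
      have total: "measure (weighted (\<lambda>y. Gf y powr q)) (ball z (32 * R)) \<le> \<omega> * (32 * R) ^ ?d * a powr q"
      proof -
        have "measure (weighted (\<lambda>y. Gf y powr q)) (ball z (32 * R)) \<le> measure (weighted (\<lambda>y. n y powr q)) (ball z (2 * (32 * R)))"
          using \<rho>0 R by (intro Gn) auto
        also have "\<dots> \<le> \<omega> * (2 * (32 * R)) ^ ?d * (H' * measure (weighted n) (ball z (1024 * R)) / (\<omega> * (1024 * R) ^ ?d)) powr q"
        proof -
          have e: "16 * (2 * (32 * R)) = 1024 * R" by simp
          show ?thesis using \<rho>0 R by (intro RHn[of "2 * (32 * R)" z, unfolded e]) auto
        qed
        also have "\<dots> \<le> \<omega> * (2 * (32 * R)) ^ ?d * (H' * T / (\<omega> * (1024 * R) ^ ?d)) powr q"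
          using T R \<omega> H' q by (intro mult_left_mono powr_mono2 divide_right_mono) auto
        also have "\<dots> \<le> \<omega> * (32 * R) ^ ?d * a powr q"
          unfolding a_def using R T H' \<omega> by (intro scale) auto
        finally show ?thesis .
      qed
      have G': "measure (weighted (\<lambda>y. Gf y powr q')) (ball z (8 * R)) \<le> C1 * R ^ ?d * a powr q'"
      proof -
        have "measure (weighted (\<lambda>y. Gf y powr (q + \<epsilon>))) (ball z (16 * R / 2)) \<le>
          2 * c0 powr (1/q) * (40 * 64) ^ DIM(real^'n) * (unit_ball_vol (real DIM(real^'n)) * (2 * (16 * R)) ^ DIM(real^'n)) * a powr (q + \<epsilon>)"
        proof (rule W.higher_integrability[OF a])
          show "\<epsilon> * gehring_const DIM(real^'n) q H c0 \<le> (1 / 2) ^ (DIM(real^'n) + 1)"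
            using \<epsilon> K by (simp add: \<epsilon>0_def K_def[symmetric] field_simps)
        qed (use total \<epsilon> in \<open>auto simp: \<omega>_def \<epsilon>0_def\<close>)
        then show ?thesis by (simp add: q'_def C1_def \<omega>_def power_mult_distrib mult_ac)
      qed
      have n': "measure (weighted (\<lambda>y. n y powr q')) (ball z (4 * R)) \<le>
          (s / h) powr (?d * \<epsilon> / q) * measure (weighted (\<lambda>y. Gf y powr q')) (ball z (8 * R))"
      proof -
        have "real ?d * s \<le> 4 * R" using \<rho>0 R unfolding \<rho>0_def by simp
        then have "emeasure (weighted (\<lambda>y. n y powr q')) (ball z (4 * R)) \<le>
            ennreal ((s / h) powr (?d * \<epsilon> / q)) * emeasure (weighted (\<lambda>y. Gf y powr q')) (ball z (2 * (4 * R)))"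
          unfolding Gf_def q'_def
          by (rule emeasure_ball_le_of_cubes[OF s _ sets_weighted sets_weighted cube_weighted_power_le[OF n nb s q h(1) nested const \<epsilon>(1)]])
        also have "\<dots> = ennreal ((s / h) powr (?d * \<epsilon> / q)) * emeasure (weighted (\<lambda>y. Gf y powr q')) (ball z (8 * R))"
          by simp
        also have "\<dots> = ennreal ((s / h) powr (?d * \<epsilon> / q) * measure (weighted (\<lambda>y. Gf y powr q')) (ball z (8 * R)))"
          using fin[OF Gm Gb, of q' z "8 * R"] q'
          by (simp add: emeasure_eq_ennreal_measure less_top ennreal_mult'[symmetric])
        finally show ?thesis
          using fin[OF n nb, of q' z "4 * R"] q' by (simp add: emeasure_eq_ennreal_measure less_top)
      qed
      have "measure (weighted (\<lambda>y. n y powr q')) (ball z (4 * R)) \<le> (s / h) powr (?d * \<epsilon> / q) * (C1 * R ^ ?d * a powr q')"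
        by (rule order_trans[OF n' mult_left_mono[OF G']]) simp
      then have "measure (weighted (\<lambda>y. n y powr q')) (ball z (4 * R)) powr (1 / q') \<le> ((s / h) powr (?d * \<epsilon> / q) * (C1 * R ^ ?d * a powr q')) powr (1 / q')"
        using q' by (intro powr_mono2) auto
      also have "\<dots> = (s / h) powr (?d / q - ?d / q') * C1 powr (1 / q') * R powr (?d / q') * a"
      proof -
        have "?d * \<epsilon> / q * (1 / q') = ?d / q - ?d / q'" using q q' by (simp add: q'_def field_simps)
        then have "((s / h) powr (?d * \<epsilon> / q)) powr (1 / q') = (s / h) powr (?d / q - ?d / q')"
          by (simp only: powr_powr)
        then show ?thesis
          using C1 R a q' by (simp add: powr_mult powr_powr powr_realpow[symmetric] mult.assoc)
      qed
      also have "\<dots> \<le> ((2 / h) powr (?d / q - ?d / q') * L powr (?d / q - ?d / q')) * C1 powr (1 / q') * R powr (?d / q') * a"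
      proof -
        have "(s / h) powr (?d / q - ?d / q') \<le> (2 / h * L) powr (?d / q - ?d / q')"
          using s s2 h q q' by (intro powr_mono2) (auto simp: field_simps)
        also have "\<dots> = (2 / h) powr (?d / q - ?d / q') * L powr (?d / q - ?d / q')"
          using h L by (intro powr_mult)
        finally show ?thesis using C1 a by (intro mult_right_mono) auto
      qed
      also have "\<dots> = C * L powr (?d / q - ?d / q') * R powr (?d / q' - ?d) * T"
        using R by (simp add: C_def a_def powr_diff powr_realpow power_mult_distrib field_simps)
      finally show ?thesis .
    qed
    show ?thesis
      unfolding gains_integrability_def
    proof (intro exI[of _ C] conjI allI impI C, elim conjE, goal_cases)
      case (1 n b z R L T)
      show ?case by (rule main[unfolded q'_def]) (use 1 in blast)+
    qed
  qed
  ultimately show ?thesis by blast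
qed

section \<open>Smallest eigenvalues and quadratic forms\<close>

lemma symmetric_matrix_dot:
  fixes M :: "real^'n^'n"
  assumes "transpose M = M"
  shows "v \<bullet> (M *v w) = (M *v v) \<bullet> w"
  using assms dot_lmul_matrix[of v M w] transpose_matrix_vector[of M v] by simp

text \<open>A minimiser \<open>v\<close> of the quadratic form on the unit sphere, with value
  \<open>c\<close>, is an eigenvector: put \<open>u = M v - c v\<close>. The form minus
  \<open>c |w|^2\<close> is nonnegative along \<open>v + t u\<close> and vanishes at
  \<open>t = 0\<close>, so its linear coefficient \<open>2 |u|^2\<close> must be zero.\<close>

lemma rayleigh_minimum:
  fixes M :: "real^'n^'n"
  assumes sym: "transpose M = M"
  obtains v where "norm v = 1" "M *v v = (v \<bullet> (M *v v)) *\<^sub>R v"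
    "\<And>w. (v \<bullet> (M *v v)) * (w \<bullet> w) \<le> w \<bullet> (M *v w)"
proof -
  have "compact (sphere (0::real^'n) 1)" "sphere (0::real^'n) 1 \<noteq> {}" by auto
  moreover have "continuous_on (sphere 0 1) (\<lambda>v::real^'n. v \<bullet> (M *v v))"
    by (intro continuous_intros matrix_vector_mult_linear_continuous_on)
  ultimately obtain v where v: "norm v = 1" "\<And>w. norm w = 1 \<Longrightarrow> v \<bullet> (M *v v) \<le> w \<bullet> (M *v w)"
    using continuous_attains_inf[of "sphere (0::real^'n) 1" "\<lambda>v. v \<bullet> (M *v v)"] by auto
  define c where "c = v \<bullet> (M *v v)"
  have min: "c * (w \<bullet> w) \<le> w \<bullet> (M *v w)" for w
  proof (cases "w = 0")
    case False
    have "c \<le> ((1 / norm w) *\<^sub>R w) \<bullet> (M *v ((1 / norm w) *\<^sub>R w))"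
      unfolding c_def using False by (intro v(2)) simp
    also have "\<dots> = (w \<bullet> (M *v w)) / (w \<bullet> w)"
      by (simp add: matrix_vector_mult_scaleR power2_norm_eq_inner[symmetric] power2_eq_square)
    finally show ?thesis using False by (simp add: field_simps)
  qed simp
  define u where "u = M *v v - c *\<^sub>R v"
  have "0 \<le> 2 * t * (u \<bullet> u) + t\<^sup>2 * (u \<bullet> (M *v u) - c * (u \<bullet> u))" for t
  proof -
    have 1: "(v + t *\<^sub>R u) \<bullet> (v + t *\<^sub>R u) = 1 + 2 * t * (u \<bullet> v) + t\<^sup>2 * (u \<bullet> u)"
      using v(1) by (simp add: inner_add_left inner_add_right inner_commute[of v u] power2_eq_square norm_eq_1 algebra_simps)
    have 2: "(v + t *\<^sub>R u) \<bullet> (M *v (v + t *\<^sub>R u)) = c + 2 * t * (u \<bullet> (M *v v)) + t\<^sup>2 * (u \<bullet> (M *v u))"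
      using symmetric_matrix_dot[OF sym, of v u]
      by (simp add: c_def inner_add_left inner_add_right matrix_vector_mult_scaleR matrix_vector_right_distrib
          inner_commute[of "M *v v" u] power2_eq_square algebra_simps)
    have "c * (1 + 2 * t * (u \<bullet> v) + t\<^sup>2 * (u \<bullet> u)) \<le> c + 2 * t * (u \<bullet> (M *v v)) + t\<^sup>2 * (u \<bullet> (M *v u))"
      using min[of "v + t *\<^sub>R u"] unfolding 1 2 .
    moreover have "u \<bullet> (M *v v) = u \<bullet> u + c * (u \<bullet> v)"
      by (subst (3) u_def) (simp add: inner_diff_right)
    ultimately show ?thesis by (simp add: algebra_simps)
  qed
  note quad = this
  have "u \<bullet> u = 0"
  proof (rule ccontr)
    assume ne: "u \<bullet> u \<noteq> 0"
    define a where "a = u \<bullet> u"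
    define b where "b = \<bar>u \<bullet> (M *v u) - c * (u \<bullet> u)\<bar> + 1"
    have a: "0 < a" using ne by (simp add: a_def)
    have b: "u \<bullet> (M *v u) - c * (u \<bullet> u) < b" "0 < b" by (auto simp: b_def)
    have "0 \<le> 2 * (- a / b) * a + (- a / b)\<^sup>2 * (u \<bullet> (M *v u) - c * (u \<bullet> u))"
      using quad[of "- a / b"] by (simp add: a_def)
    also have "\<dots> \<le> 2 * (- a / b) * a + (- a / b)\<^sup>2 * b"
      using b by (intro add_left_mono mult_left_mono) auto
    also have "\<dots> = - (a * a / b)" using b by (simp add: power2_eq_square field_simps)
    finally show False using a b mult_pos_pos[OF a a] by (simp add: field_simps)
  qed
  then have "M *v v = c *\<^sub>R v" by (simp add: u_def)
  then show ?thesis using v(1) min by (intro that[of v]) (auto simp: c_def)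
qed

text \<open>\<open>lambda_min\<close> is a \<open>Min\<close>, which is meaningful only on a finite
  set. Eigenvectors of different eigenvalues are orthogonal, hence independent, and the dimension
  bounds their number.\<close>

lemma finite_eigenvalues:
  fixes M :: "real^'n^'n"
  assumes sym: "transpose M = M"
  shows "finite (eigenvalues M)"
proof -
  obtain e where e: "\<And>c. c \<in> eigenvalues M \<Longrightarrow> e c \<noteq> 0 \<and> M *v e c = c *\<^sub>R e c"
    using choice[of "\<lambda>c v. c \<in> eigenvalues M \<longrightarrow> v \<noteq> 0 \<and> M *v v = c *\<^sub>R v"]
    by (auto simp: eigenvalues_def)
  have orth: "e c \<bullet> e c' = 0" if "c \<in> eigenvalues M" "c' \<in> eigenvalues M" "c \<noteq> c'" for c c'
  proof -
    have "c' * (e c \<bullet> e c') = c * (e c \<bullet> e c')"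
      using symmetric_matrix_dot[OF sym, of "e c" "e c'"] e that by simp
    then show ?thesis using that by simp
  qed
  have inj: "inj_on e (eigenvalues M)"
    by (rule inj_onI) (metis e inner_eq_zero_iff orth)
  have "pairwise orthogonal (e ` eigenvalues M)"
    by (auto simp: pairwise_def orthogonal_def intro!: orth)
  moreover have "0 \<notin> e ` eigenvalues M" using e by auto
  ultimately have "independent (e ` eigenvalues M)" by (rule pairwise_orthogonal_independent)
  then have "finite (e ` eigenvalues M)" using independent_bound by blast
  then show ?thesis using inj by (rule finite_imageD)
qed

lemma lambda_min_attained:
  fixes M :: "real^'n^'n"
  assumes sym: "transpose M = M"
  obtains v where "norm v = 1" "lambda_min M = v \<bullet> (M *v v)" "\<And>w. lambda_min M * (w \<bullet> w) \<le> w \<bullet> (M *v w)"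
proof -
  obtain v where v: "norm v = 1" "M *v v = (v \<bullet> (M *v v)) *\<^sub>R v"
    "\<And>w. (v \<bullet> (M *v v)) * (w \<bullet> w) \<le> w \<bullet> (M *v w)"
    by (rule rayleigh_minimum[OF sym]) blast
  have "lambda_min M = v \<bullet> (M *v v)"
    unfolding lambda_min_def
  proof (rule Min_eqI)
    show "finite (eigenvalues M)" by (rule finite_eigenvalues[OF sym])
    show "v \<bullet> (M *v v) \<in> eigenvalues M"
      unfolding eigenvalues_def mem_Collect_eq using v(1,2) by (intro exI[of _ v] conjI) auto
    fix c assume "c \<in> eigenvalues M"
    then obtain w where w: "w \<noteq> 0" "M *v w = c *\<^sub>R w" by (auto simp: eigenvalues_def)
    then show "v \<bullet> (M *v v) \<le> c" using v(3)[of w] by simp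
  qed
  then show ?thesis using v that by simp
qed

definition outer :: "real^'n \<Rightarrow> real^'n^'n" where
  "outer v = (\<chi> i j. v $ i * v $ j)"

lemma inner_outer: "M \<bullet> outer v = v \<bullet> (M *v v)"
  by (simp add: inner_vec_def outer_def matrix_vector_mult_def sum_distrib_left mult_ac)

lemma outer_mult: "outer v *v w = (v \<bullet> w) *\<^sub>R v"
  by (simp add: vec_eq_iff inner_vec_def outer_def matrix_vector_mult_def sum_distrib_left sum_distrib_right mult_ac)

definition positive_definite_field :: "('n::finite) matrix_field \<Rightarrow> bool" where
  "positive_definite_field A \<longleftrightarrow> continuous_on UNIV A \<and> (\<forall>x. transpose (A x) = A x \<and> (\<forall>v. v \<noteq> 0 \<longrightarrow> 0 < v \<bullet> (A x *v v)))"

text \<open>Rayleigh quotients turn the infimum into the existence of a point and a unit vector;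
  positivity supplies the lower bound without which a real infimum is unspecified. In this form
  openness is visible.\<close>

lemma degenerate_set_iff:
  assumes A: "positive_definite_field A"
  shows "x \<in> degenerate_set A \<kappa> \<longleftrightarrow> (\<exists>y\<in>cball x 2. \<exists>v. norm v = 1 \<and> v \<bullet> (A y *v v) < \<kappa>)"
proof -
  have sym: "transpose (A y) = A y" for y using A by (simp add: positive_definite_field_def)
  have pos: "0 \<le> lambda_min (A y)" for y
  proof (rule lambda_min_attained[OF sym, of y])
    fix v assume v: "norm v = 1" "lambda_min (A y) = v \<bullet> (A y *v v)"
    then have "v \<noteq> 0" by auto
    then show ?thesis using A v(2) by (force simp: positive_definite_field_def intro: less_imp_le)
  qed
  have "lambda_min (A y) < \<kappa> \<longleftrightarrow> (\<exists>v. norm v = 1 \<and> v \<bullet> (A y *v v) < \<kappa>)" for y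
  proof (rule lambda_min_attained[OF sym, of y])
    fix v assume v: "norm v = 1" "lambda_min (A y) = v \<bullet> (A y *v v)"
      "\<And>w. lambda_min (A y) * (w \<bullet> w) \<le> w \<bullet> (A y *v w)"
    show ?thesis
    proof safe
      assume "lambda_min (A y) < \<kappa>" then show "\<exists>v. norm v = 1 \<and> v \<bullet> (A y *v v) < \<kappa>" using v by metis
    next
      fix w assume w: "norm w = 1" "w \<bullet> (A y *v w) < \<kappa>"
      then have "w \<bullet> w = 1" by (simp add: norm_eq_1)
      then show "lambda_min (A y) < \<kappa>" using v(3)[of w] w by simp
    qed
  qed
  moreover have "bdd_below ((\<lambda>y. lambda_min (A y)) ` cball x 2)" using pos by (intro bdd_belowI2[of _ 0])
  ultimately show ?thesis by (simp add: degenerate_set_def cINF_less_iff del: mem_cball)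
qed

text \<open>A union of translates of the open set where some unit vector gives a value below
  \<open>\<kappa>\<close>. Since the complement is closed, the first time outside is a stopping time
  of the natural filtration.\<close>

lemma open_degenerate_set:
  assumes A: "positive_definite_field A"
  shows "open (degenerate_set A \<kappa>)"
proof -
  define U where "U = (\<Union>v\<in>sphere 0 1. {y. v \<bullet> (A y *v v) < \<kappa>})"
  have cA: "continuous_on UNIV A" using A by (simp add: positive_definite_field_def)
  have U: "open U"
    unfolding U_def inner_outer[symmetric] by (intro open_UN ballI open_Collect_less continuous_intros cA)
  have "degenerate_set A \<kappa> = (\<Union>e\<in>cball 0 2. (\<lambda>y. y + e) ` U)"
  proof (intro set_eqI)
    fix x
    have "x \<in> degenerate_set A \<kappa> \<longleftrightarrow> (\<exists>y\<in>cball x 2. y \<in> U)"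
      unfolding degenerate_set_iff[OF A] U_def by (intro bex_cong refl) (simp add: Bex_def)
    also have "\<dots> \<longleftrightarrow> x \<in> (\<Union>e\<in>cball 0 2. (\<lambda>y. y + e) ` U)"
    proof safe
      fix y assume "y \<in> cball x 2" "y \<in> U"
      then show "x \<in> (\<Union>e\<in>cball 0 2. (\<lambda>y. y + e) ` U)"
        by (intro UN_I[of "x - y"] image_eqI[of _ _ y]) (auto simp: dist_norm norm_minus_commute)
    next
      fix e y assume "e \<in> cball (0::real^'a) 2" "y \<in> U"
      then show "\<exists>ya\<in>cball (y + e) 2. ya \<in> U" by (intro bexI[of _ y]) (auto simp: dist_norm norm_minus_commute)
    qed
    finally show "x \<in> degenerate_set A \<kappa> \<longleftrightarrow> x \<in> (\<Union>e\<in>cball 0 2. (\<lambda>y. y + e) ` U)" .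
  qed
  moreover have "open ((\<lambda>y. y + e) ` U)" for e using open_translation[OF U, of e] by (simp add: add.commute)
  ultimately show ?thesis by auto
qed

section \<open>Quadratic forms and the trace-one normalization\<close>

lemma trace_eq_sum_axis:
  fixes M :: "real^'n^'n"
  shows "trace M = (\<Sum>i\<in>UNIV. axis i 1 \<bullet> (M *v axis i 1))"
  by (simp add: trace_def inner_axis' matrix_vector_mult_basis column_def)

lemma trace_pos:
  fixes M :: "real^'n^'n"
  assumes "\<And>v. v \<noteq> 0 \<Longrightarrow> 0 < v \<bullet> (M *v v)"
  shows "0 < trace M"
  unfolding trace_eq_sum_axis using assms by (intro sum_pos) (auto simp: axis_eq_0_iff)

lemma inner_mat_1:
  fixes M :: "real^'n^'n"
  shows "M \<bullet> mat c = c * trace M"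
  by (simp add: inner_vec_def mat_def trace_def if_distrib[of "\<lambda>z. _ * z"] sum_distrib_left mult.commute cong: if_cong)

text \<open>Nonnegativity on \<open>v_i e_i - v_j e_j\<close> bounds each off-diagonal term by
  diagonal ones. This avoids diagonalization; the dimensional factor it costs only enlarges the
  radius of the Lyapunov function.\<close>

lemma quadratic_form_le_trace:
  fixes M :: "real^'n^'n"
  assumes sym: "transpose M = M" and nn: "\<And>v. 0 \<le> v \<bullet> (M *v v)"
  shows "v \<bullet> (M *v v) \<le> real CARD('n) * trace M * (v \<bullet> v)"
proof -
  have sum: "v \<bullet> (M *v v) = (\<Sum>i\<in>UNIV. \<Sum>j\<in>UNIV. v $ i * v $ j * M $ i $ j)" for v
    by (simp add: inner_vec_def matrix_vector_mult_def sum_distrib_left mult_ac)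
  have Mij: "axis i 1 \<bullet> (M *v axis j 1) = M $ i $ j" for i j
    by (simp add: inner_axis' matrix_vector_mult_basis column_def)
  have Msym: "M $ j $ i = M $ i $ j" for i j using sym by (metis transpose_def vec_lambda_beta)
  have entry: "v $ i * v $ j * M $ i $ j \<le> ((v $ i)\<^sup>2 * M $ i $ i + (v $ j)\<^sup>2 * M $ j $ j) / 2" for i j
    using nn[of "(v $ i) *\<^sub>R axis i 1 - (v $ j) *\<^sub>R axis j 1"]
    by (simp add: matrix_vector_mult_diff_distrib matrix_vector_mult_scaleR inner_diff_left inner_diff_right
        Mij Msym[of j i] power2_eq_square algebra_simps)
  have "v \<bullet> (M *v v) \<le> (\<Sum>i\<in>UNIV. \<Sum>j\<in>UNIV. ((v $ i)\<^sup>2 * M $ i $ i + (v $ j)\<^sup>2 * M $ j $ j) / 2)"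
    unfolding sum by (intro sum_mono entry)
  also have "\<dots> = real CARD('n) * (\<Sum>i\<in>UNIV. (v $ i)\<^sup>2 * M $ i $ i)"
    by (simp add: add_divide_distrib sum.distrib sum_divide_distrib[symmetric] sum_distrib_left[symmetric])
  also have "(\<Sum>i\<in>UNIV. (v $ i)\<^sup>2 * M $ i $ i) \<le> (\<Sum>i\<in>UNIV. (v $ i)\<^sup>2 * trace M)"
  proof (intro sum_mono mult_left_mono)
    fix i
    show "M $ i $ i \<le> trace M" unfolding trace_def
      by (rule member_le_sum) (use nn[of "axis _ 1"] in \<open>auto simp: Mij\<close>)
  qed auto
  also have "\<dots> = trace M * (v \<bullet> v)"
    by (simp add: inner_vec_def power2_eq_square sum_distrib_left mult.commute)
  finally show ?thesis by (simp add: mult.assoc)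
qed

lemma normalized_field_properties:
  fixes A :: "('n::finite) matrix_field"
  assumes A: "positive_definite_field A"
  shows "trace (normalized_field A x) = 1" "0 \<le> v \<bullet> (normalized_field A x *v v)"
    "v \<bullet> (normalized_field A x *v v) \<le> real CARD('n) * (v \<bullet> v)" "continuous_on UNIV (normalized_field A)"
proof -
  have pos: "0 < v \<bullet> (A x *v v)" if "v \<noteq> 0" for v x using A that by (simp add: positive_definite_field_def)
  have tr: "0 < trace (A x)" for x by (rule trace_pos) (rule pos)
  have sc: "normalized_field A x *v v = (1 / trace (A x)) *\<^sub>R (A x *v v)" for x v
    by (simp add: normalized_field_def scaleR_matrix_vector_assoc)
  show tr1: "trace (normalized_field A x) = 1" for x
    using tr[of x] by (simp add: trace_eq_sum_axis sc sum_divide_distrib[symmetric])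
  have nn: "0 \<le> v \<bullet> (normalized_field A x *v v)" for v x
    using pos[of v x] tr[of x] by (cases "v = 0") (auto simp: sc intro: less_imp_le)
  show "0 \<le> v \<bullet> (normalized_field A x *v v)" by (rule nn)
  have "transpose (normalized_field A x) = normalized_field A x" for x
    using A by (simp add: positive_definite_field_def normalized_field_def transpose_scalar)
  from quadratic_form_le_trace[OF this nn, of v x]
  show "v \<bullet> (normalized_field A x *v v) \<le> real CARD('n) * (v \<bullet> v)" by (simp add: tr1)
  have cA: "continuous_on UNIV A" using A by (simp add: positive_definite_field_def)
  show "continuous_on UNIV (normalized_field A)"
    unfolding normalized_field_def trace_def using tr
    by (intro continuous_intros cA ballI) (auto simp: trace_def less_le)
qed

section \<open>Path space and optional stopping\<close>

type_synonym 'n path = "real \<Rightarrow> real^'n"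

lemma space_path_space: "space (path_space :: 'n::finite path measure) = {w \<in> extensional {0..}. continuous_on {0..} w}"
  by (auto simp: path_space_def space_restrict_space space_PiM PiE_def)

lemma path_continuous: "w \<in> space path_space \<Longrightarrow> continuous_on {0..} w"
  by (simp add: space_path_space)

lemma path_continuous_on: "w \<in> space path_space \<Longrightarrow> 0 \<le> a \<Longrightarrow> continuous_on {a..b} w"
  by (rule continuous_on_subset[OF path_continuous]) auto

lemma measurable_eval:
  "0 \<le> t \<Longrightarrow> (\<lambda>w. w t) \<in> measurable (path_space :: 'n::finite path measure) borel"
  unfolding path_space_def by (intro measurable_restrict_space1 measurable_component_singleton) simp

lemma measurable_path_spaceI:
  assumes "\<And>t. 0 \<le> t \<Longrightarrow> (\<lambda>x. f x t) \<in> measurable N borel" "\<And>x. x \<in> space N \<Longrightarrow> f x \<in> space path_space"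
  shows "f \<in> measurable N (path_space :: 'n::finite path measure)"
proof -
  have "(\<lambda>x t. f x t) \<in> measurable N (Pi\<^sub>M {0..} (\<lambda>_. borel))"
    using assms by (intro measurable_PiM_single') (auto simp: space_path_space PiE_def extensional_def)
  then show ?thesis
    unfolding path_space_def using assms(2)
    by (intro measurable_restrict_space2) (auto simp: space_path_space)
qed

text \<open>The time is rounded up to a multiple of \<open>1 / (k + 1)\<close>, so that only
  countably many evaluations occur; continuity of the path gives convergence.\<close>

lemma measurable_eval_random:
  fixes g :: "'a \<Rightarrow> 'n::finite path"
  assumes T [measurable]: "T \<in> borel_measurable N" and nonneg: "\<And>x. x \<in> space N \<Longrightarrow> 0 \<le> T x"
    and g [measurable]: "g \<in> measurable N path_space"
  shows "(\<lambda>x. g x (T x)) \<in> borel_measurable N"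
proof (rule borel_measurable_LIMSEQ_metric[where f="\<lambda>k x. g x (real (nat \<lceil>T x * real (Suc k)\<rceil>) / real (Suc k))"])
  define r where "r k x = real (nat \<lceil>T x * real (Suc k)\<rceil>) / real (Suc k)" for k x
  show "(\<lambda>x. g x (real (nat \<lceil>T x * real (Suc k)\<rceil>) / real (Suc k))) \<in> borel_measurable N" for k
  proof -
    have "(\<lambda>x. (\<lambda>m x. g x (real m / real (Suc k))) (nat \<lceil>T x * real (Suc k)\<rceil>) x) \<in> borel_measurable N"
    proof (rule measurable_compose_countable[where f="\<lambda>m x. g x (real m / real (Suc k))" and g="\<lambda>x. nat \<lceil>T x * real (Suc k)\<rceil>"])
      show "(\<lambda>x. g x (real m / real (Suc k))) \<in> borel_measurable N" for m
        using measurable_compose[OF g measurable_eval[of "real m / real (Suc k)"]] by simp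
    qed measurable
    then show ?thesis by simp
  qed
  fix x assume x: "x \<in> space N"
  have lower: "T x \<le> r k x" for k
  proof -
    have "T x * real (Suc k) \<le> real (nat \<lceil>T x * real (Suc k)\<rceil>)" by linarith
    then show ?thesis by (simp add: r_def field_simps del: of_nat_Suc)
  qed
  have upper: "r k x \<le> T x + 1 / real (Suc k)" for k
  proof -
    have "real (nat \<lceil>T x * real (Suc k)\<rceil>) \<le> T x * real (Suc k) + 1"
      using nonneg[OF x] by (simp add: of_nat_nat)
    then show ?thesis by (simp add: r_def field_simps del: of_nat_Suc)
  qed
  have lim: "(\<lambda>k. 1 / real (Suc k)) \<longlonglongrightarrow> 0"
    by (rule LIMSEQ_Suc[OF lim_1_over_n[where 'a=real]])
  have "(\<lambda>k. T x + 1 / real (Suc k)) \<longlonglongrightarrow> T x"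
    using tendsto_add[OF tendsto_const[of "T x"] lim] by (simp only: add_0_right)
  then have "(\<lambda>k. r k x) \<longlonglongrightarrow> T x"
    by (rule tendsto_sandwich[OF always_eventually always_eventually tendsto_const, rotated 2])
       (use lower upper in auto)
  moreover have "continuous_on {0..} (g x)" using measurable_space[OF g x] by (rule path_continuous)
  ultimately show "(\<lambda>k. g x (real (nat \<lceil>T x * real (Suc k)\<rceil>) / real (Suc k))) \<longlonglongrightarrow> g x (T x)"
    unfolding r_def[symmetric] using order_trans[OF nonneg[OF x] lower]
    by (intro continuous_on_tendsto_compose[where s="{0..}" and f="g x"]) (auto simp: nonneg[OF x])
qed

lemma shift_path_in_space:
  assumes "w \<in> space path_space" "0 \<le> s"
  shows "shift_path s w \<in> space (path_space :: 'n::finite path measure)"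
proof -
  have "continuous_on {0..} (\<lambda>t. w (s + t))"
    using assms by (intro continuous_on_compose2[OF path_continuous[OF assms(1)]] continuous_intros) auto
  then have "continuous_on {0..} (shift_path s w)"
    unfolding shift_path_def by (rule continuous_on_eq) simp
  then show ?thesis by (simp add: space_path_space shift_path_def)
qed

lemma shift_path_apply [simp]: "0 \<le> t \<Longrightarrow> shift_path s w t = w (s + t)"
  by (simp add: shift_path_def)

lemma shift_path_add: "0 \<le> a \<Longrightarrow> 0 \<le> b \<Longrightarrow> shift_path (a + b) w = shift_path b (shift_path a w)"
  by (auto simp: shift_path_def fun_eq_iff restrict_def add.assoc)

lemma measurable_shift_path:
  fixes g :: "'a \<Rightarrow> 'n::finite path"
  assumes T [measurable]: "T \<in> borel_measurable N" and nonneg: "\<And>x. x \<in> space N \<Longrightarrow> 0 \<le> T x"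
    and g [measurable]: "g \<in> measurable N path_space"
  shows "(\<lambda>x. shift_path (T x) (g x)) \<in> measurable N path_space"
proof (rule measurable_path_spaceI)
  fix t :: real assume "0 \<le> t"
  then show "(\<lambda>x. shift_path (T x) (g x) t) \<in> borel_measurable N"
    using nonneg by (simp add: measurable_eval_random[OF _ _ g])
qed (use nonneg measurable_space[OF g] in \<open>auto intro: shift_path_in_space\<close>)

section \<open>Stopped paths, Galmarino's test and hitting times\<close>

definition stop_path :: "real \<Rightarrow> 'n path \<Rightarrow> 'n path" where
  "stop_path t w = restrict (\<lambda>s. w (min s t)) {0..}"

lemma stop_path_apply [simp]: "0 \<le> s \<Longrightarrow> s \<le> t \<Longrightarrow> stop_path t w s = w s"
  by (simp add: stop_path_def)

lemma stop_path_in_space: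
  assumes "w \<in> space path_space" "0 \<le> t"
  shows "stop_path t w \<in> space (path_space :: 'n::finite path measure)"
proof -
  have "continuous_on {0..} (\<lambda>s. w (min s t))"
    using assms by (intro continuous_on_compose2[OF path_continuous[OF assms(1)]] continuous_intros) auto
  then have "continuous_on {0..} (stop_path t w)"
    unfolding stop_path_def by (rule continuous_on_eq) simp
  then show ?thesis by (simp add: space_path_space stop_path_def)
qed

lemma space_natural_filtration [simp]: "space (natural_filtration t) = space path_space"
  unfolding natural_filtration_def by (intro space_measure_of) auto

lemma measurable_eval_natural_filtration:
  assumes "0 \<le> s" "ennreal s \<le> t"
  shows "(\<lambda>w. w s) \<in> measurable (natural_filtration t) (borel :: (real^'n::finite) measure)"
proof (rule measurableI)
  fix E :: "(real^'n) set" assume E: "E \<in> sets borel"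
  have "(\<lambda>w. w s) -` E \<inter> space path_space \<in> {(\<lambda>w. w s) -` E \<inter> space (path_space :: 'n path measure) | s E. 0 \<le> s \<and> ennreal s \<le> t \<and> E \<in> sets borel}"
    using assms E by blast
  then show "(\<lambda>w. w s) -` E \<inter> space (natural_filtration t) \<in> sets (natural_filtration t :: 'n path measure)"
    unfolding space_natural_filtration unfolding natural_filtration_def
    by (subst sets_measure_of) (auto intro: sigma_sets.Basic)
qed simp

lemma sets_natural_filtration_subset:
  "sets (natural_filtration t :: 'n::finite path measure) \<subseteq> sets path_space"
  unfolding natural_filtration_def
proof (subst sets_measure_of)
  show "sigma_sets (space path_space) {(\<lambda>w. w s) -` E \<inter> space (path_space :: 'n path measure) | s E. 0 \<le> s \<and> ennreal s \<le> t \<and> E \<in> sets borel} \<subseteq> sets path_space"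
    by (intro sets.sigma_sets_subset) (auto intro: measurable_sets[OF measurable_eval])
qed auto

lemma measurable_stop_path:
  assumes t: "0 \<le> t"
  shows "stop_path t \<in> measurable (natural_filtration (ennreal t)) (path_space :: 'n::finite path measure)"
proof (rule measurable_path_spaceI)
  fix s :: real assume s: "0 \<le> s"
  have eq: "stop_path t w s = w (min s t)" for w :: "'n path"
    using s by (simp add: stop_path_def)
  have "(\<lambda>w :: 'n path. w (min s t)) \<in> borel_measurable (natural_filtration (ennreal t))"
  proof (rule measurable_eval_natural_filtration)
    show "0 \<le> min s t" using s t by (simp add: min_def)
    show "ennreal (min s t) \<le> ennreal t" by (rule ennreal_leI) (simp add: min_def)
  qed
  then show "(\<lambda>w. stop_path t w s) \<in> borel_measurable (natural_filtration (ennreal t) :: 'n path measure)"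
    unfolding eq .
qed (simp add: stop_path_in_space t)

lemma galmarino_stopping_time:
  fixes T :: "'n::finite path \<Rightarrow> ennreal"
  assumes T [measurable]: "T \<in> borel_measurable path_space"
    and test: "\<And>w w' t. w \<in> space path_space \<Longrightarrow> w' \<in> space path_space \<Longrightarrow> 0 \<le> t \<Longrightarrow>
      (\<And>s. 0 \<le> s \<Longrightarrow> s \<le> t \<Longrightarrow> w s = w' s) \<Longrightarrow> T w \<le> ennreal t \<Longrightarrow> T w' \<le> ennreal t"
  shows "stopping_time natural_filtration T"
proof
  fix t :: ennreal
  show "Measurable.pred (natural_filtration t) (\<lambda>w. T w \<le> t)"
  proof (cases t)
    case (real r)
    have stop: "stop_path r \<in> measurable (natural_filtration t) path_space"
      using measurable_stop_path[of r] real by simp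
    have "Measurable.pred (natural_filtration t) (\<lambda>w. T (stop_path r w) \<le> ennreal r)"
      by (rule pred_le_const[OF measurable_compose[OF stop T]]) simp
    also have "?this \<longleftrightarrow> Measurable.pred (natural_filtration t) (\<lambda>w. T w \<le> ennreal r)"
    proof (rule measurable_cong)
      fix w :: "'n path" assume "w \<in> space (natural_filtration t)"
      then have w: "w \<in> space path_space" "stop_path r w \<in> space path_space"
        using real by (auto intro: stop_path_in_space)
      show "(T (stop_path r w) \<le> ennreal r) = (T w \<le> ennreal r)"
        using test[OF w, of r] test[OF w(2,1), of r] real by auto
    qed
    finally show ?thesis using real by simp
  qed simp
qed

text \<open>On a compact time interval a continuous nonnegative function vanishes somewhere iff it
  takes arbitrarily small values on a countable dense set, so the uncountable union over times
  becomes a countable one.\<close>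

lemma measurable_hits_zero:
  fixes \<xi> :: "real \<Rightarrow> 'a \<Rightarrow> real"
  assumes t: "0 \<le> t" and meas [measurable]: "\<And>u. 0 \<le> u \<Longrightarrow> \<xi> u \<in> borel_measurable M"
    and cont: "\<And>w. w \<in> space M \<Longrightarrow> continuous_on {0..t} (\<lambda>u. \<xi> u w)" and nonneg: "\<And>u w. 0 \<le> \<xi> u w"
  shows "{w \<in> space M. \<exists>u\<in>{0..t}. \<xi> u w = 0} \<in> sets M"
proof -
  let ?D = "{0..1} \<inter> \<rat> :: real set"
  have eq: "(\<exists>u\<in>{0..t}. \<xi> u w = 0) \<longleftrightarrow> (\<forall>n. \<exists>r\<in>?D. \<xi> (t * r) w < 1 / real (Suc n))" if w: "w \<in> space M" for w
  proof safe
    fix u n assume u: "u \<in> {0..t}" "\<xi> u w = 0"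
    define v where "v = (if t = 0 then 0 else u / t)"
    have v: "v \<in> {0..1}" "t * v = u" using u t by (auto simp: v_def field_simps)
    have "continuous_on {0..1} (\<lambda>r. \<xi> (t * r) w)"
      using t by (intro continuous_on_compose2[OF cont[OF w]] continuous_intros) (auto intro: mult_left_le)
    from this[unfolded continuous_on_iff, rule_format, OF v(1), of "1 / real (Suc n)"]
    obtain d where d: "d > 0" "\<And>r. r \<in> {0..1} \<Longrightarrow> dist r v < d \<Longrightarrow> dist (\<xi> (t * r) w) (\<xi> (t * v) w) < 1 / real (Suc n)"
      by auto
    have "\<exists>r\<in>?D. dist r v < d"
    proof (cases "v = 1")
      case True
      then show ?thesis using d(1) by (intro bexI[of _ 1]) auto
    next
      case False
      then obtain r where "r \<in> \<rat>" "v < r" "r < min 1 (v + d)"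
        using Rats_dense_in_real[of v "min 1 (v + d)"] v(1) d(1) by auto
      then show ?thesis using v(1) by (intro bexI[of _ r]) (auto simp: dist_real_def)
    qed
    then obtain r where r: "r \<in> ?D" "dist r v < d" by blast
    have "dist (\<xi> (t * r) w) 0 < 1 / real (Suc n)" using d(2)[OF _ r(2)] r(1) v(2) u(2) by simp
    then show "\<exists>r\<in>?D. \<xi> (t * r) w < 1 / real (Suc n)" using r(1) by (intro bexI[of _ r]) (auto simp: dist_real_def)
  next
    assume small: "\<forall>n. \<exists>r\<in>?D. \<xi> (t * r) w < 1 / real (Suc n)"
    obtain u where u: "u \<in> {0..t}" "\<And>s. s \<in> {0..t} \<Longrightarrow> \<xi> u w \<le> \<xi> s w"
      using continuous_attains_inf[OF compact_Icc _ cont[OF w]] t by fastforce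
    have "\<xi> u w < 1 / real (Suc n)" for n
    proof -
      obtain r where r: "r \<in> ?D" "\<xi> (t * r) w < 1 / real (Suc n)" using small by blast
      then have "t * r \<in> {0..t}" using t by (auto intro: mult_left_le)
      then show ?thesis using u(2) r(2) by fastforce
    qed
    then have "\<xi> u w \<le> 0"
      by (metis le_cases not_le reals_Archimedean inverse_eq_divide order.strict_trans order_less_imp_not_less)
    then show "\<exists>u\<in>{0..t}. \<xi> u w = 0" using u nonneg[of u w] by (intro bexI[of _ u]) auto
  qed
  have "countable ?D" by (intro countable_Int2 countable_rat)
  moreover have "{w \<in> space M. \<xi> (t * r) w < 1 / real (Suc n)} \<in> sets M" if "r \<in> ?D" for r n
  proof -
    have "\<xi> (t * r) \<in> borel_measurable M" using that t by (intro meas) auto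
    then show ?thesis by measurable
  qed
  ultimately have "(\<Inter>n. \<Union>r\<in>?D. {w \<in> space M. \<xi> (t * r) w < 1 / real (Suc n)}) \<in> sets M"
    by (intro sets.countable_INT' image_subsetI sets.countable_UN') auto
  also have "(\<Inter>n. \<Union>r\<in>?D. {w \<in> space M. \<xi> (t * r) w < 1 / real (Suc n)}) =
      {w \<in> space M. \<forall>n. \<exists>r\<in>?D. \<xi> (t * r) w < 1 / real (Suc n)}"
    by blast
  also have "{w \<in> space M. \<forall>n. \<exists>r\<in>?D. \<xi> (t * r) w < 1 / real (Suc n)} = {w \<in> space M. \<exists>u\<in>{0..t}. \<xi> u w = 0}"
    using eq by blast
  finally show ?thesis .
qed

text \<open>A continuous path attains its hitting time of a closed set, so the event depends on the
  path up to \<open>t\<close> and not on its immediate future. The unaugmented natural filtration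
  therefore suffices.\<close>

lemma first_time_le_iff:
  fixes w :: "'n::finite path"
  assumes w: "w \<in> space path_space" and s: "0 \<le> s" and E: "closed E" and t: "0 \<le> t"
  shows "first_time s w E \<le> ennreal t \<longleftrightarrow> (\<exists>u\<in>{s..t}. w u \<in> E)"
proof
  assume "\<exists>u\<in>{s..t}. w u \<in> E"
  then obtain u where u: "s \<le> u" "u \<le> t" "w u \<in> E" by auto
  then have "first_time s w E \<le> ennreal u" unfolding first_time_def by (intro INF_lower) auto
  also have "\<dots> \<le> ennreal t" using u by (simp add: ennreal_leI)
  finally show "first_time s w E \<le> ennreal t" .
next
  assume le: "first_time s w E \<le> ennreal t"
  define Z where "Z = {u. s \<le> u \<and> w u \<in> E}"
  have "Z \<noteq> {}" using le unfolding first_time_def Z_def[symmetric] by (auto simp: top_unique)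
  moreover have "bdd_below Z" by (rule bdd_belowI[of _ s]) (auto simp: Z_def)
  moreover have "closed Z"
  proof -
    have "continuous_on {s..} w" by (rule continuous_on_subset[OF path_continuous[OF w]]) (use s in auto)
    then have "closed ({s..} \<inter> w -` E)" by (intro continuous_closed_preimage E) auto
    then show ?thesis by (simp add: Z_def vimage_def Int_def)
  qed
  ultimately have Z: "Inf Z \<in> Z" and low: "\<And>u. u \<in> Z \<Longrightarrow> Inf Z \<le> u"
    by (auto intro: closed_contains_Inf cInf_lower)
  have "ennreal (Inf Z) \<le> first_time s w E"
    unfolding first_time_def Z_def[symmetric] by (intro INF_greatest) (auto intro: ennreal_leI low)
  then have "ennreal (Inf Z) \<le> ennreal t" using le by (rule order_trans)
  then have "Inf Z \<le> t" using t by simp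
  then show "\<exists>u\<in>{s..t}. w u \<in> E" using Z by (auto simp: Z_def)
qed

lemma ennreal_eqI_le:
  fixes x y :: ennreal
  assumes "\<And>t. 0 \<le> t \<Longrightarrow> x \<le> ennreal t \<longleftrightarrow> y \<le> ennreal t"
  shows "x = y"
proof (rule antisym)
  show "x \<le> y" using assms[of "enn2real y"] by (cases y) auto
  show "y \<le> x" using assms[of "enn2real x"] by (cases x) auto
qed

lemma borel_measurable_ennrealI_le:
  assumes "\<And>t. 0 \<le> t \<Longrightarrow> {x \<in> space M. f x \<le> ennreal t} \<in> sets M"
  shows "f \<in> borel_measurable M"
proof (rule borel_measurableI_le)
  fix y :: ennreal show "{x \<in> space M. f x \<le> y} \<in> sets M"
    using assms by (cases y) auto
qed

lemma measurable_first_time: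
  fixes E :: "(real^'n::finite) set"
  assumes E: "closed E"
  shows "(\<lambda>w. first_time 0 w E) \<in> borel_measurable path_space"
proof (cases "E = {}")
  case True
  then show ?thesis by (simp add: first_time_def)
next
  case False
  \<comment> \<open>\<open>infdist\<close> to the empty set is 0, so this description of
    \<open>E\<close> as a zero set is reserved for nonempty \<open>E\<close>.\<close>
  have zero_iff: "infdist x E = 0 \<longleftrightarrow> x \<in> E" for x
    using in_closed_iff_infdist_zero[OF E False, of x] by simp
  show ?thesis
  proof (rule borel_measurable_ennrealI_le)
    fix t :: real assume t: "0 \<le> t"
    have "{w \<in> space path_space. \<exists>u\<in>{0..t}. infdist (w u) E = 0} \<in> sets path_space"
    proof (rule measurable_hits_zero[OF t])
      show "(\<lambda>w. infdist (w u) E) \<in> borel_measurable path_space" if "0 \<le> u" for u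
        using that by (intro measurable_compose[OF measurable_eval] borel_measurable_continuous_onI continuous_intros)
      show "continuous_on {0..t} (\<lambda>u. infdist (w u) E)" if "w \<in> space path_space" for w
        using path_continuous_on[OF that] by (intro continuous_intros) auto
    qed (simp add: infdist_nonneg)
    also have "{w \<in> space path_space. \<exists>u\<in>{0..t}. infdist (w u) E = 0} = {w \<in> space path_space. first_time 0 w E \<le> ennreal t}"
      using t by (intro Collect_cong conj_cong refl) (simp add: first_time_le_iff[OF _ _ E] zero_iff)
    finally show "{w \<in> space path_space. first_time 0 w E \<le> ennreal t} \<in> sets path_space" .
  qed
qed

lemma stopping_time_first_time:
  fixes E :: "(real^'n::finite) set"
  assumes E: "closed E"
  shows "stopping_time natural_filtration (\<lambda>w. first_time 0 w E)"
  by (rule galmarino_stopping_time[OF measurable_first_time[OF E]])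
     (auto simp: first_time_le_iff[OF _ _ E])

section \<open>Optional stopping for bounded continuous martingales\<close>

lemma subalgebra_natural_filtration:
  "sets Q = sets (path_space :: 'n::finite path measure) \<Longrightarrow> subalgebra Q (natural_filtration t)"
  using sets_natural_filtration_subset[of t] sets_eq_imp_space_eq[of Q path_space]
  by (auto simp: subalgebra_def)

lemma path_martingale_set_integral:
  fixes Q :: "'n::finite path measure"
  assumes Q: "prob_space Q" "sets Q = sets path_space" and mart: "path_martingale Q M"
    and st: "0 \<le> s" "s \<le> t" and E: "E \<in> sets (natural_filtration (ennreal s))"
  shows "(LINT w:E|Q. M t w) = (LINT w:E|Q. M s w)"
proof -
  interpret prob_space Q by fact
  interpret finite_measure_subalgebra Q "natural_filtration (ennreal s)"
    by unfold_locales (rule subalgebra_natural_filtration[OF Q(2)])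
  have int: "integrable Q (M t)" "integrable Q (M s)" and ae: "AE w in Q. real_cond_exp Q (natural_filtration (ennreal s)) (M t) w = M s w"
    using mart st unfolding path_martingale_def by auto
  have EQ: "E \<in> sets Q" using E sets_natural_filtration_subset[of "ennreal s"] Q(2) by auto
  have "(LINT w:E|Q. M t w) = (LINT w:E|Q. real_cond_exp Q (natural_filtration (ennreal s)) (M t) w)"
    by (rule real_cond_exp_intA[OF int(1) E])
  also have "\<dots> = (LINT w:E|Q. M s w)"
    unfolding set_lebesgue_integral_def
  proof (rule integral_cong_AE)
    show "(\<lambda>w. indicator E w *\<^sub>R M s w) \<in> borel_measurable Q"
      using borel_measurable_integrable[OF int(2)] EQ by simp
    show "AE w in Q. indicator E w *\<^sub>R real_cond_exp Q (natural_filtration (ennreal s)) (M t) w = indicator E w *\<^sub>R M s w"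
      using ae by eventually_elim simp
    have "(\<lambda>w. real_cond_exp Q (natural_filtration (ennreal s)) (M t) w) \<in> borel_measurable Q"
      by simp
    then show "(\<lambda>w. indicator E w *\<^sub>R real_cond_exp Q (natural_filtration (ennreal s)) (M t) w) \<in> borel_measurable Q"
      using EQ by simp
  qed
  finally show ?thesis .
qed

text \<open>\<open>Y n\<close> is the martingale sampled at the first grid point not before the
  stopped time, the mesh being \<open>t / (n + 1)\<close>: from \<open>M t\<close> the increments
  after that point are removed. Each removed increment is restricted to an event known at its left
  end and has mean zero; path continuity and the bound \<open>C\<close> give the limit.\<close>

lemma optional_stopping:
  fixes Q :: "'n::finite path measure"
  assumes Q: "prob_space Q" "sets Q = sets path_space" and mart: "path_martingale Q M"
    and T: "stopping_time natural_filtration T" and t: "0 < t"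
    and bound: "\<And>w s. w \<in> space path_space \<Longrightarrow> 0 \<le> s \<Longrightarrow> s \<le> t \<Longrightarrow> \<bar>M s w\<bar> \<le> C"
    and cont: "\<And>w. w \<in> space path_space \<Longrightarrow> continuous_on {0..t} (\<lambda>s. M s w)"
  shows "integrable Q (\<lambda>w. M (enn2real (min (T w) (ennreal t))) w)"
    and "(LINT w|Q. M (enn2real (min (T w) (ennreal t))) w) = (LINT w|Q. M 0 w)"
proof -
  interpret prob_space Q by fact
  have space: "space Q = space path_space" by (rule sets_eq_imp_space_eq[OF Q(2)])
  define s where "s n i = t * real i / real (Suc n)" for n i
  define E where "E n i = {w \<in> space path_space. T w \<le> ennreal (s n i)}" for n i
  define Y where "Y n w = M t w - (\<Sum>i<Suc n. indicator (E n i) w *\<^sub>R (M (s n (Suc i)) w - M (s n i) w))" for n w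
  define \<tau> where "\<tau> w = enn2real (min (T w) (ennreal t))" for w
  have s: "0 \<le> s n i" "s n i \<le> s n (Suc i)" for n i using t by (auto simp: s_def field_simps)
  have sN: "s n (Suc n) = t" for n using t by (simp add: s_def)
  have st: "s n i \<le> t" if "i \<le> Suc n" for n i
  proof -
    have "t * real i \<le> t * real (Suc n)" using that t by (intro mult_left_mono) auto
    then show ?thesis by (simp add: s_def divide_le_eq)
  qed
  have EF: "E n i \<in> sets (natural_filtration (ennreal (s n i)))" for n i
    using stopping_timeD[OF T, of "ennreal (s n i)"] by (simp add: E_def pred_def)
  have EQ: "E n i \<in> sets Q" for n i
    using EF[of n i] sets_natural_filtration_subset[of "ennreal (s n i)"] Q(2) by auto
  have int: "integrable Q (M u)" if "0 \<le> u" for u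
    using mart that unfolding path_martingale_def by auto
  have iterm: "integrable Q (\<lambda>w. indicator (E n i) w *\<^sub>R (M (s n (Suc i)) w - M (s n i) w))" for n i
    using s[of n i] by (intro integrable_mult_indicator EQ Bochner_Integration.integrable_diff int) auto
  have intY: "integrable Q (Y n)" for n
    unfolding Y_def using t by (intro Bochner_Integration.integrable_diff Bochner_Integration.integrable_sum iterm int) auto
  have EY: "(LINT w|Q. Y n w) = (LINT w|Q. M 0 w)" for n
  proof -
    have zero: "(LINT w|Q. indicator (E n i) w *\<^sub>R (M (s n (Suc i)) w - M (s n i) w)) = 0" for i
    proof -
      have "(LINT w|Q. indicator (E n i) w *\<^sub>R (M (s n (Suc i)) w - M (s n i) w)) =
          (LINT w:E n i|Q. M (s n (Suc i)) w) - (LINT w:E n i|Q. M (s n i) w)"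
        unfolding set_lebesgue_integral_def scaleR_diff_right using s[of n i] order_trans[OF s(1) s(2), of n i]
        by (intro Bochner_Integration.integral_diff integrable_mult_indicator EQ int) auto
      then show ?thesis
        using path_martingale_set_integral[OF Q mart s EF, of n i] by simp
    qed
    have "(LINT w|Q. (\<Sum>i<Suc n. indicator (E n i) w *\<^sub>R (M (s n (Suc i)) w - M (s n i) w))) = 0"
      by (subst Bochner_Integration.integral_sum[OF iterm]) (simp only: zero sum.neutral_const)
    then have "(LINT w|Q. Y n w) = (LINT w|Q. M t w)"
      unfolding Y_def using t
      by (subst Bochner_Integration.integral_diff[OF int Bochner_Integration.integrable_sum[OF iterm]]) auto
    moreover have "(LINT w:space Q|Q. M t w) = (LINT w:space Q|Q. M 0 w)"
      using t by (intro path_martingale_set_integral[OF Q mart]) (auto simp: space sets.top[of "natural_filtration _", simplified])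
    ultimately show ?thesis using set_integral_space[OF int] t by simp
  qed
  have path: "\<exists>u. Y n w = M u w \<and> \<tau> w \<le> u \<and> u \<le> \<tau> w + t / real (Suc n) \<and> u \<le> t" if w: "w \<in> space path_space" for n w
  proof -
    have \<tau>: "0 \<le> \<tau> w" "\<tau> w \<le> t"
      unfolding \<tau>_def using t by (auto intro!: enn2real_leI)
    have \<tau>_eq: "ennreal (\<tau> w) = min (T w) (ennreal t)"
      unfolding \<tau>_def by (rule ennreal_enn2real) (auto simp: min_less_iff_disj)
    define m where "m = nat \<lceil>\<tau> w * real (Suc n) / t\<rceil>"
    have m_iff: "m \<le> i \<longleftrightarrow> \<tau> w \<le> s n i" for i
    proof -
      have "m \<le> i \<longleftrightarrow> \<tau> w * real (Suc n) / t \<le> real i" unfolding m_def by linarith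
      also have "\<dots> \<longleftrightarrow> \<tau> w \<le> s n i" using t by (simp add: s_def field_simps)
      finally show ?thesis .
    qed
    have mN: "m \<le> Suc n" using \<tau> by (simp add: m_iff sN)
    \<comment> \<open>Truncation at \<open>t\<close> cannot be seen at grid points strictly below
      \<open>t\<close>; the events in \<open>Y\<close> use only those, since the sum ends at index
      \<open>n\<close>.\<close>
    have E_iff: "w \<in> E n i \<longleftrightarrow> m \<le> i" if "i < Suc n" for i
    proof -
      have "s n i < t"
      proof -
        have "t * real i < t * real (Suc n)" using that t by (intro mult_strict_left_mono) auto
        then show ?thesis by (simp add: s_def divide_less_eq)
      qed
      then have "ennreal (s n i) < ennreal t" using s[of n i] by (simp add: ennreal_less_iff)
      then have "T w \<le> ennreal (s n i) \<longleftrightarrow> min (T w) (ennreal t) \<le> ennreal (s n i)"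
        by (auto simp: min_le_iff_disj)
      also have "\<dots> \<longleftrightarrow> \<tau> w \<le> s n i" unfolding \<tau>_eq[symmetric] using s[of n i] by simp
      finally show ?thesis using w by (simp add: E_def m_iff)
    qed
    have "(\<Sum>i<Suc n. indicator (E n i) w *\<^sub>R (M (s n (Suc i)) w - M (s n i) w)) =
        (\<Sum>i\<in>{m..<Suc n}. M (s n (Suc i)) w - M (s n i) w)"
      using E_iff by (intro sum.mono_neutral_cong_right) (auto simp: indicator_def)
    also have "\<dots> = M t w - M (s n m) w" using sum_Suc_diff'[OF mN, of "\<lambda>i. M (s n i) w"] sN by simp
    finally have "Y n w = M (s n m) w" by (simp add: Y_def)
    moreover have "\<tau> w \<le> s n m" using m_iff[of m] by simp
    moreover have "s n m \<le> \<tau> w + t / real (Suc n)"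
    proof -
      have "real m \<le> \<tau> w * real (Suc n) / t + 1"
      proof -
        have "0 \<le> \<tau> w * real (Suc n) / t" using \<tau> t by simp
        then show ?thesis unfolding m_def by linarith
      qed
      then have "t * real m / real (Suc n) \<le> t * (\<tau> w * real (Suc n) / t + 1) / real (Suc n)"
        using t by (intro divide_right_mono mult_left_mono) auto
      also have "\<dots> = \<tau> w + t / real (Suc n)"
        using t by (simp add: distrib_left add_divide_distrib del: of_nat_Suc)
      finally show ?thesis by (simp add: s_def)
    qed
    ultimately show ?thesis using st[OF mN] by (intro exI[of _ "s n m"]) auto
  qed
  have \<tau>0: "0 \<le> \<tau> w" "\<tau> w \<le> t" for w
    unfolding \<tau>_def using t by (auto intro!: enn2real_leI)
  have lim: "(\<lambda>n. Y n w) \<longlonglongrightarrow> M (\<tau> w) w" if w: "w \<in> space path_space" for w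
  proof -
    obtain u where u: "\<And>n. Y n w = M (u n) w" "\<And>n. \<tau> w \<le> u n" "\<And>n. u n \<le> \<tau> w + t / real (Suc n)" "\<And>n. u n \<le> t"
      using path[OF w] by metis
    have "(\<lambda>n. \<tau> w + t * (1 / real (Suc n))) \<longlonglongrightarrow> \<tau> w + t * 0"
      by (rule tendsto_add[OF tendsto_const tendsto_mult[OF tendsto_const LIMSEQ_Suc[OF lim_1_over_n[where 'a=real]]]])
    then have "(\<lambda>n. \<tau> w + t / real (Suc n)) \<longlonglongrightarrow> \<tau> w" by simp
    then have "u \<longlonglongrightarrow> \<tau> w"
      by (rule tendsto_sandwich[OF always_eventually always_eventually tendsto_const, rotated 2]) (use u in auto)
    then have "(\<lambda>n. M (u n) w) \<longlonglongrightarrow> M (\<tau> w) w"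
      using \<tau>0[of w] u order_trans[OF \<tau>0(1) u(2)]
      by (intro continuous_on_tendsto_compose[OF cont[OF w], of u]) auto
    then show ?thesis by (simp add: u)
  qed
  have bnd: "\<bar>Y n w\<bar> \<le> C" if "w \<in> space path_space" for n w
    using path[OF that, of n] \<tau>0[of w] bound[OF that] by (metis order_trans)
  have YM: "Y n \<in> borel_measurable Q" for n using intY by (rule borel_measurable_integrable)
  have meas: "(\<lambda>w. M (\<tau> w) w) \<in> borel_measurable Q"
    by (rule borel_measurable_LIMSEQ_metric[where f=Y]) (use YM lim space in auto)
  have "integrable Q (\<lambda>w. M (\<tau> w) w)" "(\<lambda>n. LINT w|Q. Y n w) \<longlonglongrightarrow> (LINT w|Q. M (\<tau> w) w)"
    by (rule integrable_dominated_convergence[where w="\<lambda>_. C" and s=Y] integral_dominated_convergence[where w="\<lambda>_. C" and s=Y],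
        use meas YM lim bnd space in auto)+
  then show "integrable Q (\<lambda>w. M (enn2real (min (T w) (ennreal t))) w)"
    "(LINT w|Q. M (enn2real (min (T w) (ennreal t))) w) = (LINT w|Q. M 0 w)"
    unfolding EY \<tau>_def[symmetric] by (auto dest: LIMSEQ_const_iff[THEN iffD1])
qed

section \<open>Lyapunov functions\<close>

text \<open>Exponents start at 2 so that the derivative exists and vanishes at the kink. Used with
  \<open>n = 1\<close> for the bump and \<open>n = 0\<close> for its gradient.\<close>

lemma has_real_derivative_pos_part_power:
  "((\<lambda>s. (max 0 s) ^ (n + 2)) has_real_derivative real (n + 2) * (max 0 s) ^ (n + 1)) (at (s::real))"
proof -
  consider "s < 0" | "s = 0" | "0 < s" by linarith
  then show ?thesis
  proof cases
    case 1
    have "((\<lambda>_. 0) has_real_derivative real (n + 2) * (max 0 s) ^ (n + 1)) (at s)"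
      using 1 by (auto intro!: derivative_eq_intros simp: max_def)
    then show ?thesis
      by (rule has_field_derivative_transform_within_open[where S="{..<0}"]) (use 1 in \<open>auto simp: max_def\<close>)
  next
    case 2
    have "((\<lambda>h. (max 0 h) ^ (n + 1)) \<longlongrightarrow> (max 0 0) ^ (n + 1)) (at (0::real))"
      by (intro tendsto_intros)
    then have "((\<lambda>h. (max 0 h) ^ (n + 1)) \<longlongrightarrow> 0) (at (0::real))" by simp
    then have "((\<lambda>h. ((max 0 (0 + h)) ^ (n + 2) - (max 0 0) ^ (n + 2)) / h) \<longlongrightarrow> 0) (at (0::real))"
      by (rule Lim_transform_eventually) (auto simp: eventually_at max_def intro!: exI[of _ 1])
    then show ?thesis using 2 by (simp add: DERIV_def)
  next
    case 3
    have "((\<lambda>s. s ^ (n + 2)) has_real_derivative real (n + 2) * (max 0 s) ^ (n + 1)) (at s)"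
      using DERIV_pow[of "n + 2" s] 3 by (simp add: max_def)
    then show ?thesis
      by (rule has_field_derivative_transform_within_open[where S="{0<..}"]) (use 3 in \<open>auto simp: max_def\<close>)
  qed
qed

text \<open>A third power makes the truncated quadratic function twice continuously differentiable, hence
  admissible in the martingale problem.\<close>

definition bump_base :: "real^'n \<Rightarrow> real \<Rightarrow> real^'n \<Rightarrow> real" where
  "bump_base z M y = max 0 (1 - (y - z) \<bullet> (y - z) / M\<^sup>2)"

definition bump :: "real^'n \<Rightarrow> real \<Rightarrow> real^'n \<Rightarrow> real" where
  "bump z M y = bump_base z M y ^ 3"

definition bump_gradient :: "real^'n \<Rightarrow> real \<Rightarrow> real^'n \<Rightarrow> real^'n" where
  "bump_gradient z M y = (- (6 / M\<^sup>2) * bump_base z M y ^ 2) *\<^sub>R (y - z)"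

definition bump_hessian :: "real^'n \<Rightarrow> real \<Rightarrow> real^'n \<Rightarrow> real^'n^'n" where
  "bump_hessian z M y = (24 / M ^ 4 * bump_base z M y) *\<^sub>R outer (y - z) + mat (- (6 / M\<^sup>2) * bump_base z M y ^ 2)"

lemma mat_mult_vec: "mat c *v h = c *\<^sub>R (h :: real^'n)"
  by (simp add: vec_eq_iff matrix_vector_mult_def mat_def if_distrib[of "\<lambda>x. x * _"] cong: if_cong)

lemma bump_base_bounds: "0 \<le> bump_base z M y" "bump_base z M y \<le> 1"
  by (auto simp: bump_base_def)

lemma bump_bounds: "0 \<le> bump z M y" "bump z M y \<le> 1"
  using bump_base_bounds[of z M y] by (auto simp: bump_def power_le_one)

lemma continuous_bump_base: "continuous_on S (bump_base z M)"
  unfolding bump_base_def by (cases "M = 0") (auto intro!: continuous_intros)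

lemma bump_base_power_derivative:
  fixes z :: "real^'n"
  assumes M: "0 < M"
  shows "((\<lambda>y. bump_base z M y ^ (n + 2)) has_derivative
    (\<lambda>h. real (n + 2) * bump_base z M y ^ (n + 1) * (- 2 * ((y - z) \<bullet> h) / M\<^sup>2))) (at y)"
proof -
  have "((\<lambda>y. 1 - (y - z) \<bullet> (y - z) / M\<^sup>2) has_derivative (\<lambda>h. - 2 * ((y - z) \<bullet> h) / M\<^sup>2)) (at y)"
  proof -
    have "((\<lambda>y. (y - z) \<bullet> (y - z)) has_derivative (\<lambda>h. 2 * ((y - z) \<bullet> h))) (at y)"
      by (auto intro!: derivative_eq_intros simp: inner_commute)
    then have "((\<lambda>y. 1 + (- 1 / M\<^sup>2) * ((y - z) \<bullet> (y - z))) has_derivative (\<lambda>h. 0 + (- 1 / M\<^sup>2) * (2 * ((y - z) \<bullet> h)))) (at y)"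
      by (intro has_derivative_add has_derivative_const has_derivative_mult_right)
    then show ?thesis by simp
  qed
  from has_derivative_compose[OF this has_real_derivative_pos_part_power[of n, unfolded has_field_derivative_def]]
  show ?thesis by (simp add: bump_base_def)
qed

lemma has_gradient_hessian_bump:
  fixes z :: "real^'n"
  assumes M: "0 < M"
  shows "has_gradient_hessian (bump z M) (bump_gradient z M) (bump_hessian z M)"
  unfolding has_gradient_hessian_def
proof (intro conjI allI)
  fix y
  have "((\<lambda>y. bump_base z M y ^ (1 + 2)) has_derivative (\<lambda>h. bump_gradient z M y \<bullet> h)) (at y)"
    by (rule has_derivative_eq_rhs[OF bump_base_power_derivative[OF M]])
       (simp add: bump_gradient_def fun_eq_iff power2_eq_square)
  then show "(bump z M has_derivative (\<lambda>h. bump_gradient z M y \<bullet> h)) (at y)"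
    by (simp add: bump_def[abs_def] numeral_3_eq_3)
  have base: "((\<lambda>y. bump_base z M y ^ 2) has_derivative
    (\<lambda>h. 2 * bump_base z M y * (- 2 * ((y - z) \<bullet> h) / M\<^sup>2))) (at y)"
    using bump_base_power_derivative[OF M, of z 0 y] by (simp add: power2_eq_square)
  have id: "((\<lambda>y. y - z) has_derivative (\<lambda>h. h)) (at y)" by (auto intro!: derivative_eq_intros)
  have "((\<lambda>y. (- (6 / M\<^sup>2) * bump_base z M y ^ 2) *\<^sub>R (y - z)) has_derivative
      (\<lambda>h. (- (6 / M\<^sup>2) * bump_base z M y ^ 2) *\<^sub>R h + (- (6 / M\<^sup>2) * (2 * bump_base z M y * (- 2 * ((y - z) \<bullet> h) / M\<^sup>2))) *\<^sub>R (y - z))) (at y)"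
    by (intro has_derivative_scaleR has_derivative_mult_right base id)
  then show "(bump_gradient z M has_derivative (*v) (bump_hessian z M y)) (at y)"
    unfolding bump_gradient_def[abs_def]
  proof (rule has_derivative_eq_rhs, intro ext)
    fix h
    have "- (6 / M\<^sup>2) * (2 * bump_base z M y * (- 2 * ((y - z) \<bullet> h) / M\<^sup>2)) = 24 / M ^ 4 * bump_base z M y * ((y - z) \<bullet> h)"
      by (simp add: power2_eq_square power4_eq_xxxx)
    moreover have "bump_hessian z M y *v h = (24 / M ^ 4 * bump_base z M y * ((y - z) \<bullet> h)) *\<^sub>R (y - z) + (- (6 / M\<^sup>2) * bump_base z M y ^ 2) *\<^sub>R h"
      by (simp add: bump_hessian_def matrix_vector_mult_add_rdistrib scaleR_matrix_vector_assoc[symmetric] outer_mult mat_mult_vec)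
    ultimately show "(- (6 / M\<^sup>2) * bump_base z M y ^ 2) *\<^sub>R h + (- (6 / M\<^sup>2) * (2 * bump_base z M y * (- 2 * ((y - z) \<bullet> h) / M\<^sup>2))) *\<^sub>R (y - z) = bump_hessian z M y *v h"
      by (simp only: add.commute)
  qed
  have diag: "continuous_on UNIV (\<lambda>y. if i = j then - (6 / M\<^sup>2) * bump_base z M y ^ 2 else 0)" for i j :: 'n
    using M by (cases "i = j") (auto intro!: continuous_intros continuous_bump_base)
  show "continuous_on UNIV (bump_hessian z M)"
    unfolding bump_hessian_def outer_def mat_def
    by (intro continuous_intros continuous_bump_base diag)
qed

lemma bump_eq_0:
  assumes "0 < M" "y \<notin> ball z M"
  shows "bump_base z M y = 0"
proof -
  have "M\<^sup>2 \<le> (y - z) \<bullet> (y - z)"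
    using assms by (simp add: dist_norm norm_minus_commute power2_norm_eq_inner[symmetric])
  then show ?thesis using assms by (simp add: bump_base_def)
qed

lemma C2_compact_bump:
  fixes z :: "real^'n"
  assumes M: "0 < M"
  shows "C2_compact UNIV (bump z M)"
proof -
  have "bump z M x = 0" if "x \<notin> ball z M" for x
    by (simp only: bump_def bump_eq_0[OF M that]) simp
  then have "{x. bump z M x \<noteq> 0} \<subseteq> ball z M" by blast
  then have "bounded {x. bump z M x \<noteq> 0}" by (rule bounded_subset[OF bounded_ball])
  then show ?thesis using has_gradient_hessian_bump[OF M, of z] by (auto simp: C2_compact_def)
qed

lemma bump_center: "bump z M z = 1" by (simp add: bump_def bump_base_def)

context
  fixes B :: "('n::finite) matrix_field" and d :: real
  assumes cont_B: "continuous_on UNIV B" and trace_B: "\<And>y. trace (B y) = 1"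
    and B_nonneg: "\<And>y v. 0 \<le> v \<bullet> (B y *v v)" and B_le: "\<And>y v. v \<bullet> (B y *v v) \<le> d * (v \<bullet> v)"
    and d: "1 \<le> d"
begin

lemma generator_bump:
  "B y \<bullet> bump_hessian z M y =
    24 / M ^ 4 * bump_base z M y * ((y - z) \<bullet> (B y *v (y - z))) - 6 / M\<^sup>2 * bump_base z M y ^ 2"
  by (simp add: bump_hessian_def inner_add_right inner_mat_1 trace_B inner_outer)

lemma generator_bump_lower: "- (6 / M\<^sup>2) \<le> B y \<bullet> bump_hessian z M y"
proof -
  have "6 / M\<^sup>2 * bump_base z M y ^ 2 \<le> 6 / M\<^sup>2 * 1"
    using bump_base_bounds[of z M y] by (intro mult_left_mono power_le_one) auto
  moreover have "0 \<le> 24 / M ^ 4 * bump_base z M y * ((y - z) \<bullet> (B y *v (y - z)))"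
    using bump_base_bounds[of z M y] B_nonneg by (intro mult_nonneg_nonneg) auto
  ultimately show ?thesis unfolding generator_bump by linarith
qed

text \<open>On this ball the base is at least \<open>15 / 16\<close>, so the trace term is at most
  \<open>- 6 * (15 / 16)^2 / M^2\<close>, while the outer product term, which has the wrong sign, is
  at most \<open>(3 / 2) / M^2\<close>. The hypothesis with \<open>16 * d\<close> is chosen to leave
  this margin.\<close>

lemma generator_bump_upper:
  assumes M: "0 < M" and y: "16 * d * ((y - z) \<bullet> (y - z)) \<le> M\<^sup>2"
  shows "B y \<bullet> bump_hessian z M y \<le> - (3 / M\<^sup>2)"
proof -
  let ?s = "(y - z) \<bullet> (y - z)"
  have "16 * ?s \<le> 16 * d * ?s" using d by (intro mult_right_mono) auto
  then have "?s / M\<^sup>2 \<le> 1 / 16" using y M by (simp add: field_simps)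
  then have "15 / 16 \<le> 1 - ?s / M\<^sup>2" by simp
  also have "\<dots> \<le> bump_base z M y" by (simp add: bump_base_def)
  finally have u: "15 / 16 \<le> bump_base z M y" .
  have "(15/16)\<^sup>2 \<le> bump_base z M y ^ 2" using u by (intro power_mono) auto
  then have "6 / M\<^sup>2 * (15/16)\<^sup>2 \<le> 6 / M\<^sup>2 * bump_base z M y ^ 2" by (intro mult_left_mono) auto
  moreover have "24 / M ^ 4 * bump_base z M y * ((y - z) \<bullet> (B y *v (y - z))) \<le> 24 / M ^ 4 * 1 * (M\<^sup>2 / 16)"
    using bump_base_bounds[of z M y] B_nonneg order_trans[OF B_le, of "y - z" "M\<^sup>2 / 16" y] y
    by (intro mult_mono mult_nonneg_nonneg) auto
  moreover have "24 / M ^ 4 * 1 * (M\<^sup>2 / 16) = (3/2) / M\<^sup>2" using M by (simp add: power2_eq_square power4_eq_xxxx)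
  moreover have "6 / M\<^sup>2 * (15/16)\<^sup>2 = (6 * (15/16)\<^sup>2) / M\<^sup>2" by simp
  moreover have "(3/2) / M\<^sup>2 + 3 / M\<^sup>2 \<le> (6 * (15/16)\<^sup>2) / M\<^sup>2"
    unfolding add_divide_distrib[symmetric] by (intro divide_right_mono) (auto simp: power2_eq_square)
  ultimately show ?thesis unfolding generator_bump by linarith
qed

lemma continuous_generator_bump:
  assumes M: "0 < M" shows "continuous_on S (\<lambda>y. B y \<bullet> bump_hessian z M y)"
proof -
  have "continuous_on UNIV (\<lambda>y. B y \<bullet> bump_hessian z M y)"
    using has_gradient_hessian_bump[OF M, of z] by (intro continuous_intros cont_B) (simp add: has_gradient_hessian_def)
  then show ?thesis by (rule continuous_on_subset) simp
qed

lemma generator_bump_bounded: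
  assumes M: "0 < M" obtains K where "\<And>y. \<bar>B y \<bullet> bump_hessian z M y\<bar> \<le> K"
proof -
  have "compact ((\<lambda>y. B y \<bullet> bump_hessian z M y) ` cball z M)"
    by (intro compact_continuous_image continuous_generator_bump M) auto
  then have "bounded ((\<lambda>y. B y \<bullet> bump_hessian z M y) ` cball z M)" by (rule compact_imp_bounded)
  then obtain K where K: "\<And>y. y \<in> cball z M \<Longrightarrow> \<bar>B y \<bullet> bump_hessian z M y\<bar> \<le> K"
    by (auto simp: bounded_iff simp del: mem_cball)
  have "\<bar>B y \<bullet> bump_hessian z M y\<bar> \<le> max K 0" for y
  proof (cases "y \<in> cball z M")
    case True then show ?thesis using K[OF True] by simp
  next
    case False
    then have "bump_base z M y = 0" using M by (intro bump_eq_0) auto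
    then show ?thesis by (simp add: generator_bump)
  qed
  then show ?thesis by (rule that)
qed

text \<open>Optional stopping for the martingale attached to the bump, truncated at a deterministic
  time. The third claim asks for negativity of the generator only along the path up to the stopped
  time and gives the decrease; the last rests on the global lower bound and limits how fast the bump
  can fall.\<close>

lemma dynkin_bump:
  fixes Q :: "'n path measure"
  assumes Q: "solves_martingale_problem B x Q" and M: "0 < M" and T: "stopping_time natural_filtration T" and t: "0 < t"
  defines "\<tau> w \<equiv> enn2real (min (T w) (ennreal t))"
  shows "integrable Q (\<lambda>w. bump z M (w (\<tau> w)))" "integrable Q \<tau>"
    and "(AE w in Q. \<forall>s. 0 \<le> s \<longrightarrow> s \<le> \<tau> w \<longrightarrow> B (w s) \<bullet> bump_hessian z M (w s) \<le> - c) \<Longrightarrow>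
      (LINT w|Q. bump z M (w (\<tau> w))) + c * (LINT w|Q. \<tau> w) \<le> bump z M x"
    and "bump z M x \<le> (LINT w|Q. bump z M (w (\<tau> w))) + 6 / M\<^sup>2 * (LINT w|Q. \<tau> w)"
proof -
  have prob: "prob_space Q" and sets: "sets Q = sets path_space" and start: "AE w in Q. w 0 = x"
    using Q by (auto simp: solves_martingale_problem_def)
  interpret prob_space Q by (rule prob)
  have space: "space Q = space path_space" by (rule sets_eq_imp_space_eq[OF sets])
  define b where "b y = B y \<bullet> bump_hessian z M y" for y
  define N where "N t w = bump z M (w t) - integral {0..t} (\<lambda>s. b (w s))" for t and w :: "'n path"
  have mart: "path_martingale Q N"
    using Q C2_compact_bump[OF M, of z] has_gradient_hessian_bump[OF M, of z]
    unfolding solves_martingale_problem_def N_def b_def by blast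
  obtain K where K: "\<And>y. \<bar>b y\<bar> \<le> K" using generator_bump_bounded[OF M, of z] unfolding b_def by blast
  have K0: "0 \<le> K" using K[of 0] by simp
  have contb: "continuous_on {0..s} (\<lambda>s. b (w s))" if "w \<in> space path_space" for w s
    unfolding b_def by (rule continuous_on_compose2[OF continuous_generator_bump[OF M, of UNIV] path_continuous_on[OF that]]) auto
  have intb: "(\<lambda>s. b (w s)) integrable_on {0..s}" if "w \<in> space path_space" for w s
    by (rule integrable_continuous_interval[OF contb[OF that]])
  have bump_meas: "bump z M \<in> borel_measurable borel"
    unfolding bump_def by (intro borel_measurable_continuous_onI continuous_intros continuous_bump_base)
  have contbump: "continuous_on S (bump z M)" for S
    unfolding bump_def by (intro continuous_intros continuous_bump_base)
  have \<tau>0: "0 \<le> \<tau> w" "\<tau> w \<le> t" for w unfolding \<tau>_def using t by (auto intro!: enn2real_leI)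
  have TQ: "T \<in> borel_measurable Q"
    by (rule measurable_stopping_time[OF T]) (use sets_natural_filtration_subset sets space in auto)
  then have \<tau>_meas: "\<tau> \<in> borel_measurable Q" unfolding \<tau>_def by measurable
  show int\<tau>: "integrable Q \<tau>"
    by (rule integrable_const_bound[of _ t]) (use \<tau>0 \<tau>_meas in auto)
  have id: "(\<lambda>w. w) \<in> measurable Q path_space" using sets by (simp add: measurable_ident_sets)
  have eval_meas: "(\<lambda>w. w (\<tau> w)) \<in> borel_measurable Q"
    by (rule measurable_eval_random[OF \<tau>_meas \<tau>0(1) id])
  show intbump: "integrable Q (\<lambda>w. bump z M (w (\<tau> w)))"
    by (rule integrable_const_bound[of _ 1])
       (use measurable_compose[OF eval_meas bump_meas] in \<open>simp_all add: abs_of_nonneg[OF bump_bounds(1)] bump_bounds\<close>)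
  have int_bound: "\<bar>integral {0..s} (\<lambda>s. b (w s))\<bar> \<le> K * s" if "w \<in> space path_space" "0 \<le> s" for w s
    using integral_bound[OF that(2) contb[OF that(1)], of K] K by simp
  have bound: "\<bar>N s w\<bar> \<le> 1 + K * t" if "w \<in> space path_space" "0 \<le> s" "s \<le> t" for w s
  proof -
    have "K * s \<le> K * t" using K0 that by (intro mult_left_mono) auto
    then show ?thesis using int_bound[OF that(1,2)] bump_bounds[of z M "w s"] unfolding N_def by linarith
  qed
  have contN: "continuous_on {0..t} (\<lambda>s. N s w)" if w: "w \<in> space path_space" for w
    unfolding N_def
    by (intro continuous_on_diff continuous_on_compose2[OF contbump path_continuous_on[OF w]]
        indefinite_integral_continuous_1 intb[OF w]) auto
  note os = optional_stopping[OF prob sets mart T t bound contN]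
  have intN: "integrable Q (\<lambda>w. N (\<tau> w) w)" using os(1) by (simp add: \<tau>_def)
  have int0: "integrable Q (N 0)" using mart unfolding path_martingale_def by simp
  have "AE w in Q. N 0 w = bump z M x" using start by eventually_elim (simp add: N_def)
  then have "(LINT w|Q. N 0 w) = (LINT w|Q. bump z M x)"
    by (intro integral_cong_AE borel_measurable_integrable[OF int0] borel_measurable_const)
  then have EN: "(LINT w|Q. N (\<tau> w) w) = bump z M x" using os(2) by (simp add: \<tau>_def prob_space)
  show "(LINT w|Q. bump z M (w (\<tau> w))) + c * (LINT w|Q. \<tau> w) \<le> bump z M x"
    if neg: "AE w in Q. \<forall>s. 0 \<le> s \<longrightarrow> s \<le> \<tau> w \<longrightarrow> B (w s) \<bullet> bump_hessian z M (w s) \<le> - c"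
  proof -
    have "(LINT w|Q. bump z M (w (\<tau> w)) + c * \<tau> w) \<le> (LINT w|Q. N (\<tau> w) w)"
    proof (rule integral_mono_AE)
      show "AE w in Q. bump z M (w (\<tau> w)) + c * \<tau> w \<le> N (\<tau> w) w"
        using neg AE_space
      proof eventually_elim
        case (elim w)
        then have w: "w \<in> space path_space" by (simp add: space)
        have "integral {0..\<tau> w} (\<lambda>s. b (w s)) \<le> integral {0..\<tau> w} (\<lambda>s. - c)"
          using elim by (intro integral_le intb[OF w]) (auto simp: b_def)
        then show ?case using \<tau>0[of w] by (simp add: N_def mult.commute)
      qed
    qed (use intN intbump int\<tau> in auto)
    then show ?thesis using intbump int\<tau> by (simp add: EN)
  qed
  have "(LINT w|Q. N (\<tau> w) w) \<le> (LINT w|Q. bump z M (w (\<tau> w)) + 6 / M\<^sup>2 * \<tau> w)"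
  proof (rule integral_mono_AE)
    show "AE w in Q. N (\<tau> w) w \<le> bump z M (w (\<tau> w)) + 6 / M\<^sup>2 * \<tau> w"
      using AE_space
    proof eventually_elim
      case (elim w)
      then have w: "w \<in> space path_space" by (simp add: space)
      have "integral {0..\<tau> w} (\<lambda>s. - (6 / M\<^sup>2)) \<le> integral {0..\<tau> w} (\<lambda>s. b (w s))"
        using generator_bump_lower by (intro integral_le intb[OF w]) (auto simp: b_def)
      then show ?case using \<tau>0[of w] by (simp add: N_def mult.commute)
    qed
  qed (use intN intbump int\<tau> in auto)
  then show "bump z M x \<le> (LINT w|Q. bump z M (w (\<tau> w))) + 6 / M\<^sup>2 * (LINT w|Q. \<tau> w)"
    using intbump int\<tau> by (simp add: EN)
qed

end

section \<open>The coarse step\<close>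

lemma first_time_mono: "E \<subseteq> E' \<Longrightarrow> first_time s w E' \<le> first_time s w E"
  unfolding first_time_def by (intro INF_superset_mono) auto

text \<open>A path segment inside the degenerate set is connected, so it cannot leave its component
  without leaving the set. A target that varies with the path is thus replaced by a fixed one; for a
  start outside, both times are 0.\<close>

lemma component_exit_time_eq:
  fixes A :: "('n::finite) matrix_field"
  assumes w: "w \<in> space path_space"
  shows "component_exit_time A \<kappa> w = first_time 0 w (- degenerate_set A \<kappa>)"
proof (cases "w 0 \<in> degenerate_set A \<kappa>")
  case True
  let ?W = "degenerate_set A \<kappa>"
  let ?C = "connected_component_set ?W (w 0)"
  have "first_time 0 w (- ?C) \<le> first_time 0 w (- ?W)"
    by (intro first_time_mono) (auto dest: connected_component_in)
  moreover have "first_time 0 w (- ?W) \<le> first_time 0 w (- ?C)"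
    unfolding first_time_def[of 0 w "- ?C"]
  proof (intro INF_greatest)
    fix t assume "t \<in> {t. 0 \<le> t \<and> w t \<in> - ?C}"
    then have t: "0 \<le> t" "w t \<notin> ?C" by auto
    have "\<not> w ` {0..t} \<subseteq> ?W"
    proof
      assume sub: "w ` {0..t} \<subseteq> ?W"
      have "connected (w ` {0..t})" by (intro connected_continuous_image path_continuous_on[OF w]) auto
      then have "w ` {0..t} \<subseteq> ?C" using sub t by (intro connected_component_maximal) auto
      moreover have "w t \<in> w ` {0..t}" using t(1) by simp
      ultimately show False using t(2) by blast
    qed
    then obtain u where u: "0 \<le> u" "u \<le> t" "w u \<notin> ?W"
      by (meson atLeastAtMost_iff image_subsetI)
    then have "first_time 0 w (- ?W) \<le> ennreal u" unfolding first_time_def by (intro INF_lower) auto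
    also have "\<dots> \<le> ennreal t" using u by (simp add: ennreal_leI)
    finally show "first_time 0 w (- ?W) \<le> ennreal t" .
  qed
  ultimately show ?thesis using True by (simp add: component_exit_time_def)
next
  case False
  have "first_time 0 w (- degenerate_set A \<kappa>) \<le> ennreal 0"
    unfolding first_time_def using False by (intro INF_lower) auto
  then show ?thesis using False by (simp add: component_exit_time_def)
qed

context
  fixes A :: "('n::finite) matrix_field" and \<kappa> :: real
  assumes A: "positive_definite_field A"
begin

lemma closed_Compl_degenerate_set: "closed (- degenerate_set A \<kappa>)"
  using open_degenerate_set[OF A] by (simp add: closed_def)

text \<open>The random sphere is eliminated in favour of two times of the path: \<open>a\<close>,
  when the degenerate set is left, and \<open>b\<close>, when the distance from \<open>w a\<close>
  is one. Galmarino's test can be checked on this form.\<close>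

lemma step_time_le_iff:
  assumes w: "w \<in> space path_space" and t: "0 \<le> t"
  shows "step_time A \<kappa> w \<le> ennreal t \<longleftrightarrow>
    (\<exists>a b. 0 \<le> a \<and> a \<le> b \<and> b \<le> t \<and> first_time 0 w (- degenerate_set A \<kappa>) = ennreal a \<and> dist (w a) (w b) = 1)"
proof (cases "first_time 0 w (- degenerate_set A \<kappa>)")
  case (real a)
  have "step_time A \<kappa> w = first_time a w (sphere (w a) 1)"
    using real by (simp add: step_time_def component_exit_time_eq[OF w])
  also have "\<dots> \<le> ennreal t \<longleftrightarrow> (\<exists>u\<in>{a..t}. w u \<in> sphere (w a) 1)"
    by (rule first_time_le_iff[OF w real(1) closed_sphere t])
  also have "\<dots> \<longleftrightarrow> (\<exists>b. a \<le> b \<and> b \<le> t \<and> dist (w a) (w b) = 1)" by auto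
  also have "\<dots> \<longleftrightarrow> (\<exists>a' b. 0 \<le> a' \<and> a' \<le> b \<and> b \<le> t \<and> first_time 0 w (- degenerate_set A \<kappa>) = ennreal a' \<and> dist (w a') (w b) = 1)"
    using real by auto
  finally show ?thesis .
next
  case top
  then show ?thesis by (auto simp: step_time_def component_exit_time_eq[OF w] top_unique)
qed

lemma measurable_unit_exit_time:
  "(\<lambda>w. first_time 0 w (sphere (w 0) 1)) \<in> borel_measurable (path_space :: 'n path measure)"
proof (rule borel_measurable_ennrealI_le)
  fix t :: real assume t: "0 \<le> t"
  have "{w \<in> space (path_space :: 'n path measure). \<exists>u\<in>{0..t}. \<bar>dist (w 0) (w u) - 1\<bar> = 0} \<in> sets path_space"
  proof (rule measurable_hits_zero[OF t])
    show "(\<lambda>w. \<bar>dist (w 0) (w u) - 1\<bar>) \<in> borel_measurable (path_space :: 'n path measure)" if "0 \<le> u" for u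
      by (intro borel_measurable_abs borel_measurable_diff borel_measurable_dist measurable_eval borel_measurable_const order_refl that)
    show "continuous_on {0..t} (\<lambda>u. \<bar>dist (w 0) (w u) - 1\<bar>)" if "w \<in> space path_space" for w :: "'n path"
      by (intro continuous_intros path_continuous_on[OF that]) auto
  qed simp
  also have "{w \<in> space (path_space :: 'n path measure). \<exists>u\<in>{0..t}. \<bar>dist (w 0) (w u) - 1\<bar> = 0} =
      {w \<in> space path_space. first_time 0 w (sphere (w 0) 1) \<le> ennreal t}"
    using t by (intro Collect_cong conj_cong refl) (simp add: first_time_le_iff[OF _ _ closed_sphere])
  finally show "{w \<in> space (path_space :: 'n path measure). first_time 0 w (sphere (w 0) 1) \<le> ennreal t} \<in> sets path_space" .
qed

text \<open>Shifted to the exit time, the path has the centre of the sphere as its starting point.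
  Measurability of the step then follows by composition with the shift.\<close>

lemma step_time_eq_add:
  assumes w: "w \<in> space path_space"
  defines "T \<equiv> first_time 0 w (- degenerate_set A \<kappa>)"
  shows "step_time A \<kappa> w = T + first_time 0 (shift_path (enn2real T) w) (sphere (shift_path (enn2real T) w 0) 1)"
proof (cases T)
  case (real a)
  let ?w = "shift_path a w"
  have w': "?w \<in> space path_space" by (rule shift_path_in_space[OF w real(1)])
  show ?thesis
  proof (rule ennreal_eqI_le)
    fix t :: real assume t: "0 \<le> t"
    have "step_time A \<kappa> w \<le> ennreal t \<longleftrightarrow> (\<exists>b. a \<le> b \<and> b \<le> t \<and> dist (w a) (w b) = 1)"
      unfolding step_time_le_iff[OF w t] T_def[symmetric] using real by auto
    also have "\<dots> \<longleftrightarrow> a \<le> t \<and> (\<exists>u\<in>{0..t - a}. ?w u \<in> sphere (?w 0) 1)"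
    proof safe
      fix b assume "a \<le> b" "b \<le> t" "dist (w a) (w b) = 1"
      then show "\<exists>u\<in>{0..t - a}. ?w u \<in> sphere (?w 0) 1" "a \<le> t" by (auto intro!: bexI[of _ "b - a"])
    next
      fix u assume "a \<le> t" "u \<in> {0..t - a}" "?w u \<in> sphere (?w 0) 1"
      then show "\<exists>b. a \<le> b \<and> b \<le> t \<and> dist (w a) (w b) = 1" by (intro exI[of _ "a + u"]) auto
    qed
    also have "\<dots> \<longleftrightarrow> a \<le> t \<and> first_time 0 ?w (sphere (?w 0) 1) \<le> ennreal (t - a)"
      by (intro conj_cong refl) (simp add: first_time_le_iff[OF w' _ closed_sphere])
    also have "\<dots> \<longleftrightarrow> T + first_time 0 ?w (sphere (?w 0) 1) \<le> ennreal t"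
    proof (cases "first_time 0 ?w (sphere (?w 0) 1)")
      case r: (real r)
      then show ?thesis using real t by (auto simp: ennreal_plus[symmetric] simp del: ennreal_plus)
    next
      case top
      then show ?thesis by (auto simp: top_unique)
    qed
    finally show "step_time A \<kappa> w \<le> ennreal t \<longleftrightarrow>
        T + first_time 0 (shift_path (enn2real T) w) (sphere (shift_path (enn2real T) w 0) 1) \<le> ennreal t"
      using real by simp
  qed
next
  case top
  then show ?thesis by (simp add: T_def step_time_def component_exit_time_eq[OF w])
qed

lemma measurable_step_time: "step_time A \<kappa> \<in> borel_measurable path_space"
proof -
  define T where "T w = first_time 0 w (- degenerate_set A \<kappa>)" for w
  have T: "T \<in> borel_measurable path_space" unfolding T_def by (rule measurable_first_time[OF closed_Compl_degenerate_set])
  have "(\<lambda>w. shift_path (enn2real (T w)) w) \<in> measurable path_space path_space"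
    using T by (intro measurable_shift_path) auto
  then have "(\<lambda>w. T w + first_time 0 (shift_path (enn2real (T w)) w) (sphere (shift_path (enn2real (T w)) w 0) 1)) \<in> borel_measurable path_space"
    by (intro borel_measurable_add T measurable_compose[OF _ measurable_unit_exit_time])
  also have "?this \<longleftrightarrow> ?thesis"
    by (intro measurable_cong) (simp add: step_time_eq_add T_def)
  finally show ?thesis .
qed

lemma stopping_time_step_time: "stopping_time natural_filtration (step_time A \<kappa>)"
proof (rule galmarino_stopping_time[OF measurable_step_time])
  fix w w' :: "'n path" and t :: real
  assume w: "w \<in> space path_space" "w' \<in> space path_space" and t: "0 \<le> t"
    and eq: "\<And>s. 0 \<le> s \<Longrightarrow> s \<le> t \<Longrightarrow> w s = w' s" and le: "step_time A \<kappa> w \<le> ennreal t"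
  obtain a b where ab: "0 \<le> a" "a \<le> b" "b \<le> t" "first_time 0 w (- degenerate_set A \<kappa>) = ennreal a" "dist (w a) (w b) = 1"
    using le unfolding step_time_le_iff[OF w(1) t] by blast
  have iff: "first_time 0 w (- degenerate_set A \<kappa>) \<le> ennreal s \<longleftrightarrow> first_time 0 w' (- degenerate_set A \<kappa>) \<le> ennreal s" if "0 \<le> s" "s \<le> t" for s
  proof -
    have "(\<exists>u\<in>{0..s}. w u \<in> - degenerate_set A \<kappa>) \<longleftrightarrow> (\<exists>u\<in>{0..s}. w' u \<in> - degenerate_set A \<kappa>)"
      using eq that by (intro bex_cong refl) simp
    then show ?thesis
      using first_time_le_iff[OF w(1) order_refl closed_Compl_degenerate_set that(1)] first_time_le_iff[OF w(2) order_refl closed_Compl_degenerate_set that(1)] by simp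
  qed
  have "first_time 0 w' (- degenerate_set A \<kappa>) = ennreal a"
  proof (rule antisym)
    show le': "first_time 0 w' (- degenerate_set A \<kappa>) \<le> ennreal a" using iff[of a] ab by simp
    then obtain c where c: "0 \<le> c" "first_time 0 w' (- degenerate_set A \<kappa>) = ennreal c"
      using ab(1) by (cases "first_time 0 w' (- degenerate_set A \<kappa>)") (auto simp: top_unique)
    then have "c \<le> a" using le' ab by simp
    then have "ennreal a \<le> ennreal c" using iff[of c] c ab by simp
    then show "ennreal a \<le> first_time 0 w' (- degenerate_set A \<kappa>)" using c by simp
  qed
  then show "step_time A \<kappa> w' \<le> ennreal t"
    unfolding step_time_le_iff[OF w(2) t] using ab eq[of a] eq[of b]
    by (intro exI[of _ a] exI[of _ b]) auto
qed

text \<open>A step visits two points at distance one. They cannot both lie in an open ball of radius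
  \<open>1/2\<close>, wherever its first phase has led.\<close>

lemma exit_half_ball_le_step_time:
  assumes w: "w \<in> space path_space" "w 0 = x"
  shows "first_time 0 w (- ball x (1/2)) \<le> step_time A \<kappa> w"
proof (cases "step_time A \<kappa> w")
  case (real t)
  then have "step_time A \<kappa> w \<le> ennreal t" by simp
  then obtain a b where ab: "0 \<le> a" "a \<le> b" "b \<le> t" "dist (w a) (w b) = 1"
    unfolding step_time_le_iff[OF w(1) real(1)] by blast
  then have "w a \<notin> ball x (1/2) \<or> w b \<notin> ball x (1/2)"
    using dist_triangle[of "w a" "w b" x] by (auto simp: dist_commute)
  then obtain u where u: "0 \<le> u" "u \<le> t" "w u \<notin> ball x (1/2)" using ab by (metis order_trans)
  then have "first_time 0 w (- ball x (1/2)) \<le> ennreal u" unfolding first_time_def by (intro INF_lower) auto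
  also have "\<dots> \<le> ennreal t" using u by (simp add: ennreal_leI)
  finally show ?thesis using real by simp
qed simp

section \<open>Duration of a step and decrease of the Lyapunov function\<close>

lemmas coefficient_bounds = normalized_field_properties[OF A]

lemma dimension_ge_1: "1 \<le> real CARD('n)" by (simp add: Suc_le_eq)

lemmas dynkin = dynkin_bump[OF coefficient_bounds(4,1,2,3) dimension_ge_1]

lemma integrable_min_stopping_time:
  assumes Q: "solves_martingale_problem (normalized_field A) x Q" and T: "stopping_time natural_filtration T" and t: "0 < t"
  shows "integrable Q (\<lambda>w. enn2real (min (T w) (ennreal t)))"
  by (rule dynkin(2)[OF Q zero_less_one T t])

lemma enn2real_min_mono: "a \<le> b \<Longrightarrow> enn2real (min a (ennreal t)) \<le> enn2real (min b (ennreal t))"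
  by (intro enn2real_mono min.mono) (auto simp: min_less_iff_disj)

text \<open>Tested with the bump of radius 1 centred at \<open>x\<close>, which starts at its
  maximum 1. On leaving the half ball it is at most \<open>(3/4)^3 = 27/64\<close>; without an exit
  by time 1 the elapsed time is 1. Together with the generator bound \<open>-6\<close> this gives
  \<open>1 \<le> 27/64 + 7 * E \<tau>\<close>, and \<open>37/448\<close> exceeds
  \<open>1/20\<close>.\<close>

lemma expected_step_time_lower:
  assumes Q: "solves_martingale_problem (normalized_field A) x Q"
  shows "1 / 20 \<le> (LINT w|Q. enn2real (min (step_time A \<kappa> w) (ennreal 1)))"
proof -
  have prob: "prob_space Q" and sets: "sets Q = sets path_space" and start: "AE w in Q. w 0 = x"
    using Q by (auto simp: solves_martingale_problem_def)
  interpret prob_space Q by (rule prob)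
  have space: "space Q = space path_space" by (rule sets_eq_imp_space_eq[OF sets])
  define \<sigma> where "\<sigma> w = first_time 0 w (- ball x (1/2))" for w :: "'n path"
  define \<tau> where "\<tau> w = enn2real (min (\<sigma> w) (ennreal 1))" for w
  have cl: "closed (- ball x (1/2))" by (simp add: closed_def)
  have st: "stopping_time natural_filtration \<sigma>" unfolding \<sigma>_def by (rule stopping_time_first_time[OF cl])
  note dy1 = dynkin(1)[OF Q zero_less_one st zero_less_one, of x, folded \<tau>_def]
    and dy2 = dynkin(2)[OF Q zero_less_one st zero_less_one, folded \<tau>_def]
    and dy4 = dynkin(4)[OF Q zero_less_one st zero_less_one, of x, folded \<tau>_def]
  have bump: "bump x 1 (w (\<tau> w)) \<le> 27 / 64 + \<tau> w" if w: "w \<in> space path_space" for w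
  proof (cases "\<sigma> w \<le> ennreal 1")
    case True
    then obtain s where s: "0 \<le> s" "\<sigma> w = ennreal s" "s \<le> 1" by (cases "\<sigma> w") (auto simp: top_unique)
    then have \<tau>: "\<tau> w = s" by (simp add: \<tau>_def min_def)
    have "\<exists>u\<in>{0..s}. w u \<in> - ball x (1/2)"
      using first_time_le_iff[OF w order_refl cl s(1)] s(2) by (simp add: \<sigma>_def)
    then obtain u where u: "0 \<le> u" "u \<le> s" "w u \<in> - ball x (1/2)" by auto
    then have "\<sigma> w \<le> ennreal u" using first_time_le_iff[OF w order_refl cl u(1)] by (auto simp: \<sigma>_def)
    then have "u = s" using u s by simp
    then have "1 / 2 \<le> norm (w s - x)" using u by (simp add: dist_norm norm_minus_commute)
    then have "(1/2)\<^sup>2 \<le> (norm (w s - x))\<^sup>2" by (intro power_mono) auto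
    then have "1 / 4 \<le> (w s - x) \<bullet> (w s - x)"
      unfolding power2_norm_eq_inner by (simp add: power_divide)
    then have "bump_base x 1 (w s) \<le> 3 / 4"
      unfolding bump_base_def by (intro max.boundedI) auto
    then have "bump_base x 1 (w s) ^ 3 \<le> (3/4) ^ 3" by (intro power_mono bump_base_bounds)
    then show ?thesis using \<tau> s by (simp add: bump_def power3_eq_cube)
  next
    case False
    then have "\<tau> w = 1" by (simp add: \<tau>_def min_def)
    then show ?thesis using bump_bounds(2)[of x 1 "w (\<tau> w)"] by simp
  qed
  have "(LINT w|Q. bump x 1 (w (\<tau> w))) \<le> (LINT w|Q. 27 / 64 + \<tau> w)"
    using dy1 dy2 bump space by (intro integral_mono) auto
  also have "\<dots> = 27 / 64 + (LINT w|Q. \<tau> w)" using dy2 by (simp add: prob_space)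
  finally have "1 / 20 \<le> (LINT w|Q. \<tau> w)" using dy4 by (simp add: bump_center)
  also have "\<dots> \<le> (LINT w|Q. enn2real (min (step_time A \<kappa> w) (ennreal 1)))"
  proof (rule integral_mono_AE)
    show "AE w in Q. \<tau> w \<le> enn2real (min (step_time A \<kappa> w) (ennreal 1))"
      using start AE_space
    proof eventually_elim
      case (elim w)
      then show ?case unfolding \<tau>_def \<sigma>_def space
        by (intro enn2real_min_mono exit_half_ball_le_step_time) auto
    qed
  qed (use dy2 integrable_min_stopping_time[OF Q stopping_time_step_time zero_less_one] in auto)
  finally show ?thesis .
qed

context
  fixes z0 x :: "real^'n" and \<rho> L M :: real and Q :: "'n path measure"
  assumes Q: "solves_martingale_problem (normalized_field A) x Q"
    and short: "short_coarse_steps A \<kappa> (ball z0 \<rho>) L" and x: "x \<in> ball z0 \<rho>"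
    and M: "0 < M" "16 * real CARD('n) * (\<rho> + L)\<^sup>2 \<le> M\<^sup>2"
begin

lemma prob_Q: "prob_space Q" and sets_Q: "sets Q = sets path_space" and start_Q: "AE w in Q. w 0 = x"
  using Q by (auto simp: solves_martingale_problem_def)

lemma space_Q: "space Q = space path_space" by (rule sets_eq_imp_space_eq[OF sets_Q])

text \<open>\<open>short\<close> keeps the path within \<open>\<rho> + L\<close> of
  \<open>z0\<close> during the whole step, including its passage through the degenerate set, and
  \<open>M\<close> is so large that the generator is at most \<open>- 3 / M^2\<close> there.\<close>

lemma stopped_step_decrease:
  assumes t: "0 < t"
  defines "\<tau> w \<equiv> enn2real (min (step_time A \<kappa> w) (ennreal t))"
  shows "(LINT w|Q. bump z0 M (w (\<tau> w))) + 3 / M\<^sup>2 * (LINT w|Q. \<tau> w) \<le> bump z0 M x"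
  unfolding \<tau>_def
proof (rule dynkin(3)[OF Q M(1) stopping_time_step_time t])
  show "AE w in Q. \<forall>s. 0 \<le> s \<longrightarrow> s \<le> enn2real (min (step_time A \<kappa> w) (ennreal t)) \<longrightarrow>
      normalized_field A (w s) \<bullet> bump_hessian z0 M (w s) \<le> - (3 / M\<^sup>2)"
    using start_Q AE_space
  proof eventually_elim
    case (elim w)
    have w: "w \<in> space path_space" "w 0 \<in> ball z0 \<rho>" using elim x space_Q by auto
    show ?case
    proof (intro allI impI)
      fix s assume s: "0 \<le> s" "s \<le> enn2real (min (step_time A \<kappa> w) (ennreal t))"
      have "ennreal s \<le> ennreal (enn2real (min (step_time A \<kappa> w) (ennreal t)))" using s by (intro ennreal_leI)
      also have "\<dots> = min (step_time A \<kappa> w) (ennreal t)" by (rule ennreal_enn2real) (auto simp: min_less_iff_disj)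
      finally have "ennreal s \<le> step_time A \<kappa> w" by simp
      then have "dist (w 0) (w s) \<le> L" using short w s unfolding short_coarse_steps_def by blast
      then have "norm (w s - z0) \<le> \<rho> + L"
        using w(2) dist_triangle[of z0 "w s" "w 0"] by (simp add: dist_norm norm_minus_commute)
      then have "(norm (w s - z0))\<^sup>2 \<le> (\<rho> + L)\<^sup>2" by (intro power_mono) auto
      then have "16 * real CARD('n) * ((w s - z0) \<bullet> (w s - z0)) \<le> 16 * real CARD('n) * (\<rho> + L)\<^sup>2"
        unfolding power2_norm_eq_inner by (intro mult_left_mono) auto
      then show "normalized_field A (w s) \<bullet> bump_hessian z0 M (w s) \<le> - (3 / M\<^sup>2)"
        by (intro generator_bump_upper[OF coefficient_bounds(4,1,2,3) dimension_ge_1 M(1)] order_trans[OF _ M(2)])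
    qed
  qed
qed

text \<open>As the bump lies between 0 and 1, its decrease bounds the mean of the step time
  truncated at \<open>t\<close> by \<open>M^2 / 3\<close> for every \<open>t\<close>; on a path with
  an infinite step the truncated time is \<open>t\<close> itself.\<close>

lemma AE_step_time_finite: "AE w in Q. step_time A \<kappa> w < \<infinity>"
proof -
  interpret prob_space Q by (rule prob_Q)
  define E where "E = {w \<in> space Q. step_time A \<kappa> w = \<infinity>}"
  have SQ: "step_time A \<kappa> \<in> borel_measurable Q"
    by (subst measurable_cong_sets[OF sets_Q refl]) (rule measurable_step_time)
  then have E: "E \<in> sets Q" unfolding E_def by measurable
  have "real (Suc n) * prob E \<le> M\<^sup>2 / 3" for n
  proof -
    let ?t = "real (Suc n)"
    let ?\<tau> = "\<lambda>w. enn2real (min (step_time A \<kappa> w) (ennreal ?t))"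
    have int: "integrable Q ?\<tau>" by (rule integrable_min_stopping_time[OF Q stopping_time_step_time]) simp
    have "?t * prob E = (LINT w|Q. ?t * indicator E w)" using E by simp
    also have "\<dots> \<le> (LINT w|Q. ?\<tau> w)"
    proof (rule integral_mono)
      show "integrable Q (\<lambda>w. ?t * indicator E w)"
        using E by (intro integrable_mult_right integrable_real_indicator) (auto simp: emeasure_eq_measure)
      show "?t * indicator E w \<le> ?\<tau> w" if "w \<in> space Q" for w
        by (auto simp: indicator_def E_def simp del: of_nat_Suc)
    qed (rule int)
    also have "\<dots> \<le> M\<^sup>2 / 3"
    proof -
      have "0 \<le> (LINT w|Q. bump z0 M (w (?\<tau> w)))" by (intro integral_nonneg_AE) (simp add: bump_bounds)
      then have "3 / M\<^sup>2 * (LINT w|Q. ?\<tau> w) \<le> 1"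
        using stopped_step_decrease[of ?t] bump_bounds(2)[of z0 M x] by (simp del: of_nat_Suc)
      then show ?thesis using M by (simp add: field_simps)
    qed
    finally show ?thesis .
  qed
  note bound = this
  have "prob E = 0"
  proof (rule ccontr)
    assume "prob E \<noteq> 0"
    then have p: "0 < prob E" by (simp add: zero_less_measure_iff)
    obtain n where "M\<^sup>2 / 3 / prob E < real n" using reals_Archimedean2 by blast
    then have "M\<^sup>2 / 3 < real n * prob E" using p by (simp add: field_simps)
    also have "\<dots> \<le> real (Suc n) * prob E" using p by (intro mult_right_mono) auto
    finally show False using bound[of n] by simp
  qed
  then have "AE w in Q. w \<notin> E" using E by (simp add: prob_eq_0)
  then show ?thesis using AE_space by eventually_elim (auto simp: E_def less_top)
qed

text \<open>The truncated inequality with mean duration at least \<open>1/20\<close>, as the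
  truncation is removed; since the step is finite, the truncated values are eventually constant on
  almost every path.\<close>

lemma step_decrease:
  "(LINT w|Q. bump z0 M (w (enn2real (step_time A \<kappa> w)))) + 3 / (20 * M\<^sup>2) \<le> bump z0 M x"
proof -
  interpret prob_space Q by (rule prob_Q)
  let ?\<tau> = "\<lambda>n w. enn2real (min (step_time A \<kappa> w) (ennreal (real (Suc n))))"
  have SQ: "step_time A \<kappa> \<in> borel_measurable Q"
    by (subst measurable_cong_sets[OF sets_Q refl]) (rule measurable_step_time)
  have id: "(\<lambda>w. w) \<in> measurable Q path_space" using sets_Q by (simp add: measurable_ident_sets)
  have bump_meas: "bump z0 M \<in> borel_measurable borel"
    unfolding bump_def by (intro borel_measurable_continuous_onI continuous_intros continuous_bump_base)
  have meas: "(\<lambda>w. bump z0 M (w (enn2real (step_time A \<kappa> w)))) \<in> borel_measurable Q"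
    by (rule measurable_compose[OF measurable_eval_random[OF _ _ id] bump_meas]) (use SQ in auto)
  have int: "integrable Q (?\<tau> n)" "integrable Q (\<lambda>w. bump z0 M (w (?\<tau> n w)))" for n
    by (rule dynkin(2)[OF Q M(1) stopping_time_step_time] dynkin(1)[OF Q M(1) stopping_time_step_time], simp)+
  have "(LINT w|Q. bump z0 M (w (?\<tau> n w))) \<le> bump z0 M x - 3 / (20 * M\<^sup>2)" for n
  proof -
    have "1 / 20 \<le> (LINT w|Q. ?\<tau> 0 w)" using expected_step_time_lower[OF Q] by simp
    also have "\<dots> \<le> (LINT w|Q. ?\<tau> n w)"
      by (intro integral_mono int enn2real_mono min.mono ennreal_leI) (auto simp: min_less_iff_disj)
    finally have "3 / M\<^sup>2 * (1 / 20) \<le> 3 / M\<^sup>2 * (LINT w|Q. ?\<tau> n w)" by (intro mult_left_mono) auto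
    moreover have "3 / M\<^sup>2 * (1 / 20) = 3 / (20 * M\<^sup>2)" by simp
    ultimately show ?thesis using stopped_step_decrease[of "real (Suc n)"] by (simp del: of_nat_Suc)
  qed
  moreover have "(\<lambda>n. LINT w|Q. bump z0 M (w (?\<tau> n w))) \<longlonglongrightarrow> (LINT w|Q. bump z0 M (w (enn2real (step_time A \<kappa> w))))"
  proof (rule integral_dominated_convergence[where w="\<lambda>_. 1"])
    show "AE w in Q. (\<lambda>n. bump z0 M (w (?\<tau> n w))) \<longlonglongrightarrow> bump z0 M (w (enn2real (step_time A \<kappa> w)))"
      using AE_step_time_finite
    proof eventually_elim
      case (elim w)
      then obtain s where s: "0 \<le> s" "step_time A \<kappa> w = ennreal s" by (cases "step_time A \<kappa> w") auto
      have "eventually (\<lambda>n. s \<le> real (Suc n)) sequentially"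
        using eventually_ge_at_top[of "nat \<lceil>s\<rceil>"] by eventually_elim linarith
      then have "eventually (\<lambda>n. bump z0 M (w (?\<tau> n w)) = bump z0 M (w (enn2real (step_time A \<kappa> w)))) sequentially"
        by eventually_elim (simp add: s min_absorb1 ennreal_leI del: of_nat_Suc)
      then show ?case by (rule tendsto_eventually)
    qed
  qed (use meas int(2)[THEN borel_measurable_integrable] in \<open>auto simp: abs_of_nonneg[OF bump_bounds(1)] bump_bounds\<close>)
  ultimately have "(LINT w|Q. bump z0 M (w (enn2real (step_time A \<kappa> w)))) \<le> bump z0 M x - 3 / (20 * M\<^sup>2)"
    by (intro LIMSEQ_le_const2) auto
  then show ?thesis by simp
qed

end

end

section \<open>The Green measure of the killed coarse chain\<close>

locale killed_coarse_chain =
  fixes A :: "('n::finite) matrix_field" and \<kappa> :: real and Q :: "real^'n \<Rightarrow> 'n path measure"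
    and z0 :: "real^'n" and \<rho> L M :: real
  assumes A: "positive_definite_field A"
    and diffusion: "diffusion (normalized_field A) Q"
    and short: "short_coarse_steps A \<kappa> (ball z0 \<rho>) L"
    and M: "0 < M" "16 * real CARD('n) * (\<rho> + L)\<^sup>2 \<le> M\<^sup>2"
begin

abbreviation "D \<equiv> ball z0 \<rho>"
abbreviation "S \<equiv> step_time A \<kappa>"
abbreviation "K \<equiv> coarse_kernel A Q \<kappa>"

text \<open>One coarse step as a self-map of path space: the chain becomes
  \<open>(\<theta> ^^ n) w 0\<close> and the strong Markov property is used one step at a time. On
  an infinite step it is the shift by 0.\<close>

definition \<theta> :: "'n path \<Rightarrow> 'n path" where
  "\<theta> w = shift_path (enn2real (S w)) w"

lemma Q_measurable: "Q \<in> measurable borel (prob_algebra path_space)"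
  and martingale_problem: "solves_martingale_problem (normalized_field A) x (Q x)"
  using diffusion by (auto simp: diffusion_def)

lemma prob_Q: "prob_space (Q x)" and sets_Q: "sets (Q x) = sets path_space" and start_Q: "AE w in Q x. w 0 = x"
  using martingale_problem[of x] by (auto simp: solves_martingale_problem_def)

lemma space_Q: "space (Q x) = space path_space" by (rule sets_eq_imp_space_eq[OF sets_Q])

lemma measurable_Q: "measurable (Q x) N = measurable path_space N"
  by (rule measurable_cong_sets[OF sets_Q refl])

lemma S_measurable: "S \<in> borel_measurable path_space" by (rule measurable_step_time[OF A])

lemma \<theta>_measurable: "\<theta> \<in> measurable path_space path_space"
  unfolding \<theta>_def using S_measurable by (intro measurable_shift_path) auto

lemma \<theta>_0: "\<theta> w 0 = w (enn2real (S w))" by (simp add: \<theta>_def)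

lemma start_measurable: "(\<lambda>w. w 0) \<in> borel_measurable (path_space :: 'n path measure)" by (rule measurable_eval) simp

lemma \<theta>_0_measurable: "(\<lambda>w. \<theta> w 0) \<in> borel_measurable path_space"
  by (rule measurable_compose[OF \<theta>_measurable start_measurable])

lemma coarse_kernel_eq: "K x = distr (Q x) borel (\<lambda>w. \<theta> w 0)"
  by (simp add: coarse_kernel_def \<theta>_0)

lemma prob_K: "prob_space (K x)"
  unfolding coarse_kernel_eq using \<theta>_0_measurable
  by (intro prob_space.prob_space_distr[OF prob_Q]) (simp add: measurable_Q)

lemma sets_K [simp]: "sets (K x) = sets borel" by (simp add: coarse_kernel_eq)

lemma nn_integral_K:
  assumes "f \<in> borel_measurable borel"
  shows "(\<integral>\<^sup>+y. f y \<partial>K x) = (\<integral>\<^sup>+w. f (\<theta> w 0) \<partial>Q x)"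
  unfolding coarse_kernel_eq using \<theta>_0_measurable assms by (intro nn_integral_distr) (simp_all add: measurable_Q)

lemma nn_integral_Q_measurable:
  assumes "f \<in> borel_measurable path_space"
  shows "(\<lambda>x. \<integral>\<^sup>+w. f w \<partial>Q x) \<in> borel_measurable borel"
  by (rule measurable_compose[OF measurable_prob_algebraD[OF Q_measurable] nn_integral_measurable_subprob_algebra[OF assms]])

lemma nn_integral_K_measurable:
  assumes "f \<in> borel_measurable borel"
  shows "(\<lambda>x. \<integral>\<^sup>+y. f y \<partial>K x) \<in> borel_measurable borel"
  unfolding nn_integral_K[OF assms]
  by (intro nn_integral_Q_measurable measurable_compose[OF \<theta>_0_measurable assms])

lemma AE_S_finite: "x \<in> D \<Longrightarrow> AE w in Q x. S w < \<infinity>"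
  by (rule AE_step_time_finite[OF A martingale_problem short _ M])

lemma nn_integral_bump_K:
  assumes x: "x \<in> D"
  shows "(\<integral>\<^sup>+y. ennreal (bump z0 M y) \<partial>K x) + ennreal (3 / (20 * M\<^sup>2)) \<le> ennreal (bump z0 M x)"
proof -
  interpret prob_space "Q x" by (rule prob_Q)
  have bump_meas: "bump z0 M \<in> borel_measurable borel"
    unfolding bump_def by (intro borel_measurable_continuous_onI continuous_intros continuous_bump_base)
  have "(\<lambda>w. bump z0 M (\<theta> w 0)) \<in> borel_measurable (Q x)"
    unfolding measurable_Q by (rule measurable_compose[OF \<theta>_0_measurable bump_meas])
  then have int: "integrable (Q x) (\<lambda>w. bump z0 M (\<theta> w 0))"
    by (intro integrable_const_bound[of _ 1]) (simp_all add: abs_of_nonneg[OF bump_bounds(1)] bump_bounds)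
  have "(\<integral>\<^sup>+y. ennreal (bump z0 M y) \<partial>K x) = ennreal (LINT w|Q x. bump z0 M (\<theta> w 0))"
    using bump_meas by (simp add: nn_integral_K nn_integral_eq_integral[OF int] bump_bounds)
  then show ?thesis
    using step_decrease[OF A martingale_problem short x M] integral_nonneg_AE[of "\<lambda>w. bump z0 M (\<theta> w 0)" "Q x"]
    by (simp add: \<theta>_0 bump_bounds ennreal_plus[symmetric] ennreal_leI del: ennreal_plus)
qed

text \<open>\<open>diffusion\<close> states the property for events. With the step as stopping time
  and the whole space as past event it identifies the law of \<open>\<theta>\<close> with
  \<open>K x \<bind> Q\<close>. Starting in \<open>D\<close> makes the step almost surely
  finite.\<close>

lemma strong_markov:
  assumes x: "x \<in> D" and f: "f \<in> borel_measurable path_space"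
  shows "(\<integral>\<^sup>+w. f (\<theta> w) \<partial>Q x) = (\<integral>\<^sup>+y. (\<integral>\<^sup>+w. f w \<partial>Q y) \<partial>K x)"
proof -
  have QK: "Q \<in> measurable (K x) (subprob_algebra path_space)"
    using measurable_prob_algebraD[OF Q_measurable] measurable_cong_sets[OF sets_K refl] by blast
  have ne: "space (K x) \<noteq> {}" by (simp add: coarse_kernel_eq)
  have \<theta>Q: "\<theta> \<in> measurable (Q x) path_space" using \<theta>_measurable by (simp add: measurable_Q)
  have "distr (Q x) path_space \<theta> = K x \<bind> Q"
  proof (rule measure_eqI)
    show "sets (distr (Q x) path_space \<theta>) = sets (K x \<bind> Q)"
      using sets_bind[of "K x" Q path_space] ne by (simp add: sets_Q)
    fix \<Gamma> assume "\<Gamma> \<in> sets (distr (Q x) path_space \<theta>)"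
    then have \<Gamma>: "\<Gamma> \<in> sets path_space" by simp
    interpret filt: filtration "space (path_space :: 'n path measure)" natural_filtration by (rule filtration_natural)
    let ?E = "{w \<in> space path_space. S w < \<infinity> \<and> shift_path (enn2real (S w)) w \<in> \<Gamma>}"
    have "space path_space \<in> sets (filt.pre_sigma S)"
      using sets.top[of "filt.pre_sigma S"] by (simp add: filt.space_pre_sigma)
    then have "emeasure (Q x) ?E =
        (\<integral>\<^sup>+w. emeasure (Q (w (enn2real (S w)))) \<Gamma> * indicator {w \<in> space path_space. S w < \<infinity>} w \<partial>Q x)"
      using diffusion \<Gamma> stopping_time_step_time[OF A] unfolding diffusion_def by blast
    also have "\<dots> = (\<integral>\<^sup>+w. emeasure (Q (\<theta> w 0)) \<Gamma> \<partial>Q x)"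
    proof (rule nn_integral_cong_AE)
      show "AE w in Q x. emeasure (Q (w (enn2real (S w)))) \<Gamma> * indicator {w \<in> space path_space. S w < \<infinity>} w = emeasure (Q (\<theta> w 0)) \<Gamma>"
        using AE_S_finite[OF x] AE_space by eventually_elim (simp add: \<theta>_0 space_Q)
    qed
    also have "\<dots> = (\<integral>\<^sup>+y. emeasure (Q y) \<Gamma> \<partial>K x)"
      using measurable_compose[OF measurable_prob_algebraD[OF Q_measurable] measurable_emeasure_subprob_algebra[OF \<Gamma>]]
      by (intro nn_integral_K[symmetric])
    also have "\<dots> = emeasure (K x \<bind> Q) \<Gamma>"
      by (rule emeasure_bind[OF ne QK \<Gamma>, symmetric])
    finally have "emeasure (Q x) ?E = emeasure (K x \<bind> Q) \<Gamma>" .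
    moreover have "emeasure (distr (Q x) path_space \<theta>) \<Gamma> = emeasure (Q x) ?E"
    proof -
      have "emeasure (distr (Q x) path_space \<theta>) \<Gamma> = emeasure (Q x) (\<theta> -` \<Gamma> \<inter> space (Q x))"
        by (rule emeasure_distr[OF \<theta>Q \<Gamma>])
      also have "\<dots> = emeasure (Q x) ?E"
      proof (rule emeasure_eq_AE)
        show "AE w in Q x. w \<in> \<theta> -` \<Gamma> \<inter> space (Q x) \<longleftrightarrow> w \<in> ?E"
          using AE_S_finite[OF x] AE_space by eventually_elim (simp add: \<theta>_def space_Q)
        show "\<theta> -` \<Gamma> \<inter> space (Q x) \<in> sets (Q x)" by (rule measurable_sets[OF \<theta>Q \<Gamma>])
        have "{w \<in> space path_space. S w < \<infinity>} \<in> sets path_space"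
          using S_measurable by measurable
        then have "{w \<in> space path_space. S w < \<infinity>} \<inter> (\<theta> -` \<Gamma> \<inter> space path_space) \<in> sets path_space"
          using measurable_sets[OF \<theta>_measurable \<Gamma>] by blast
        also have "{w \<in> space path_space. S w < \<infinity>} \<inter> (\<theta> -` \<Gamma> \<inter> space path_space) = ?E"
          by (auto simp: \<theta>_def)
        finally show "?E \<in> sets (Q x)" by (simp add: sets_Q)
      qed
      finally show ?thesis .
    qed
    ultimately show "emeasure (distr (Q x) path_space \<theta>) \<Gamma> = emeasure (K x \<bind> Q) \<Gamma>" by simp
  qed
  note eq = this
  have "(\<integral>\<^sup>+w. f (\<theta> w) \<partial>Q x) = (\<integral>\<^sup>+w. f w \<partial>distr (Q x) path_space \<theta>)"
    using f by (intro nn_integral_distr[OF \<theta>Q, symmetric]) simp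
  also have "\<dots> = (\<integral>\<^sup>+w. f w \<partial>(K x \<bind> Q))" by (simp only: eq)
  also have "\<dots> = (\<integral>\<^sup>+y. (\<integral>\<^sup>+w. f w \<partial>Q y) \<partial>K x)"
    by (rule nn_integral_bind[OF f QK])
  finally show ?thesis .
qed

lemma strong_markov_killed:
  assumes f: "f \<in> borel_measurable path_space"
  shows "(\<integral>\<^sup>+w. (if w 0 \<in> D then f (\<theta> w) else 0) \<partial>Q x) = (if x \<in> D then \<integral>\<^sup>+y. (\<integral>\<^sup>+w. f w \<partial>Q y) \<partial>K x else 0)"
proof -
  have "(\<integral>\<^sup>+w. (if w 0 \<in> D then f (\<theta> w) else 0) \<partial>Q x) = (\<integral>\<^sup>+w. (if x \<in> D then f (\<theta> w) else 0) \<partial>Q x)"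
    by (rule nn_integral_cong_AE) (use start_Q[of x] in eventually_elim, simp)
  then show ?thesis using strong_markov[OF _ f] by simp
qed

section \<open>The killed chain and its expected occupation\<close>

lemma \<theta>_funpow_measurable: "(\<theta> ^^ n) \<in> measurable path_space path_space"
  by (induction n) (auto intro: measurable_compose[OF _ \<theta>_measurable])

definition alive :: "nat \<Rightarrow> 'n path \<Rightarrow> bool" where
  "alive n w \<longleftrightarrow> (\<forall>m\<le>n. (\<theta> ^^ m) w 0 \<in> D)"

lemma alive_0: "alive 0 w \<longleftrightarrow> w 0 \<in> D" by (simp add: alive_def)

text \<open>The first step is split off rather than the last, to match the strong Markov property at
  the end of the first step.\<close>

lemma alive_Suc: "alive (Suc n) w \<longleftrightarrow> w 0 \<in> D \<and> alive n (\<theta> w)"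
proof -
  have "alive (Suc n) w \<longleftrightarrow> (\<forall>m\<in>{..Suc n}. (\<theta> ^^ m) w 0 \<in> D)" by (auto simp: alive_def)
  also have "{..Suc n} = insert 0 (Suc ` {..n})" by (rule atMost_Suc_eq_insert_0)
  finally show ?thesis by (auto simp: alive_def funpow_swap1)
qed

lemma alive_measurable: "Measurable.pred path_space (alive n)"
proof -
  have "(\<lambda>w. (\<theta> ^^ m) w 0) \<in> borel_measurable path_space" for m
    by (rule measurable_compose[OF \<theta>_funpow_measurable start_measurable])
  then have "Measurable.pred path_space (\<lambda>w. (\<theta> ^^ m) w 0 \<in> D)" for m
    by (intro pred_sets2[of D borel]) auto
  then show ?thesis unfolding alive_def by (intro pred_intros_countable pred_intros_logic) (auto simp: pred_def)
qed

definition occupation :: "(real^'n \<Rightarrow> ennreal) \<Rightarrow> nat \<Rightarrow> 'n path \<Rightarrow> ennreal" where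
  "occupation f n w = (if alive n w then f ((\<theta> ^^ n) w 0) else 0)"

lemma occupation_0: "occupation f 0 w = (if w 0 \<in> D then f (w 0) else 0)"
  by (simp add: occupation_def alive_0)

lemma occupation_Suc: "occupation f (Suc n) w = (if w 0 \<in> D then occupation f n (\<theta> w) else 0)"
  by (simp add: occupation_def alive_Suc funpow_swap1)

lemma occupation_measurable:
  assumes "f \<in> borel_measurable borel"
  shows "occupation f n \<in> borel_measurable path_space"
  unfolding occupation_def
  by (intro measurable_If measurable_compose[OF measurable_compose[OF \<theta>_funpow_measurable start_measurable] assms]
      alive_measurable[unfolded pred_def]) auto

text \<open>The \<open>n\<close>-th iterate of the kernel killed outside \<open>D\<close>, applied
  to \<open>f\<close>; survival is required up to and including time \<open>n\<close>.\<close>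

definition P :: "(real^'n \<Rightarrow> ennreal) \<Rightarrow> nat \<Rightarrow> real^'n \<Rightarrow> ennreal" where
  "P f n x = (\<integral>\<^sup>+w. occupation f n w \<partial>Q x)"

lemma P_measurable: "f \<in> borel_measurable borel \<Longrightarrow> P f n \<in> borel_measurable borel"
  unfolding P_def by (intro nn_integral_Q_measurable occupation_measurable)

lemma P_0: "P f 0 x = (if x \<in> D then f x else 0)"
proof -
  interpret prob_space "Q x" by (rule prob_Q)
  have "P f 0 x = (\<integral>\<^sup>+w. (if x \<in> D then f x else 0) \<partial>Q x)"
    unfolding P_def occupation_0 by (rule nn_integral_cong_AE) (use start_Q[of x] in eventually_elim, simp)
  then show ?thesis by (simp add: emeasure_space_1)
qed

lemma P_Suc:
  assumes "f \<in> borel_measurable borel"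
  shows "P f (Suc n) x = (if x \<in> D then \<integral>\<^sup>+y. P f n y \<partial>K x else 0)"
  unfolding P_def occupation_Suc by (rule strong_markov_killed[OF occupation_measurable[OF assms]])

text \<open>Splits off the last step, where \<open>P_Suc\<close> splits off the first. That last
  step is not killed, but this makes no difference to a function vanishing outside
  \<open>D\<close>.\<close>

lemma P_K:
  assumes f: "f \<in> borel_measurable borel" and supp: "\<And>y. y \<notin> D \<Longrightarrow> f y = 0"
  shows "P (\<lambda>x. \<integral>\<^sup>+y. f y \<partial>K x) n x = P f (Suc n) x"
proof (induction n arbitrary: x)
  case 0
  have "P f 0 = f" using supp by (auto simp: P_0 fun_eq_iff)
  then show ?case by (simp add: P_0 P_Suc[OF f])
next
  case (Suc n)
  have "P (\<lambda>x. \<integral>\<^sup>+y. f y \<partial>K x) n = P f (Suc n)" by (rule ext) (rule Suc.IH)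
  then show ?case
    by (subst P_Suc[OF nn_integral_K_measurable[OF f]], subst P_Suc[OF f]) simp
qed

text \<open>The multiple \<open>V\<close> of the bump on the right satisfies
  \<open>K V + 1 \<le> V\<close> on \<open>D\<close>, so by induction it dominates every partial sum
  of survival probabilities. Partial sums keep finiteness of the total out of the argument.\<close>

lemma sum_P_le:
  "(\<Sum>n<k. P (\<lambda>_. 1) n x) \<le> ennreal (20 * M\<^sup>2 / 3) * ennreal (bump z0 M x)"
proof (induction k arbitrary: x)
  case (Suc k)
  let ?C = "20 * M\<^sup>2 / 3"
  have C: "0 < ?C" using M by simp
  show ?case
  proof (cases "x \<in> D")
    case True
    have "(\<Sum>n<Suc k. P (\<lambda>_. 1) n x) = P (\<lambda>_. 1) 0 x + (\<Sum>n<k. P (\<lambda>_. 1) (Suc n) x)"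
      by (rule sum.lessThan_Suc_shift)
    also have "\<dots> = 1 + (\<Sum>n<k. \<integral>\<^sup>+y. P (\<lambda>_. 1) n y \<partial>K x)"
      using True by (simp add: P_0 P_Suc)
    also have "(\<Sum>n<k. \<integral>\<^sup>+y. P (\<lambda>_. 1) n y \<partial>K x) = (\<integral>\<^sup>+y. (\<Sum>n<k. P (\<lambda>_. 1) n y) \<partial>K x)"
      using P_measurable[of "\<lambda>_. 1"] measurable_cong_sets[OF sets_K refl]
      by (intro nn_integral_sum[symmetric]) auto
    also have "\<dots> \<le> (\<integral>\<^sup>+y. ennreal ?C * ennreal (bump z0 M y) \<partial>K x)"
      by (intro nn_integral_mono Suc.IH)
    also have "\<dots> = ennreal ?C * (\<integral>\<^sup>+y. ennreal (bump z0 M y) \<partial>K x)"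
    proof (rule nn_integral_cmult)
      have "bump z0 M \<in> borel_measurable borel"
        unfolding bump_def by (intro borel_measurable_continuous_onI continuous_intros continuous_bump_base)
      then show "(\<lambda>y. ennreal (bump z0 M y)) \<in> borel_measurable (K x)"
        by (subst measurable_cong_sets[OF sets_K refl]) simp
    qed
    finally have le: "(\<Sum>n<Suc k. P (\<lambda>_. 1) n x) \<le> 1 + ennreal ?C * (\<integral>\<^sup>+y. ennreal (bump z0 M y) \<partial>K x)"
      by (simp add: add_left_mono)
    have one: "ennreal ?C * ennreal (3 / (20 * M\<^sup>2)) = 1"
      using M C by (simp add: ennreal_mult'[symmetric])
    note le
    also have "1 + ennreal ?C * (\<integral>\<^sup>+y. ennreal (bump z0 M y) \<partial>K x) =
        ennreal ?C * ((\<integral>\<^sup>+y. ennreal (bump z0 M y) \<partial>K x) + ennreal (3 / (20 * M\<^sup>2)))"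
      unfolding distrib_left one by (rule add.commute)
    also have "\<dots> \<le> ennreal ?C * ennreal (bump z0 M x)"
      by (intro mult_left_mono nn_integral_bump_K True) auto
    finally show ?thesis .
  next
    case False
    then have "P (\<lambda>_. 1) n x = 0" for n by (cases n) (simp_all add: P_0 P_Suc)
    then show ?thesis by simp
  qed
qed simp

text \<open>Counting measure times path law, restricted to surviving pairs and pushed forward: a
  measure by construction, whereas \<open>green_measure\<close> is generated from a set function.
  They are identified in \<open>green_measure_eq\<close>.\<close>

definition green :: "real^'n \<Rightarrow> (real^'n) measure" where
  "green x = distr (density (count_space UNIV \<Otimes>\<^sub>M Q x) (\<lambda>(n, w). if alive n w then 1 else 0)) borel (\<lambda>(n, w). (\<theta> ^^ n) w 0)"

lemma sets_green [simp]: "sets (green x) = sets borel" and space_green [simp]: "space (green x) = UNIV"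
  by (simp_all add: green_def)

lemma nn_integral_green:
  assumes f: "f \<in> borel_measurable borel"
  shows "(\<integral>\<^sup>+y. f y \<partial>green x) = (\<Sum>n. P f n x)"
proof -
  interpret prob_space "Q x" by (rule prob_Q)
  let ?N = "count_space UNIV \<Otimes>\<^sub>M Q x"
  have chain: "(\<lambda>(n, w). (\<theta> ^^ n) w 0) \<in> borel_measurable ?N"
    unfolding measurable_split_conv
    by (rule measurable_pair_measure_countable1)
       (use measurable_compose[OF \<theta>_funpow_measurable start_measurable] in \<open>auto simp: measurable_Q\<close>)
  have alive: "(\<lambda>(n, w). if alive n w then 1 else 0 :: ennreal) \<in> borel_measurable ?N"
    unfolding measurable_split_conv
    by (rule measurable_pair_measure_countable1)
       (use alive_measurable in \<open>auto simp: measurable_Q pred_def intro!: measurable_If\<close>)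
  have occ: "(\<lambda>(n, w). occupation f n w) \<in> borel_measurable ?N"
    unfolding measurable_split_conv
    by (rule measurable_pair_measure_countable1)
       (use occupation_measurable[OF f] in \<open>auto simp: measurable_Q\<close>)
  have "(\<integral>\<^sup>+y. f y \<partial>green x) = (\<integral>\<^sup>+p. (case p of (n, w) \<Rightarrow> if alive n w then 1 else 0) * f (case p of (n, w) \<Rightarrow> (\<theta> ^^ n) w 0) \<partial>?N)"
    unfolding green_def using chain alive f
    by (subst nn_integral_distr) (auto intro!: nn_integral_density measurable_compose[OF chain])
  also have "\<dots> = (\<integral>\<^sup>+p. (case p of (n, w) \<Rightarrow> occupation f n w) \<partial>?N)"
    by (intro nn_integral_cong) (auto simp: occupation_def)
  also have "\<dots> = (\<integral>\<^sup>+n. (\<integral>\<^sup>+w. occupation f n w \<partial>Q x) \<partial>count_space UNIV)"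
    using nn_integral_fst[OF occ] by simp
  also have "\<dots> = (\<Sum>n. P f n x)" by (simp add: nn_integral_count_space_nat P_def)
  finally show ?thesis .
qed

lemma emeasure_green: "E \<in> sets borel \<Longrightarrow> emeasure (green x) E = (\<Sum>n. P (indicator E) n x)"
  using nn_integral_green[of "indicator E" x] nn_integral_indicator[of E "green x"] by simp

lemma emeasure_green_UNIV_le: "emeasure (green x) UNIV \<le> ennreal (20 * M\<^sup>2 / 3)"
proof -
  have "emeasure (green x) UNIV = (\<Sum>n. P (\<lambda>_. 1) n x)"
  proof -
    have "indicator UNIV = (\<lambda>_ :: real^'n. 1 :: ennreal)" by (simp add: fun_eq_iff)
    then show ?thesis by (simp add: emeasure_green)
  qed
  also have "\<dots> \<le> ennreal (20 * M\<^sup>2 / 3) * 1"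
  proof (intro suminf_le_const allI)
    fix k
    show "(\<Sum>n<k. P (\<lambda>_. 1) n x) \<le> ennreal (20 * M\<^sup>2 / 3) * 1"
      by (rule order_trans[OF sum_P_le mult_left_mono]) (auto simp: bump_bounds)
  qed simp
  finally show ?thesis by simp
qed

section \<open>Agreement with the coarse times of the definition\<close>

lemma enat_less_chain_exit_iff:
  "enat n < chain_exit A \<kappa> E w \<longleftrightarrow> (\<forall>m\<le>n. coarse_chain A \<kappa> m w \<in> E)"
proof
  assume less: "enat n < chain_exit A \<kappa> E w"
  show "\<forall>m\<le>n. coarse_chain A \<kappa> m w \<in> E"
  proof (intro allI impI, rule ccontr)
    fix m assume "m \<le> n" "coarse_chain A \<kappa> m w \<notin> E"
    then have "chain_exit A \<kappa> E w \<le> enat m" unfolding chain_exit_def by (intro INF_lower) auto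
    also have "\<dots> \<le> enat n" using \<open>m \<le> n\<close> by simp
    finally show False using less by simp
  qed
next
  assume "\<forall>m\<le>n. coarse_chain A \<kappa> m w \<in> E"
  then have "enat (Suc n) \<le> chain_exit A \<kappa> E w"
    unfolding chain_exit_def by (intro INF_greatest) (auto simp: not_le[symmetric] Suc_le_eq)
  then show "enat n < chain_exit A \<kappa> E w" by (rule less_le_trans[rotated]) simp
qed

text \<open>Almost surely no step fails to terminate before the chain is killed; on these paths the
  concatenated coarse times of the definition agree with the iterates of \<open>\<theta>\<close>.\<close>

lemma AE_steps_finite: "AE w in Q x. \<forall>n. alive n w \<longrightarrow> S ((\<theta> ^^ n) w) < \<infinity>"
proof -
  define h where "h n w = (if alive n w \<and> S ((\<theta> ^^ n) w) = \<infinity> then 1 else 0 :: ennreal)" for n w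
  have SPn: "(\<lambda>w. S ((\<theta> ^^ n) w)) \<in> borel_measurable path_space" for n
    by (rule measurable_compose[OF \<theta>_funpow_measurable S_measurable])
  have meas: "h n \<in> borel_measurable path_space" for n
  proof -
    have "Measurable.pred path_space (\<lambda>w. S ((\<theta> ^^ n) w) = \<infinity>)" using SPn by measurable
    then show ?thesis unfolding h_def using alive_measurable[of n]
      by (intro measurable_If pred_intros_logic[unfolded pred_def]) (auto simp: pred_def)
  qed
  have "(\<integral>\<^sup>+w. h n w \<partial>Q x) = 0" for n x
  proof (induction n arbitrary: x)
    case 0
    show ?case
    proof (subst nn_integral_0_iff_AE)
      show "h 0 \<in> borel_measurable (Q x)" using meas by (simp add: measurable_Q)
      show "AE w in Q x. h 0 w = 0"
      proof (cases "x \<in> D")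
        case True
        show ?thesis using AE_S_finite[OF True] by eventually_elim (simp add: h_def less_top)
      next
        case False
        show ?thesis using start_Q[of x] by eventually_elim (use False in \<open>simp add: h_def alive_0\<close>)
      qed
    qed
  next
    case (Suc n)
    have "h (Suc n) w = (if w 0 \<in> D then h n (\<theta> w) else 0)" for w
      by (simp add: h_def alive_Suc funpow_swap1)
    then show ?case using strong_markov_killed[OF meas[of n], of x] Suc by simp
  qed
  note zero = this
  have "AE w in Q x. h n w = 0" for n
  proof -
    have "h n \<in> borel_measurable (Q x)" using meas by (simp add: measurable_Q)
    from nn_integral_0_iff_AE[OF this] show ?thesis using zero by simp
  qed
  then have "AE w in Q x. \<forall>n. h n w = 0" by (simp add: AE_all_countable)
  then show ?thesis by eventually_elim (auto simp: h_def less_top split: if_splits)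
qed

text \<open>Survival is required strictly before \<open>n\<close> only: the formula must still hold
  at the first index where the chain is outside \<open>D\<close>, so that both descriptions are
  killed at the same time.\<close>

lemma coarse_chain_eq:
  assumes w: "w \<in> space path_space" and fin: "\<forall>n. alive n w \<longrightarrow> S ((\<theta> ^^ n) w) < \<infinity>"
    and before: "\<forall>m<n. (\<theta> ^^ m) w 0 \<in> D"
  shows "coarse_time A \<kappa> n w < \<infinity>" "shift_path (enn2real (coarse_time A \<kappa> n w)) w = (\<theta> ^^ n) w"
proof -
  have "coarse_time A \<kappa> n w < \<infinity> \<and> shift_path (enn2real (coarse_time A \<kappa> n w)) w = (\<theta> ^^ n) w"
    using before
  proof (induction n)
    case 0
    have "shift_path 0 w = w"
      using w by (auto simp: shift_path_def space_path_space extensional_def restrict_def fun_eq_iff)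
    then show ?case by simp
  next
    case (Suc n)
    then have IH: "coarse_time A \<kappa> n w < \<infinity>" "shift_path (enn2real (coarse_time A \<kappa> n w)) w = (\<theta> ^^ n) w" by auto
    have "alive n w" using Suc.prems by (simp add: alive_def)
    then have S: "S ((\<theta> ^^ n) w) < \<infinity>" using fin by blast
    have "enn2real (coarse_time A \<kappa> (Suc n) w) = enn2real (coarse_time A \<kappa> n w) + enn2real (S ((\<theta> ^^ n) w))"
      using IH S by (simp add: enn2real_plus)
    then have "shift_path (enn2real (coarse_time A \<kappa> (Suc n) w)) w = \<theta> ((\<theta> ^^ n) w)"
      by (simp add: shift_path_add IH(2) \<theta>_def)
    then show ?case using IH S by (simp add: less_top)
  qed
  then show "coarse_time A \<kappa> n w < \<infinity>" "shift_path (enn2real (coarse_time A \<kappa> n w)) w = (\<theta> ^^ n) w" by auto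
qed

lemma killed_chain_eq_occupation:
  assumes w: "w \<in> space path_space" and fin: "\<forall>n. alive n w \<longrightarrow> S ((\<theta> ^^ n) w) < \<infinity>"
  shows "(if enat n < chain_exit A \<kappa> D w then f (coarse_chain A \<kappa> n w) else 0) = occupation f n w"
proof -
  have chain: "coarse_chain A \<kappa> n w = (\<theta> ^^ n) w 0" if "\<forall>m<n. (\<theta> ^^ m) w 0 \<in> D" for n
  proof -
    have "coarse_chain A \<kappa> n w = shift_path (enn2real (coarse_time A \<kappa> n w)) w 0"
      by (simp add: coarse_chain_def)
    then show ?thesis by (simp add: coarse_chain_eq(2)[OF w fin that])
  qed
  have "(\<forall>m\<le>n. coarse_chain A \<kappa> m w \<in> D) \<longleftrightarrow> alive n w" for n
  proof (induction n)
    case 0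
    then show ?case using chain[of 0] by (simp add: alive_0)
  next
    case (Suc n)
    have "(\<forall>m\<le>Suc n. coarse_chain A \<kappa> m w \<in> D) \<longleftrightarrow> alive n w \<and> coarse_chain A \<kappa> (Suc n) w \<in> D"
      unfolding Suc.IH[symmetric] by (auto simp: le_Suc_eq)
    also have "\<dots> \<longleftrightarrow> alive n w \<and> (\<theta> ^^ Suc n) w 0 \<in> D"
      using chain[of "Suc n"] by (auto simp: alive_def less_Suc_eq_le)
    also have "\<dots> \<longleftrightarrow> alive (Suc n) w" by (auto simp: alive_def le_Suc_eq)
    finally show ?case .
  qed
  then show ?thesis
    using chain[of n] by (auto simp: enat_less_chain_exit_iff occupation_def alive_def)
qed

text \<open>\<open>measure_of\<close> depends on its set function only through the values on the
  generated sigma-algebra, and there the defining expression agrees with a genuine measure.\<close>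

lemma green_measure_eq: "green_measure A Q \<kappa> D x = green x"
proof -
  have eq: "(\<integral>\<^sup>+w. (\<Sum>n. if enat n < chain_exit A \<kappa> D w then indicator E (coarse_chain A \<kappa> n w) else 0) \<partial>Q x) = emeasure (green x) E"
    if E: "E \<in> sets borel" for E
  proof -
    have "(\<integral>\<^sup>+w. (\<Sum>n. if enat n < chain_exit A \<kappa> D w then indicator E (coarse_chain A \<kappa> n w) else 0) \<partial>Q x) =
        (\<integral>\<^sup>+w. (\<Sum>n. occupation (indicator E) n w) \<partial>Q x)"
      by (rule nn_integral_cong_AE, use AE_steps_finite[of x] AE_space in eventually_elim)
         (simp only: killed_chain_eq_occupation space_Q)
    also have "\<dots> = (\<Sum>n. P (indicator E) n x)"
      unfolding P_def using E occupation_measurable[of "indicator E"]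
      by (intro nn_integral_suminf) (auto simp: measurable_Q)
    finally show ?thesis using E by (simp add: emeasure_green)
  qed
  have "green_measure A Q \<kappa> D x = measure_of UNIV (sets borel) (emeasure (green x))"
    unfolding green_measure_def
    by (rule measure_of_eq) (auto simp: eq sets.sigma_sets_eq[of borel, simplified])
  also have "\<dots> = green x"
    using measure_of_of_measure[of "green x"] by (simp add: green_def)
  finally show ?thesis .
qed

section \<open>The differential inequality for the Green measure\<close>

lemma green_finite: "emeasure (green x) E < \<infinity>"
proof -
  have "emeasure (green x) E \<le> emeasure (green x) (space (green x))" by (rule emeasure_space)
  also have "\<dots> \<le> ennreal (20 * M\<^sup>2 / 3)" using emeasure_green_UNIV_le by simp
  finally show ?thesis by (rule le_less_trans) simp
qed

lemma green_locally_finite: "locally_finite (green x)"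
  using green_finite by (simp add: locally_finite_def)

text \<open>By \<open>P_K\<close> the integral of \<open>K \<phi>\<close> is the series for
  \<open>\<phi>\<close> without its first term, hence at most the integral of \<open>\<phi>\<close>.
  The comparison is made for extended nonnegative integrals; as \<open>\<phi>\<close> is bounded and
  the measure finite, integrability of \<open>K \<phi>\<close> comes out of it.\<close>

lemma green_supersolution:
  assumes \<phi>: "C2_compact D \<phi>" "\<And>y. 0 \<le> \<phi> y"
  shows "integrable (green x) (coarse_generator A Q \<kappa> \<phi>)" "(LINT y|green x. coarse_generator A Q \<kappa> \<phi> y) \<le> 0"
proof -
  interpret green: finite_measure "green x" using green_finite[of x UNIV] by (intro finite_measureI) (simp add: less_top)
  obtain g where "\<And>y. (\<phi> has_derivative (\<lambda>h. g y \<bullet> h)) (at y)"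
    using \<phi>(1) by (auto simp: C2_compact_def has_gradient_hessian_def)
  then have cont: "continuous_on UNIV \<phi>"
    by (intro differentiable_imp_continuous_on) (auto simp: differentiable_on_def differentiable_def intro: has_derivative_at_withinI)
  then have meas: "\<phi> \<in> borel_measurable borel" by (rule borel_measurable_continuous_onI)
  have supp: "\<phi> y = 0" if "y \<notin> D" for y
    using \<phi>(1) that closure_subset[of "{x. \<phi> x \<noteq> 0}"] by (auto simp: C2_compact_def)
  have "compact (\<phi> ` closure {x. \<phi> x \<noteq> 0})"
    using \<phi>(1) by (intro compact_continuous_image continuous_on_subset[OF cont]) (auto simp: C2_compact_def)
  then have "bounded (\<phi> ` closure {x. \<phi> x \<noteq> 0})" by (rule compact_imp_bounded)
  then obtain b where b': "\<And>y. y \<in> closure {x. \<phi> x \<noteq> 0} \<Longrightarrow> \<bar>\<phi> y\<bar> \<le> b" by (auto simp: bounded_iff)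
  have b: "\<phi> y \<le> max b 0" for y
    using b'[of y] closure_subset[of "{x. \<phi> x \<noteq> 0}"] by (cases "\<phi> y = 0") auto
  define k where "k y = (LINT u|K y. \<phi> u)" for y
  have k_nonneg: "0 \<le> k y" for y unfolding k_def by (intro integral_nonneg_AE) (simp add: \<phi>)
  have k: "ennreal (k y) = (\<integral>\<^sup>+u. ennreal (\<phi> u) \<partial>K y)" for y
  proof -
    interpret prob_space "K y" by (rule prob_K)
    have "integrable (K y) \<phi>"
      using meas measurable_cong_sets[OF sets_K refl, of y borel] \<phi>(2) b
      by (intro integrable_const_bound[of _ "max b 0"]) auto
    then show ?thesis unfolding k_def using \<phi>(2) by (subst nn_integral_eq_integral) auto
  qed
  have k_meas: "k \<in> borel_measurable borel"
  proof -
    have "(\<lambda>y. enn2real (\<integral>\<^sup>+u. ennreal (\<phi> u) \<partial>K y)) \<in> borel_measurable borel"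
      using nn_integral_K_measurable[of "\<lambda>u. ennreal (\<phi> u)"] meas by simp
    also have "(\<lambda>y. enn2real (\<integral>\<^sup>+u. ennreal (\<phi> u) \<partial>K y)) = k" using k_nonneg by (simp add: k[symmetric])
    finally show ?thesis .
  qed
  have M1: "\<phi> \<in> borel_measurable (green x)" "k \<in> borel_measurable (green x)"
    using meas k_meas by (auto simp: measurable_cong_sets[OF sets_green refl])
  have int\<phi>: "integrable (green x) \<phi>"
    using M1 \<phi>(2) b by (intro green.integrable_const_bound[of _ "max b 0"]) auto
  have le: "(\<integral>\<^sup>+y. ennreal (k y) \<partial>green x) \<le> (\<integral>\<^sup>+y. ennreal (\<phi> y) \<partial>green x)"
  proof -
    have "(\<integral>\<^sup>+y. ennreal (k y) \<partial>green x) = (\<Sum>n. P (\<lambda>y. ennreal (k y)) n x)"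
      using k_meas by (intro nn_integral_green) simp
    also have "\<dots> = (\<Sum>n. P (\<lambda>y. ennreal (\<phi> y)) (Suc n) x)"
      unfolding k using meas supp by (subst P_K) auto
    also have "\<dots> \<le> P (\<lambda>y. ennreal (\<phi> y)) 0 x + (\<Sum>n. P (\<lambda>y. ennreal (\<phi> y)) (Suc n) x)" by simp
    also have "\<dots> = (\<Sum>n. P (\<lambda>y. ennreal (\<phi> y)) n x)"
      using suminf_offset[of "\<lambda>n. P (\<lambda>y. ennreal (\<phi> y)) n x" 1] by simp
    also have "\<dots> = (\<integral>\<^sup>+y. ennreal (\<phi> y) \<partial>green x)"
      using meas by (intro nn_integral_green[symmetric]) simp
    finally show ?thesis .
  qed
  also have "\<dots> = ennreal (LINT y|green x. \<phi> y)" using int\<phi> \<phi>(2) by (intro nn_integral_eq_integral) auto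
  finally have le': "(\<integral>\<^sup>+y. ennreal (k y) \<partial>green x) \<le> ennreal (LINT y|green x. \<phi> y)" .
  then have intk: "integrable (green x) k"
    using M1 k_nonneg by (intro integrableI_bounded) (auto simp: less_top intro: le_less_trans)
  have gen: "coarse_generator A Q \<kappa> \<phi> = (\<lambda>y. k y - \<phi> y)" by (simp add: coarse_generator_def k_def fun_eq_iff)
  show "integrable (green x) (coarse_generator A Q \<kappa> \<phi>)" unfolding gen using intk int\<phi> by simp
  have "ennreal (LINT y|green x. k y) \<le> ennreal (LINT y|green x. \<phi> y)"
    using le' nn_integral_eq_integral[OF intk] k_nonneg by simp
  then have "(LINT y|green x. k y) \<le> (LINT y|green x. \<phi> y)"
    using \<phi>(2) by (subst (asm) ennreal_le_iff) auto
  then show "(LINT y|green x. coarse_generator A Q \<kappa> \<phi> y) \<le> 0" unfolding gen using intk int\<phi> by simp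
qed

end

section \<open>The density bounds\<close>

text \<open>Young's inequality after normalizing both factors; where a norm vanishes and this is
  impossible, every term on the left is zero.\<close>

lemma weighted_Hoelder_sum:
  fixes a b w :: "'i \<Rightarrow> real" and p q :: real
  assumes fin: "finite J" and pq: "1 < p" "1 < q" "1 / p + 1 / q = 1"
    and nn: "\<And>i. i \<in> J \<Longrightarrow> 0 \<le> w i" "\<And>i. i \<in> J \<Longrightarrow> 0 \<le> a i" "\<And>i. i \<in> J \<Longrightarrow> 0 \<le> b i"
  shows "(\<Sum>i\<in>J. w i * a i * b i) \<le> (\<Sum>i\<in>J. w i * a i powr p) powr (1 / p) * (\<Sum>i\<in>J. w i * b i powr q) powr (1 / q)"
proof -
  define X where "X = (\<Sum>i\<in>J. w i * a i powr p)"
  define Y where "Y = (\<Sum>i\<in>J. w i * b i powr q)"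
  have X0: "0 \<le> X" and Y0: "0 \<le> Y" unfolding X_def Y_def using nn by (auto intro!: sum_nonneg)
  show ?thesis
  proof (cases "X = 0 \<or> Y = 0")
    case True
    have "w i * a i * b i = 0" if i: "i \<in> J" for i
    proof -
      have "w i * a i powr p = 0" if "X = 0"
        using that i nn unfolding X_def by (subst (asm) sum_nonneg_eq_0_iff[OF fin]) auto
      moreover have "w i * b i powr q = 0" if "Y = 0"
        using that i nn unfolding Y_def by (subst (asm) sum_nonneg_eq_0_iff[OF fin]) auto
      ultimately have "w i * a i powr p = 0 \<or> w i * b i powr q = 0" using True by blast
      then show ?thesis by auto
    qed
    then have "(\<Sum>i\<in>J. w i * a i * b i) = 0" by (intro sum.neutral ballI)
    then show ?thesis by simp
  next
    case False
    then have X: "0 < X" and Y: "0 < Y" using X0 Y0 by auto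
    define x where "x = X powr (1 / p)"
    define y where "y = Y powr (1 / q)"
    have x: "0 < x" "x powr p = X" using X pq by (auto simp: x_def powr_powr)
    have y: "0 < y" "y powr q = Y" using Y pq by (auto simp: y_def powr_powr)
    have "(\<Sum>i\<in>J. w i * a i * b i) = x * y * (\<Sum>i\<in>J. w i * ((a i / x) * (b i / y)))"
      using x y by (simp add: sum_distrib_left mult.assoc)
    also have "\<dots> \<le> x * y * (\<Sum>i\<in>J. w i * ((a i / x) powr p / p + (b i / y) powr q / q))"
      using x y nn pq by (intro mult_left_mono sum_mono Youngs_inequality) auto
    also have "(\<Sum>i\<in>J. w i * ((a i / x) powr p / p + (b i / y) powr q / q)) = X / X / p + Y / Y / q"
    proof -
      have "(\<Sum>i\<in>J. w i * ((a i / x) powr p / p + (b i / y) powr q / q)) = (\<Sum>i\<in>J. w i * a i powr p / X / p + w i * b i powr q / Y / q)"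
        using x y nn by (intro sum.cong refl) (simp add: powr_divide distrib_left)
      then show ?thesis by (simp add: X_def Y_def sum.distrib sum_divide_distrib[symmetric])
    qed
    also have "\<dots> = 1" using X Y pq by simp
    finally show ?thesis by (simp add: x_def y_def X_def Y_def)
  qed
qed

section \<open>Grid densities of finite measures\<close>

lemma fine_grid_eq: "0 < N \<Longrightarrow> fine_grid N = range (cube (1 / real N) :: int^'n \<Rightarrow> (real^'n) set)"
  by (simp add: fine_grid_def fine_cell_eq_cube)

lemma grid_density_eq:
  fixes \<nu> :: "(real^'n) measure"
  assumes N: "0 < N"
  shows "grid_density N \<nu> y = measure \<nu> (cube (1 / real N) (cube_index (1 / real N) y)) / (1 / real N) ^ CARD('n)"
proof -
  let ?Q = "cube (1 / real N) (cube_index (1 / real N) y)"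
  have "grid_density N \<nu> y = (\<Sum>\<^sub>\<infinity>Q\<in>{?Q}. measure \<nu> Q / measure lborel Q * indicator Q y)"
    unfolding grid_density_def fine_grid_eq[OF N]
    by (rule infsum_cong_neutral) (auto simp: mem_cube indicator_def split: if_splits)
  also have "\<dots> = measure \<nu> ?Q / measure lborel ?Q" by (simp add: mem_cube)
  finally show ?thesis using N by (simp add: measure_cube)
qed

lemma finite_cells_meeting_bounded:
  fixes U :: "(real^'n) set"
  assumes s: "0 < s" and U: "bounded U"
  shows "finite (cube_index s ` U)"
proof -
  obtain b where b: "\<And>y. y \<in> U \<Longrightarrow> norm y \<le> b" using U by (auto simp: bounded_iff)
  define I where "I = {\<lfloor>(- b + 1 / 2) / s\<rfloor>..\<lfloor>(b + 1 / 2) / s\<rfloor>}"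
  have "cube_index s y \<in> vec_lambda ` (\<Pi>\<^sub>E i\<in>(UNIV :: 'n set). I)" if "y \<in> U" for y
  proof (rule image_eqI[of _ _ "vec_nth (cube_index s y)"])
    have "\<bar>y $ i\<bar> \<le> b" for i using component_le_norm_cart[of y i] b[OF that] by simp
    then have "- b \<le> y $ i" "y $ i \<le> b" for i by (simp_all add: abs_le_iff minus_le_iff)
    then show "vec_nth (cube_index s y) \<in> (\<Pi>\<^sub>E i\<in>UNIV. I)"
      using s by (auto simp: cube_index_def I_def intro!: floor_mono divide_right_mono)
  qed simp
  then have "cube_index s ` U \<subseteq> vec_lambda ` (\<Pi>\<^sub>E i\<in>(UNIV :: 'n set). I)" by blast
  moreover have "finite (vec_lambda ` (\<Pi>\<^sub>E i\<in>(UNIV :: 'n set). I))"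
    by (intro finite_imageI finite_PiE) (auto simp: I_def)
  ultimately show ?thesis by (rule finite_subset)
qed

context
  fixes \<nu> :: "(real^'n) measure" and N :: nat and T :: real
  assumes \<nu>: "sets \<nu> = sets borel" and N: "0 < N" and T: "0 \<le> T" and mass: "emeasure \<nu> UNIV \<le> ennreal T"
begin

lemma side_pos: "0 < (1 / real N)" using N by simp

lemma finite_measure_\<nu>: "finite_measure \<nu>"
proof (rule finite_measureI)
  have "space \<nu> = UNIV" using sets_eq_imp_space_eq[OF \<nu>] by simp
  then show "emeasure \<nu> (space \<nu>) \<noteq> \<infinity>" using mass by (auto simp: top_unique)
qed

lemma measure_\<nu>_le: "measure \<nu> E \<le> T"
proof -
  interpret finite_measure \<nu> by (rule finite_measure_\<nu>)
  have sp: "space \<nu> = UNIV" using sets_eq_imp_space_eq[OF \<nu>] by simp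
  have "measure \<nu> E \<le> measure \<nu> UNIV" using bounded_measure[of E] sp by simp
  also have "\<dots> \<le> T" using mass T by (simp add: emeasure_eq_measure)
  finally show ?thesis .
qed

lemma grid_density_cell: "grid_density N \<nu> y = measure \<nu> (cube (1 / real N) (cube_index (1 / real N) y)) / (1 / real N) ^ CARD('n)"
  by (rule grid_density_eq[OF N])

lemma grid_density_measurable: "grid_density N \<nu> \<in> borel_measurable borel"
  using measurable_cube_index_compose[OF side_pos, of "\<lambda>k. measure \<nu> (cube (1 / real N) k) / (1 / real N) ^ CARD('n)"]
  by (simp add: grid_density_cell[abs_def])

lemma grid_density_nonneg: "0 \<le> grid_density N \<nu> y" unfolding grid_density_cell by simp

lemma grid_density_le: "grid_density N \<nu> y \<le> T / (1 / real N) ^ CARD('n)"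
  unfolding grid_density_cell using side_pos by (intro divide_right_mono measure_\<nu>_le) auto

lemma grid_density_cong: "cube_index (1 / real N) x = cube_index (1 / real N) y \<Longrightarrow> grid_density N \<nu> x = grid_density N \<nu> y"
  by (simp only: grid_density_cell)

lemma emeasure_weighted_grid_density: "emeasure (weighted (grid_density N \<nu>)) UNIV = emeasure \<nu> UNIV"
proof -
  interpret finite_measure \<nu> by (rule finite_measure_\<nu>)
  have "emeasure (weighted (grid_density N \<nu>)) (cube (1 / real N) k) = emeasure \<nu> (cube (1 / real N) k)" for k
  proof -
    have "emeasure (weighted (grid_density N \<nu>)) (cube (1 / real N) k) = (\<integral>\<^sup>+y\<in>cube (1 / real N) k. ennreal (measure \<nu> (cube (1 / real N) k) / (1 / real N) ^ CARD('n)) \<partial>lborel)"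
      using side_pos by (subst emeasure_weighted[OF grid_density_measurable]) (auto intro!: nn_integral_cong simp: indicator_def mem_cube grid_density_cell)
    also have "\<dots> = ennreal (measure \<nu> (cube (1 / real N) k) / (1 / real N) ^ CARD('n)) * ennreal ((1 / real N) ^ CARD('n))"
      using side_pos by (simp only: nn_integral_cmult_indicator[of "cube (1 / real N) k" lborel] sets_lborel cube_borel emeasure_cube)
    also have "\<dots> = ennreal (measure \<nu> (cube (1 / real N) k))"
      using side_pos by (subst ennreal_mult'[symmetric]) auto
    finally show ?thesis by (simp add: emeasure_eq_measure)
  qed
  then show ?thesis
    using emeasure_cubes[OF side_pos sets_weighted, of "grid_density N \<nu>" UNIV] emeasure_cubes[OF side_pos \<nu>, of UNIV] by simp
qed

lemma measure_weighted_grid_density_le: "measure (weighted (grid_density N \<nu>)) E \<le> T"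
proof -
  have sp: "space (weighted (grid_density N \<nu>)) = UNIV" using sets_eq_imp_space_eq[OF sets_weighted] by simp
  have "emeasure (weighted (grid_density N \<nu>)) E \<le> emeasure (weighted (grid_density N \<nu>)) UNIV" using emeasure_space[of "weighted (grid_density N \<nu>)" E] sp by simp
  also have "\<dots> \<le> ennreal T" using mass by (simp add: emeasure_weighted_grid_density)
  finally show ?thesis unfolding measure_def using T by (intro enn2real_leI) auto
qed

text \<open>Once \<open>F\<close> is replaced by its array, \<open>\<nu>\<close> enters only through
  cell masses, each of which is volume times grid density. Cells meeting \<open>ball z R\<close> may
  stick out of it by up to \<open>d / N\<close>, hence the larger radius \<open>R'\<close>.\<close>

lemma nn_integral_le_Hoelder:
  fixes F :: "real^'n \<Rightarrow> real" and FQ :: "(real^'n) set \<Rightarrow> real" and p q R :: real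
  assumes F: "F \<in> borel_measurable borel" "\<And>y. y \<notin> ball z R \<Longrightarrow> F y = 0"
    and FQ: "\<And>Q. Q \<in> fine_grid N \<Longrightarrow> 0 \<le> FQ Q" "\<And>Q y. Q \<in> fine_grid N \<Longrightarrow> y \<in> Q \<Longrightarrow> \<bar>F y\<bar> \<le> FQ Q"
    and pq: "1 < p" "1 < q" "1 / p + 1 / q = 1" and R: "R + real CARD('n) * (1 / real N) \<le> R'"
  shows "(\<integral>\<^sup>+y. ennreal \<bar>F y\<bar> \<partial>\<nu>) \<le>
    ennreal ((\<Sum>Q | Q \<in> fine_grid N \<and> Q \<inter> ball z R \<noteq> {}. measure lborel Q * FQ Q powr p) powr (1 / p) *
      measure (weighted (\<lambda>y. grid_density N \<nu> y powr q)) (ball z R') powr (1 / q))"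
proof -
  interpret finite_measure \<nu> by (rule finite_measure_\<nu>)
  define J where "J = {Q \<in> fine_grid N. Q \<inter> ball z R \<noteq> {}}"
  have J_eq: "J = cube (1 / real N) ` cube_index (1 / real N) ` ball z R"
    unfolding J_def fine_grid_eq[OF N] by (auto simp: mem_cube)
  have finJ: "finite J" unfolding J_eq using side_pos by (intro finite_imageI finite_cells_meeting_bounded) auto
  have Jborel: "Q \<in> sets borel" if "Q \<in> J" for Q using that side_pos by (auto simp: J_eq)
  have Jgrid: "Q \<in> fine_grid N" if "Q \<in> J" for Q using that by (simp add: J_def)
  define c where "c Q = measure \<nu> Q / (1 / real N) ^ CARD('n)" for Q
  have c0: "0 \<le> c Q" for Q by (simp add: c_def)
  have vol: "measure lborel Q = (1 / real N) ^ CARD('n)" if "Q \<in> J" for Q using that side_pos by (auto simp: J_eq measure_cube)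
  have nc: "grid_density N \<nu> y = c Q" if "Q \<in> J" "y \<in> Q" for Q y using that by (auto simp: J_eq mem_cube grid_density_cell c_def)
  have "(\<integral>\<^sup>+y. ennreal \<bar>F y\<bar> \<partial>\<nu>) \<le> (\<integral>\<^sup>+y. (\<Sum>Q\<in>J. ennreal (FQ Q) * indicator Q y) \<partial>\<nu>)"
  proof (rule nn_integral_mono)
    fix y
    show "ennreal \<bar>F y\<bar> \<le> (\<Sum>Q\<in>J. ennreal (FQ Q) * indicator Q y)"
    proof (cases "y \<in> ball z R")
      case True
      define Q where "Q = cube (1 / real N) (cube_index (1 / real N) y)"
      have Q: "Q \<in> J" "y \<in> Q" using True by (auto simp: J_eq Q_def mem_cube)
      have "ennreal \<bar>F y\<bar> \<le> ennreal (FQ Q) * indicator Q y"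
        using Q Jgrid FQ by (simp add: ennreal_leI)
      also have "\<dots> \<le> (\<Sum>Q\<in>J. ennreal (FQ Q) * indicator Q y)"
        using Q finJ by (intro member_le_sum) auto
      finally show ?thesis .
    next
      case False
      then show ?thesis using F(2)[OF False] by simp
    qed
  qed
  also have "\<dots> = (\<Sum>Q\<in>J. ennreal (FQ Q) * emeasure \<nu> Q)"
    using Jborel \<nu> by (subst nn_integral_sum) (auto intro!: sum.cong nn_integral_cmult_indicator)
  also have "\<dots> = ennreal (\<Sum>Q\<in>J. FQ Q * measure \<nu> Q)"
    using FQ(1)[OF Jgrid] by (simp add: emeasure_eq_measure ennreal_mult'[symmetric] sum_ennreal)
  also have "(\<Sum>Q\<in>J. FQ Q * measure \<nu> Q) = (\<Sum>Q\<in>J. measure lborel Q * FQ Q * c Q)"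
    using side_pos by (intro sum.cong refl) (simp add: vol c_def)
  also have "ennreal \<dots> \<le> ennreal ((\<Sum>Q\<in>J. measure lborel Q * FQ Q powr p) powr (1 / p) * (\<Sum>Q\<in>J. measure lborel Q * c Q powr q) powr (1 / q))"
    using FQ(1)[OF Jgrid] c0 by (intro ennreal_leI weighted_Hoelder_sum[OF finJ pq]) auto
  also have "\<dots> \<le> ennreal ((\<Sum>Q\<in>J. measure lborel Q * FQ Q powr p) powr (1 / p) * measure (weighted (\<lambda>y. grid_density N \<nu> y powr q)) (ball z R') powr (1 / q))"
  proof (intro ennreal_leI mult_left_mono powr_mono2)
    have nq: "(\<lambda>y. grid_density N \<nu> y powr q) \<in> borel_measurable borel" using grid_density_measurable by simp
    have nqb: "grid_density N \<nu> y powr q \<le> (T / (1 / real N) ^ CARD('n)) powr q" for y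
      using grid_density_nonneg grid_density_le pq by (intro powr_mono2) auto
    have finW: "emeasure (weighted (\<lambda>y. grid_density N \<nu> y powr q)) (ball z R') < \<infinity>"
      by (rule emeasure_weighted_finite[OF nq _ nqb]) auto
    have cell: "emeasure (weighted (\<lambda>y. grid_density N \<nu> y powr q)) Q = ennreal (measure lborel Q * c Q powr q)" if Q: "Q \<in> J" for Q
    proof -
      have "emeasure (weighted (\<lambda>y. grid_density N \<nu> y powr q)) Q = (\<integral>\<^sup>+y\<in>Q. ennreal (c Q powr q) \<partial>lborel)"
        using nc[OF Q] by (subst emeasure_weighted[OF nq Jborel[OF Q]]) (auto intro!: nn_integral_cong simp: indicator_def)
      also have "\<dots> = ennreal (c Q powr q) * emeasure lborel Q"
        using Jborel[OF Q] by (intro nn_integral_cmult_indicator) simp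
      also have "emeasure lborel Q = ennreal (measure lborel Q)"
        using Q side_pos by (auto simp: J_eq emeasure_cube measure_cube)
      finally show ?thesis by (simp add: ennreal_mult'[symmetric] mult.commute)
    qed
    have "ennreal (\<Sum>Q\<in>J. measure lborel Q * c Q powr q) = (\<Sum>Q\<in>J. emeasure (weighted (\<lambda>y. grid_density N \<nu> y powr q)) Q)"
      by (subst sum_ennreal[symmetric]) (auto simp: cell)
    also have "\<dots> = emeasure (weighted (\<lambda>y. grid_density N \<nu> y powr q)) (\<Union>Q\<in>J. Q)"
      using Jborel finJ by (intro sum_emeasure) (auto simp: disjoint_family_on_def J_eq mem_cube)
    also have "\<dots> \<le> emeasure (weighted (\<lambda>y. grid_density N \<nu> y powr q)) (ball z R')"
    proof (intro emeasure_mono)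
      show "(\<Union>Q\<in>J. Q) \<subseteq> ball z R'"
      proof safe
        fix Q y assume "Q \<in> J" "y \<in> Q"
        then obtain u where u: "u \<in> ball z R" "y \<in> cube (1 / real N) (cube_index (1 / real N) u)" by (auto simp: J_eq)
        then have "y \<in> ball u (real CARD('n) * (1 / real N))" using cube_subset_ball[OF side_pos, of u] by auto
        then show "y \<in> ball z R'" using u(1) R dist_triangle[of z y u] by simp
      qed
    qed simp
    finally have "ennreal (\<Sum>Q\<in>J. measure lborel Q * c Q powr q) \<le> ennreal (measure (weighted (\<lambda>y. grid_density N \<nu> y powr q)) (ball z R'))"
      using finW by (simp add: emeasure_eq_ennreal_measure less_top)
    then show "(\<Sum>Q\<in>J. measure lborel Q * c Q powr q) \<le> measure (weighted (\<lambda>y. grid_density N \<nu> y powr q)) (ball z R')"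
      by (subst (asm) ennreal_le_iff) auto
    show "0 \<le> (\<Sum>Q\<in>J. measure lborel Q * c Q powr q)" by (intro sum_nonneg) auto
  qed (use pq in auto)
  finally show ?thesis by (simp only: J_def)
qed

end

text \<open>The constants meet here. \<open>M = 4 * d * (Cs * R + L)\<close> satisfies the Lyapunov
  condition because \<open>d \<le> d^2\<close>, and the mass bound \<open>20 * M^2 / 3\<close> has
  the factor \<open>320 / 3 \<le> 107\<close>; \<open>L \<le> R\<close> turns
  \<open>Cs * R + L\<close> into \<open>(Cs + 1) * R\<close>.\<close>

lemma coarse_green_bounds:
  fixes A :: "('n::finite) matrix_field" and Q :: "real^'n \<Rightarrow> 'n path measure" and z0 :: "real^'n"
    and \<kappa> H0 L R Cs C d q p Cm \<epsilon> :: real and N :: nat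
  assumes d_def: "d = real CARD('n)" and q_def: "q = d / (d - 1)" and p_def: "p = (q + \<epsilon>) / (q + \<epsilon> - 1)"
    and Cm_def: "Cm = 107 * d\<^sup>2 * (Cs + 1)\<^sup>2"
    and A: "positive_definite_field A" and dif: "diffusion (normalized_field A) Q"
    and RH: "reverse_Hoelder A Q \<kappa> N H0 (ball z0 (Cs * R)) L"
    and short: "short_coarse_steps A \<kappa> (ball z0 (Cs * R)) L"
    and N: "0 < N" and d2: "2 \<le> d" and Cs: "1024 \<le> Cs" and L: "1 \<le> L" "d * L \<le> R" and \<epsilon>: "0 < \<epsilon>" and C: "0 < C"
    and hi: "\<And>n :: real^'n \<Rightarrow> real. gains_integrability (1 / real N) H0 q \<epsilon> C n"
  defines "\<nu> \<equiv> green_measure A Q \<kappa> (ball z0 (Cs * R))"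
  shows green_mass: "emeasure (\<nu> x) UNIV \<le> ennreal (Cm * R\<^sup>2)"
    and green_density: "measure (weighted (\<lambda>y. grid_density N (\<nu> x) y powr (q + \<epsilon>))) (ball z0 (4 * R)) powr (1 / (q + \<epsilon>)) \<le>
      Cm * C * L powr (d / p) * R powr (2 - d / p)"
    and green_density_integrable: "(LINT y:ball z0 (2 * R)|lborel. grid_density N (\<nu> x) y powr (q + \<epsilon>)) powr (1 / (q + \<epsilon>)) \<le>
      Cm * C * L powr (d / p) * R powr (2 - d / p)"
    and green_potential: "\<And>F FQ. F \<in> borel_measurable borel \<Longrightarrow> (\<And>y. y \<notin> ball z0 (2 * R) \<Longrightarrow> F y = 0) \<Longrightarrow>
      (\<And>Q. Q \<in> fine_grid N \<Longrightarrow> 0 \<le> FQ Q) \<Longrightarrow> (\<And>Q y. Q \<in> fine_grid N \<Longrightarrow> y \<in> Q \<Longrightarrow> \<bar>F y\<bar> \<le> FQ Q) \<Longrightarrow>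
      ennreal (1 / R\<^sup>2) * (\<integral>\<^sup>+y. ennreal \<bar>F y\<bar> \<partial>\<nu> x) \<le> ennreal (Cm * C * L powr (d / p) *
        (R powr (- d) * (\<Sum>Q | Q \<in> fine_grid N \<and> Q \<inter> ball z0 (2 * R) \<noteq> {}. measure lborel Q * FQ Q powr p)) powr (1 / p))"
proof -
  define q' where "q' = q + \<epsilon>"
  define M where "M = 4 * d * (Cs * R + L)"
  have q1: "1 < q" using d2 by (simp add: q_def)
  have q': "q < q'" "1 < q'" using \<epsilon> q1 by (auto simp: q'_def)
  have p_eq: "p = q' / (q' - 1)" by (simp add: p_def q'_def)
  have p1: "1 < p" unfolding p_eq using q' by simp
  have pq: "1 / p + 1 / q' = 1" unfolding p_eq using q' by (simp add: field_simps)
  have dL: "L \<le> R" "2 \<le> R"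
  proof -
    have "2 * L \<le> d * L" using d2 L by (intro mult_right_mono) auto
    then show "L \<le> R" "2 \<le> R" using L by linarith+
  qed
  have CsRL: "0 < Cs * R + L" using Cs dL L by (intro add_pos_pos mult_pos_pos) auto
  interpret chain: killed_coarse_chain A \<kappa> Q z0 "Cs * R" L M
  proof
    show "0 < M" unfolding M_def using d2 CsRL by simp
    have "16 * d * (Cs * R + L)\<^sup>2 \<le> 16 * d * (Cs * R + L)\<^sup>2 * d"
      using d2 mult_left_mono[of 1 d "16 * d * (Cs * R + L)\<^sup>2"] by simp
    also have "\<dots> = M\<^sup>2" unfolding M_def by (simp add: power_mult_distrib power2_eq_square)
    finally show "16 * real CARD('n) * (Cs * R + L)\<^sup>2 \<le> M\<^sup>2" by (simp only: d_def)
  qed (use A dif short in auto)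
  have \<nu>: "\<nu> x = chain.green x" for x unfolding \<nu>_def by (rule chain.green_measure_eq)
  define T where "T = Cm * R\<^sup>2"
  have Cm: "0 < Cm" unfolding Cm_def using d2 Cs by simp
  have T: "0 < T" unfolding T_def using Cm dL by simp
  have mass: "emeasure (chain.green x) UNIV \<le> ennreal T" for x
  proof -
    have "Cs * R + L \<le> (Cs + 1) * R" using dL by (simp add: distrib_right)
    then have "(Cs * R + L)\<^sup>2 \<le> ((Cs + 1) * R)\<^sup>2" using CsRL by (intro power_mono) auto
    then have "320 / 3 * d\<^sup>2 * (Cs * R + L)\<^sup>2 \<le> 107 * d\<^sup>2 * ((Cs + 1) * R)\<^sup>2"
      by (intro mult_mono) auto
    then have "20 * M\<^sup>2 / 3 \<le> T" by (simp add: M_def T_def Cm_def power_mult_distrib)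
    then show ?thesis using order_trans[OF chain.emeasure_green_UNIV_le ennreal_leI] by blast
  qed
  then show "emeasure (\<nu> x) UNIV \<le> ennreal (Cm * R\<^sup>2)" by (simp add: \<nu> T_def)
  note dens = chain.sets_green N less_imp_le[OF T] mass
  \<comment> \<open>From \<open>d / q = d - 1\<close> and \<open>d / p + d / q' = d\<close>: the
    exponents of the abstract gain in terms of \<open>p\<close>.\<close>
  have dq: "d / q - d / q' = d / p - 1" "d / q' - d = - (d / p)"
  proof -
    have "d / q = d - 1" using d2 by (simp add: q_def)
    moreover have "d * (1 / p + 1 / q') = d" by (simp add: pq)
    then have "d / p + d / q' = d" by (simp add: distrib_left)
    ultimately show "d / q - d / q' = d / p - 1" "d / q' - d = - (d / p)" by auto
  qed
  have density: "measure (weighted (\<lambda>y. grid_density N (chain.green x) y powr q')) (ball z0 (4 * R)) powr (1 / q') \<le>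
      Cm * C * L powr (d / p) * R powr (2 - d / p)" for x
  proof -
    have "measure (weighted (\<lambda>y. grid_density N (chain.green x) y powr q')) (ball z0 (4 * R)) powr (1 / q') \<le>
        C * L powr (d / q - d / q') * R powr (d / q' - d) * T"
      unfolding q'_def d_def
    proof (rule hi[unfolded gains_integrability_def, THEN spec[where x="T / (1 / real N) ^ CARD('n)"], THEN spec[where x=z0],
          THEN spec[where x=R], THEN spec[where x=L], THEN spec[where x=T], THEN mp], intro conjI allI impI)
      show "1 \<le> L" "real CARD('n) * L \<le> R" using L by (simp_all add: d_def)
      show "grid_density N (chain.green x) \<in> borel_measurable borel" by (rule grid_density_measurable[OF dens])
      show "0 \<le> grid_density N (chain.green x) y" for y by (rule grid_density_nonneg[OF dens])
      show "grid_density N (chain.green x) y \<le> T / (1 / real N) ^ CARD('n)" for y by (rule grid_density_le[OF dens])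
      show "grid_density N (chain.green x) y = grid_density N (chain.green x) y'"
        if "cube_index (1 / real N) y = cube_index (1 / real N) y'" for y y' by (rule grid_density_cong[OF dens that])
      show "0 < T" by (rule T)
      show "measure (weighted (grid_density N (chain.green x))) (ball z0 (1024 * R)) \<le> T"
        by (rule measure_weighted_grid_density_le[OF dens])
      show "average (ball y r) (\<lambda>y. grid_density N (chain.green x) y powr q) powr (1 / q)
          \<le> H0 * average (ball y (16 * r)) (grid_density N (chain.green x))"
        if r': "L \<le> r \<and> ball y (16 * r) \<subseteq> ball z0 (1024 * R)" for y r
      proof -
        note r = r'[THEN conjunct1] r'[THEN conjunct2]
        have "ball z0 (1024 * R) \<subseteq> ball z0 (Cs * R)" using Cs dL by (intro subset_ball mult_right_mono) auto
        then have sub: "ball y (16 * r) \<subseteq> ball z0 (Cs * R)" using r(2) by (rule subset_trans[rotated])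
        have "sets (chain.green x) = sets borel \<and> locally_finite (chain.green x) \<and>
          (\<forall>\<phi>. C2_compact (ball z0 (Cs * R)) \<phi> \<and> (\<forall>y. 0 \<le> \<phi> y) \<longrightarrow>
             integrable (chain.green x) (coarse_generator A Q \<kappa> \<phi>) \<and> (LINT y|chain.green x. coarse_generator A Q \<kappa> \<phi> y) \<le> 0)"
          by (intro conjI allI impI chain.sets_green chain.green_locally_finite chain.green_supersolution) auto
        then show ?thesis
          using RH r(1) sub unfolding reverse_Hoelder_def Let_def q_def d_def by blast
      qed
    qed
    also have "\<dots> = Cm * C * L powr (d / p - 1) * R powr (2 - d / p)"
    proof -
      have "R powr (2 - d / p) = R\<^sup>2 * R powr (- (d / p))"
        using dL by (simp add: powr_diff powr_minus divide_inverse powr_numeral)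
      then show ?thesis by (simp add: dq T_def)
    qed
    \<comment> \<open>\<open>1 \<le> L\<close> weakens the exponent \<open>d / p - 1\<close> to the
      stated \<open>d / p\<close>.\<close>
    also have "\<dots> \<le> Cm * C * L powr (d / p) * R powr (2 - d / p)"
      using Cm C L by (intro mult_right_mono mult_left_mono powr_mono) auto
    finally show ?thesis .
  qed
  then show "measure (weighted (\<lambda>y. grid_density N (\<nu> x) y powr (q + \<epsilon>))) (ball z0 (4 * R)) powr (1 / (q + \<epsilon>)) \<le>
      Cm * C * L powr (d / p) * R powr (2 - d / p)"
    by (simp add: \<nu> q'_def)
  show "(LINT y:ball z0 (2 * R)|lborel. grid_density N (\<nu> x) y powr (q + \<epsilon>)) powr (1 / (q + \<epsilon>)) \<le>
      Cm * C * L powr (d / p) * R powr (2 - d / p)"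
  proof -
    let ?f = "\<lambda>y. grid_density N (chain.green x) y powr q'"
    have f: "?f \<in> borel_measurable borel" using grid_density_measurable[OF dens, of x] by simp
    have fb: "?f y \<le> (T / (1 / real N) ^ CARD('n)) powr q'" for y
      using grid_density_nonneg[OF dens, of x y] grid_density_le[OF dens, of x y] q' by (intro powr_mono2) auto
    have "emeasure (weighted ?f) (ball z0 (4 * R)) < \<infinity>"
      by (rule emeasure_weighted_finite[OF f _ fb]) auto
    then have "measure (weighted ?f) (ball z0 (2 * R)) \<le> measure (weighted ?f) (ball z0 (4 * R))"
      using dL by (intro measure_mono_fmeasurable subset_ball) (auto simp: fmeasurable_def)
    then have "measure (weighted ?f) (ball z0 (2 * R)) powr (1 / q') \<le> measure (weighted ?f) (ball z0 (4 * R)) powr (1 / q')"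
      using q' by (intro powr_mono2) auto
    then show ?thesis
      using density[of x] set_integral_eq_measure_weighted[OF f, of "ball z0 (2 * R)"] by (simp add: \<nu> q'_def)
  qed
  fix F :: "real^'n \<Rightarrow> real" and FQ
  assume F: "F \<in> borel_measurable borel" "\<And>y. y \<notin> ball z0 (2 * R) \<Longrightarrow> F y = 0"
    and FQ: "\<And>Q. Q \<in> fine_grid N \<Longrightarrow> 0 \<le> FQ Q" "\<And>Q y. Q \<in> fine_grid N \<Longrightarrow> y \<in> Q \<Longrightarrow> \<bar>F y\<bar> \<le> FQ Q"
  define \<Sigma> where "\<Sigma> = (\<Sum>Q | Q \<in> fine_grid N \<and> Q \<inter> ball z0 (2 * R) \<noteq> {}. measure lborel Q * FQ Q powr p)"
  have \<Sigma>: "0 \<le> \<Sigma>" unfolding \<Sigma>_def by (intro sum_nonneg) auto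
  \<comment> \<open>The density is bounded on \<open>4 * R\<close> to leave room for this: cells
    meeting the source ball stick out by at most \<open>d / N \<le> d * L \<le> R\<close>.\<close>
  have cells: "2 * R + real CARD('n) * (1 / real N) \<le> 4 * R"
  proof -
    have "d * (1 / real N) \<le> d * 1" using N d2 by (intro mult_left_mono) auto
    also have "\<dots> \<le> d * L" using d2 L by (intro mult_left_mono) auto
    finally show ?thesis using L dL by (simp add: d_def)
  qed
  have "ennreal (1 / R\<^sup>2) * (\<integral>\<^sup>+y. ennreal \<bar>F y\<bar> \<partial>chain.green x) \<le>
      ennreal (1 / R\<^sup>2) * ennreal (\<Sigma> powr (1 / p) * measure (weighted (\<lambda>y. grid_density N (chain.green x) y powr q')) (ball z0 (4 * R)) powr (1 / q'))"
    unfolding \<Sigma>_def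
    by (intro mult_left_mono nn_integral_le_Hoelder[OF dens F FQ p1 q'(2) pq cells]) auto
  also have "\<dots> \<le> ennreal (1 / R\<^sup>2) * ennreal (\<Sigma> powr (1 / p) * (Cm * C * L powr (d / p) * R powr (2 - d / p)))"
    by (intro mult_left_mono ennreal_leI density) auto
  also have "\<dots> = ennreal (1 / R\<^sup>2 * (\<Sigma> powr (1 / p) * (Cm * C * L powr (d / p) * R powr (2 - d / p))))"
    by (rule ennreal_mult'[symmetric]) simp
  also have "1 / R\<^sup>2 * (\<Sigma> powr (1 / p) * (Cm * C * L powr (d / p) * R powr (2 - d / p))) =
      Cm * C * L powr (d / p) * (R powr (- d) * \<Sigma>) powr (1 / p)"
  proof -
    have e1: "R powr (2 - d / p) / R\<^sup>2 = (R powr (- d)) powr (1 / p)"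
    proof -
      have "R powr (2 - d / p) = R\<^sup>2 * R powr (- (d / p))"
        using dL by (simp add: powr_diff powr_minus divide_inverse powr_numeral)
      moreover have "(R powr (- d)) powr (1 / p) = R powr (- (d / p))" by (simp add: powr_powr)
      ultimately show ?thesis using dL by simp
    qed
    have e2: "(R powr (- d) * \<Sigma>) powr (1 / p) = (R powr (- d)) powr (1 / p) * \<Sigma> powr (1 / p)"
      by (rule powr_mult)
    show ?thesis unfolding e2 e1[symmetric] by (simp add: mult_ac)
  qed
  finally show "ennreal (1 / R\<^sup>2) * (\<integral>\<^sup>+y. ennreal \<bar>F y\<bar> \<partial>\<nu> x) \<le> ennreal (Cm * C * L powr (d / p) *
        (R powr (- d) * (\<Sum>Q | Q \<in> fine_grid N \<and> Q \<inter> ball z0 (2 * R) \<noteq> {}. measure lborel Q * FQ Q powr p)) powr (1 / p))"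
    by (simp add: \<nu> \<Sigma>_def)
qed

text \<open>The gain, and with it \<open>p\<close>, is fixed from the dimension and
  \<open>H0\<close> before the events, \<open>v\<close> and \<open>R\<close> appear. For given
  \<open>R\<close> the exceptional null set precedes poles and sources, because the estimates in a
  single environment hold for all of them at once.\<close>

theorem proposition5p10:
  fixes P :: "(real^'n \<Rightarrow> real^'n^'n) measure"
    and PX :: "(real^'n \<Rightarrow> real^'n^'n) \<Rightarrow> real^'n \<Rightarrow> (real \<Rightarrow> real^'n) measure"
    and \<kappa> H0 \<eta>0 :: real and N0 :: nat
  assumes dim: "CARD('n) \<ge> 2"
    and prob: "prob_space P" and sets_P: "sets P = sets matrix_field_space"
    and env: "H1 P" "H2 P" "H3 P" "H4 P" "H5 P"
    and kappa: "0 < \<kappa>" "exponential_cluster_tail P \<kappa>"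
    and quenched: "AE A in P. diffusion (normalized_field A) (PX A)"
    and grid: "0 < N0" "1 / real N0 * sqrt (real CARD('n)) \<le> (\<kappa> / real CARD('n)) / 8"
    and eta: "0 < \<eta>0"
  shows "\<exists>p. max 1 (real CARD('n) / 2) < p \<and> p < real CARD('n) \<and>
    (\<exists>C0\<le>1024. \<forall>Cs\<ge>C0. \<forall>z0 G. good_events P PX \<kappa> N0 H0 \<eta>0 Cs z0 G \<longrightarrow>
      (\<forall>v. 0 < v \<and> v \<le> 1 / 2 \<longrightarrow> (\<exists>C>0. \<exists>R1>0. \<forall>R\<ge>R1. AE A in P. A \<in> G R v \<longrightarrow>
        (let d = real CARD('n); q' = p / (p - 1); L = R powr v;
             \<nu> = green_measure A (PX A) \<kappa> (ball z0 (Cs * R))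
         in (\<forall>x\<in>ball z0 R.
               emeasure (\<nu> x) UNIV \<le> ennreal (C * R^2) \<and>
               (LINT y:ball z0 (2 * R)|lborel. grid_density N0 (\<nu> x) y powr q') powr (1 / q')
                 \<le> C * L powr (d / p) * R powr (2 - d / p)) \<and>
            (\<forall>F FQ. F \<in> borel_measurable borel \<and> (\<forall>y. y \<notin> ball z0 (2 * R) \<longrightarrow> F y = (0::real)) \<and>
               (\<forall>Q\<in>fine_grid N0. 0 \<le> FQ Q \<and> (\<forall>y\<in>Q. \<bar>F y\<bar> \<le> FQ Q)) \<longrightarrow>
               ennreal (1 / R^2) * (SUP x\<in>ball z0 R. \<integral>\<^sup>+y. ennreal \<bar>F y\<bar> \<partial>\<nu> x)
                 \<le> ennreal (C * L powr (d / p) *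
                     (R powr (- d) * (\<Sum>Q | Q \<in> fine_grid N0 \<and> Q \<inter> ball z0 (2 * R) \<noteq> {}.
                        measure lborel Q * FQ Q powr p)) powr (1 / p)))))))"
proof -
  define d where "d = real CARD('n)"
  define q where "q = d / (d - 1)"
  have d2: "2 \<le> d" using dim by (simp add: d_def)
  have q1: "1 < q" using d2 by (simp add: q_def)
  have h: "0 < 1 / real N0" "1 / real N0 \<le> 1" using grid(1) by auto
  obtain \<epsilon>0 where \<epsilon>0: "0 < \<epsilon>0"
    and hi: "\<And>\<epsilon>. 0 < \<epsilon> \<Longrightarrow> \<epsilon> \<le> \<epsilon>0 \<Longrightarrow> \<exists>C>0. \<forall>n :: real^'n \<Rightarrow> real. gains_integrability (1 / real N0) H0 q \<epsilon> C n"
    using grid_higher_integrability[OF q1 h, of H0] by blast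
  \<comment> \<open>The second bound keeps \<open>d / 2 < p\<close>. For \<open>d > 2\<close> this
    amounts to \<open>(q + \<epsilon> - 1) * (d - 2) < 2\<close>; with
    \<open>q - 1 = 1 / (d - 1)\<close> the left side is at most a sum of two terms below 1.\<close>
  define \<epsilon> where "\<epsilon> = min \<epsilon>0 (1 / d\<^sup>2)"
  have \<epsilon>: "0 < \<epsilon>" "\<epsilon> \<le> \<epsilon>0" "\<epsilon> \<le> 1 / d\<^sup>2" using \<epsilon>0 d2 by (auto simp: \<epsilon>_def)
  obtain C where C: "0 < C" and hiC: "\<And>n :: real^'n \<Rightarrow> real. gains_integrability (1 / real N0) H0 q \<epsilon> C n"
    using hi[OF \<epsilon>(1,2)] by blast
  define p where "p = (q + \<epsilon>) / (q + \<epsilon> - 1)"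
  have q_minus: "q - 1 = 1 / (d - 1)" using d2 by (simp add: q_def field_simps)
  have pos: "0 < q + \<epsilon> - 1" using q1 \<epsilon> by simp
  have p_eq: "p = 1 + 1 / (q + \<epsilon> - 1)" unfolding p_def using pos by (simp add: field_simps)
  have conj: "p / (p - 1) = q + \<epsilon>" unfolding p_eq using pos by (simp add: field_simps)
  have p1: "1 < p" unfolding p_eq using pos by simp
  have pd: "p < d"
  proof -
    have "1 / (q + \<epsilon> - 1) < 1 / (q - 1)" using q1 \<epsilon> by (intro divide_strict_left_mono) auto
    also have "1 / (q - 1) = d - 1" unfolding q_minus by simp
    finally show ?thesis unfolding p_eq by simp
  qed
  have pd2: "d / 2 < p"
  proof (cases "d = 2")
    case True then show ?thesis using p1 by simp
  next
    case False
    then have d: "0 < d - 2" using d2 by simp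
    have "(q + \<epsilon> - 1) * (d - 2) \<le> (1 / (d - 1) + 1 / d\<^sup>2) * (d - 2)"
      using \<epsilon> q_minus d by (intro mult_right_mono) auto
    also have "\<dots> = (d - 2) / (d - 1) + (d - 2) / d\<^sup>2" by (simp add: distrib_right)
    also have "\<dots> < 1 + 1"
    proof (intro add_strict_mono)
      show "(d - 2) / (d - 1) < 1" using d by (simp add: divide_less_eq)
      have "d * 1 \<le> d * d" using d2 by (intro mult_left_mono) auto
      then have "d - 2 < d\<^sup>2" by (simp add: power2_eq_square)
      then show "(d - 2) / d\<^sup>2 < 1" using d2 by (simp add: divide_less_eq)
    qed
    finally have "(d - 2) / 2 < 1 / (q + \<epsilon> - 1)" using pos by (simp add: field_simps)
    then show ?thesis unfolding p_eq by (simp add: diff_divide_distrib)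
  qed
  show ?thesis
  proof (rule exI[of _ p], rule conjI, goal_cases)
    case 1
    show ?case using p1 pd2 by (simp add: d_def)
  next
    case 2
    have p_less: "p < real CARD('n)" using pd by (simp add: d_def)
    show ?case
    proof (rule conjI[OF p_less], rule exI[of _ "1024 :: real"], rule conjI[OF order_refl], intro allI impI, goal_cases)
      \<comment> \<open>The witness 1024 is the radius factor in \<open>gains_integrability\<close>:
        that ball has to fit into the killing domain.\<close>
      case (1 Cs z0 G v)
      then have Cs: "1024 \<le> Cs" and good: "good_events P PX \<kappa> N0 H0 \<eta>0 Cs z0 G" and v: "0 < v" "v \<le> 1 / 2" by auto
      obtain R0 where R0: "0 < R0" "\<And>R. R0 \<le> R \<Longrightarrow> AE A in P. A \<in> G R v \<longrightarrow>
             reverse_Hoelder A (PX A) \<kappa> N0 H0 (ball z0 (Cs * R)) (R powr v) \<and>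
             short_coarse_steps A \<kappa> (ball z0 (Cs * R)) (R powr v)"
        using good v unfolding good_events_def by meson
      define Cm where "Cm = 107 * d\<^sup>2 * (Cs + 1)\<^sup>2"
      \<comment> \<open>One constant for the mass, which needs \<open>Cm\<close>, and for density
        and sources, which need \<open>Cm * C\<close>.\<close>
      define C' where "C' = Cm * max 1 C"
      \<comment> \<open>With \<open>d^2 \<le> R\<close> and \<open>v \<le> 1 / 2\<close>, both
        \<open>d\<close> and \<open>L\<close> are at most the square root of \<open>R\<close>, so
        that \<open>d * L \<le> R\<close>.\<close>
      define R1 where "R1 = max R0 (d\<^sup>2)"
      have Cm: "0 < Cm" unfolding Cm_def using d2 Cs by simp
      have C': "0 < C'" "Cm \<le> C'" "Cm * C \<le> C'"
        unfolding C'_def using Cm by (auto intro: mult_left_mono simp: mult_le_cancel_left1)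
      have R1: "0 < R1" using R0(1) by (simp add: R1_def)
      \<comment> \<open>Continuity comes from the sample space itself, positivity from
        \<open>H1\<close>.\<close>
      have PD: "AE A in P. positive_definite_field A"
      proof -
        have sp: "space P = symmetric_fields"
        proof -
          have "{U. openin locally_uniform_topology U} \<subseteq> Pow (symmetric_fields :: 'n matrix_field set)"
            using openin_subset by (fastforce simp: locally_uniform_topology_def)
          then show ?thesis
            using sets_eq_imp_space_eq[OF sets_P] by (simp add: matrix_field_space_def space_measure_of)
        qed
        show ?thesis
          using env(1)[unfolded H1_def] AE_space
          by eventually_elim (auto simp: positive_definite_field_def sp symmetric_fields_def)
      qed
      show ?case
      proof (rule exI[of _ C'], rule conjI[OF C'(1)], rule exI[of _ R1], rule conjI[OF R1], intro allI impI, goal_cases)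
        case (1 R)
        then have R: "R0 \<le> R" "d\<^sup>2 \<le> R" by (auto simp: R1_def)
        define L where "L = R powr v"
        have "2\<^sup>2 \<le> d\<^sup>2" using d2 by (intro power_mono) auto
        then have Rge: "1 \<le> R" using R by simp
        have L1: "1 \<le> L" unfolding L_def using Rge v by (intro ge_one_powr_ge_zero) auto
        have dL: "d * L \<le> R"
        proof -
          have "d = sqrt (d\<^sup>2)" using d2 by simp
          also have "\<dots> \<le> sqrt R" using R by (intro real_sqrt_le_mono)
          finally have "d \<le> R powr (1/2)" using Rge by (simp add: powr_half_sqrt)
          moreover have "L \<le> R powr (1/2)" unfolding L_def using Rge v by (intro powr_mono) auto
          ultimately have "d * L \<le> R powr (1/2) * R powr (1/2)" using L1 by (intro mult_mono) auto
          also have "\<dots> = R" using Rge by (simp add: powr_add[symmetric])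
          finally show ?thesis .
        qed
        \<comment> \<open>Three almost sure properties are intersected; from here on the argument is
          deterministic in the environment.\<close>
        show ?case (is "AE A in P. _ \<longrightarrow> ?concl A")
          using quenched PD R0(2)[OF R(1)]
        proof eventually_elim
          case (elim A)
          show ?case
          proof (intro impI)
            assume "A \<in> G R v"
            then have RH: "reverse_Hoelder A (PX A) \<kappa> N0 H0 (ball z0 (Cs * R)) L"
              and short: "short_coarse_steps A \<kappa> (ball z0 (Cs * R)) L"
              using elim by (auto simp: L_def)
            note bounds = coarse_green_bounds[OF d_def q_def p_def Cm_def elim(2,1) RH short grid(1) d2 Cs L1 dL \<epsilon>(1) C hiC]
            define \<nu> where "\<nu> = green_measure A (PX A) \<kappa> (ball z0 (Cs * R))"
            note bounds = bounds[folded \<nu>_def]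
            have mass: "emeasure (\<nu> x) UNIV \<le> ennreal (C' * R\<^sup>2)" for x
              by (rule order_trans[OF bounds(1)]) (use C' in \<open>auto intro!: ennreal_leI mult_right_mono\<close>)
            have dens: "(LINT y:ball z0 (2 * R)|lborel. grid_density N0 (\<nu> x) y powr (q + \<epsilon>)) powr (1 / (q + \<epsilon>))
                \<le> C' * L powr (d / p) * R powr (2 - d / p)" for x
              by (rule order_trans[OF bounds(3)]) (use C' in \<open>auto intro!: mult_right_mono\<close>)
            let ?bound = "\<lambda>c FQ. ennreal (c * L powr (d / p) *
                       (R powr (- d) * (\<Sum>Q | Q \<in> fine_grid N0 \<and> Q \<inter> ball z0 (2 * R) \<noteq> {}.
                          measure lborel Q * FQ Q powr p)) powr (1 / p))"
            have pot: "ennreal (1 / R^2) * (SUP x\<in>ball z0 R. \<integral>\<^sup>+y. ennreal \<bar>F y\<bar> \<partial>\<nu> x) \<le> ?bound C' FQ"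
              if F: "F \<in> borel_measurable borel \<and> (\<forall>y. y \<notin> ball z0 (2 * R) \<longrightarrow> F y = (0::real)) \<and>
                 (\<forall>Q\<in>fine_grid N0. 0 \<le> FQ Q \<and> (\<forall>y\<in>Q. \<bar>F y\<bar> \<le> FQ Q))" for F FQ
              unfolding SUP_mult_left_ennreal
            proof (rule SUP_least)
              fix x
              have "ennreal (1 / R^2) * (\<integral>\<^sup>+y. ennreal \<bar>F y\<bar> \<partial>\<nu> x) \<le> ?bound (Cm * C) FQ"
                by (rule bounds(4)) (use F in blast)+
              also have "\<dots> \<le> ?bound C' FQ"
                using C' by (intro ennreal_leI mult_right_mono) auto
              finally show "ennreal (1 / R^2) * (\<integral>\<^sup>+y. ennreal \<bar>F y\<bar> \<partial>\<nu> x) \<le> ?bound C' FQ" .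
            qed
            show "?concl A"
              unfolding Let_def conj \<nu>_def[symmetric] d_def[symmetric] L_def[symmetric]
              by (intro conjI ballI allI impI mass dens pot) blast+
          qed
        qed
      qed
    qed
  qed
qed

end
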